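(* The second-order field $\Gamma$ represents (locally) a dissipative system, i.e. there exist (locally) a regular function $L$ and a function $D$ such that the equations $$\frac{d}{dt}\left(\frac{\partial L}{\partial \dot q^i}\right)-\frac{\partial L}{\partial q^i}=\frac{\partial D}{\partial \dot q^i}$$ are equivalent to $\ddot q^i=f^i(q,\dot q)$, if and only if there exist (locally) a function $D$ and a non-singular symmetric type $(0,2)$ tensor field $g$ along $\tau$ such that $D^V g$ is symmetric and $g$ and $D$ further satisfy $$\nabla g = D^V D^V D,\qquad \Phi\lrcorner g-(\Phi\lrcorner g)^T = d^V d^H D,$$ where $\Phi$ is the Jacobi endomorphism of $\Gamma$.
   Context: All objects are smooth; the summation convention is used. $Q$ is an $n$-dimensional manifold, $\tau:TQ\to Q$ its tangent bundle, with local coordinates $q^i$ on $Q$ and induced coordinates $(q^i,v^i)$ on $TQ$ ($v^i=\dot q^i$ along curves). $\Gamma=v^i\frac{\partial}{\partial q^i}+f^i(q,v)\frac{\partial}{\partial v^i}$ is a given second-order vector field on $TQ$, corresponding to $\ddot q^i=f^i(q,\dot q)$. Two systems of equations are equivalent if they have the same solutions. A function $L$ is regular if the matrix $\left(\frac{\partial^2L}{\partial v^i\partial v^j}\right)$ is everywhere non-singular. "Locally" means: every point of $Q$ has an open neighbourhood $U$ such that the objects in question exist on $TU$ (tensor fields along $\tau|_{TU}$). Tensor fields and forms along $\tau$ are sections over $TQ$ of the pull-backs by $\tau$ of the tensor/exterior bundles of $Q$; in coordinates they are expressed in terms of $\frac{\partial}{\partial q^i}$, $dq^i$ with coefficients that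 are functions on $TQ$. Put $\Gamma^j_i=-\frac12\frac{\partial f^j}{\partial v^i}$, $V_i=\frac{\partial}{\partial v^i}$, $H_i=\frac{\partial}{\partial q^i}-\Gamma^j_i\frac{\partial}{\partial v^j}$. Exterior derivatives: $d^V,d^H$ are the degree 1 derivations of the algebra of forms along $\tau$ determined by $d^VF=V_i(F)dq^i$, $d^HF=H_i(F)dq^i$ for $F\in C^\infty(TQ)$, and $d^V dq^i=d^Hdq^i=0$. Covariant derivatives: for $X=X^i\frac{\partial}{\partial q^i}$ along $\tau$, $D^V_X$ is the degree 0 tensor derivation with $D^V_XF=X^iV_i(F)$, $D^V_X\frac{\partial}{\partial q^i}=0$, $D^V_Xdq^i=0$. For a tensor field $T$ along $\tau$, $D^VT(X,\ldots)=(D^V_XT)(\ldots)$; thus $D^VD^VD$ has components $V_iV_j(D)$. "$D^Vg$ is symmetric" means $(D^V_Xg)(Y,Z)$ is symmetric in all its arguments. Dynamical covariant derivative: $\nabla$ is the degree 0 tensor derivation with $\nabla F=\Gamma(F)$, $\nabla\frac{\partial}{\partial q^j}=\Gamma^i_j\frac{\partial}{\partial q^i}$, $\nabla dq^i=-\Gamma^i_jdq^j$. Jacobi endomorphism: the type $(1,1)$ tensor field $\Phi=\Phi^i_j\,dq^j\otimes\frac{\partial}{\partial q^i}$ along $\tau$ with $\Phi^i_j=-\frac{\partial f^i}{\partial q^j}-\Gamma^k_j\Gamma^i_k-\Gamma(\Gamma^i_j)$. $(\Phi\lrcorner g-(\Phi\lrcorner g)^T)(X,Y):=g(\Phi X,Y)-g(X,\Phi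 Y)$. *)

theory Defs
  imports "HOL-Analysis.Analysis"
begin

section \<open>Smooth maps between open subsets of Euclidean spaces\<close>

text \<open>Meant for open \<open>S\<close>: the derivatives are unrestricted ones.\<close>

primrec Ck_on :: "nat \<Rightarrow> 'a set \<Rightarrow> ('a::real_normed_vector \<Rightarrow> 'b::real_normed_vector) \<Rightarrow> bool" where
  "Ck_on 0 S f \<longleftrightarrow> continuous_on S f"
| "Ck_on (Suc k) S f \<longleftrightarrow>
     (\<forall>x\<in>S. f differentiable (at x)) \<and> (\<forall>v. Ck_on k S (\<lambda>x. frechet_derivative f (at x) v))"

definition smooth_on :: "'a set \<Rightarrow> ('a::real_normed_vector \<Rightarrow> 'b::real_normed_vector) \<Rightarrow> bool" where
  "smooth_on S f \<longleftrightarrow> (\<forall>k. Ck_on k S f)"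


section \<open>Manifolds and tangent bundles\<close>

datatype ('p, 'e) chart = Chart (chart_dom: "'p set") (chart_map: "'p \<Rightarrow> 'e")

definition chart_inv :: "('p, 'e) chart \<Rightarrow> 'e \<Rightarrow> 'p" where
  "chart_inv \<phi> = the_inv_into (chart_dom \<phi>) (chart_map \<phi>)"

definition chart_image :: "('p, 'e) chart \<Rightarrow> 'p set \<Rightarrow> 'e set" where
  "chart_image \<phi> S = chart_map \<phi> ` (chart_dom \<phi> \<inter> S)"

definition coord_change :: "('p, 'e) chart \<Rightarrow> ('p, 'e) chart \<Rightarrow> 'e \<Rightarrow> 'e" where
  "coord_change \<phi> \<psi> = chart_map \<psi> \<circ> chart_inv \<phi>"

definition smooth_atlas :: "('p::topological_space, 'e::euclidean_space) chart set \<Rightarrow> bool" where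
  "smooth_atlas A \<longleftrightarrow>
     (\<Union>\<phi>\<in>A. chart_dom \<phi>) = UNIV \<and>
     (\<forall>\<phi>\<in>A. open (chart_dom \<phi>) \<and> open (chart_map \<phi> ` chart_dom \<phi>) \<and>
        homeomorphism (chart_dom \<phi>) (chart_map \<phi> ` chart_dom \<phi>) (chart_map \<phi>) (chart_inv \<phi>)) \<and>
     (\<forall>\<phi>\<in>A. \<forall>\<psi>\<in>A. smooth_on (chart_image \<phi> (chart_dom \<psi>)) (coord_change \<phi> \<psi>))"

text \<open>
  A tangent vector at \<open>p\<close> is the family of its coordinate vectors in all charts around \<open>p\<close>, related
  by the Jacobians of the coordinate changes; the value \<open>0\<close> on all other arguments makes the
  family unique. Only the atlas enters, so that the construction can be applied again to the
  tangent bundle.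
\<close>

type_synonym ('p, 'e) tvec = "('p, 'e) chart \<Rightarrow> 'e"
type_synonym ('p, 'e) tpoint = "'p \<times> ('p, 'e) tvec"

definition tangent_space ::
  "('p, 'e::euclidean_space) chart set \<Rightarrow> 'p \<Rightarrow> ('p, 'e) tvec set" where
  "tangent_space A p = {\<xi>.
     (\<forall>\<phi>\<in>A. \<forall>\<psi>\<in>A. p \<in> chart_dom \<phi> \<longrightarrow> p \<in> chart_dom \<psi> \<longrightarrow>
        \<xi> \<psi> = frechet_derivative (coord_change \<phi> \<psi>) (at (chart_map \<phi> p)) (\<xi> \<phi>)) \<and>
     (\<forall>\<phi>. \<not> (\<phi> \<in> A \<and> p \<in> chart_dom \<phi>) \<longrightarrow> \<xi> \<phi> = 0)}"

definition tangent_bundle ::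
  "('p, 'e::euclidean_space) chart set \<Rightarrow> 'p set \<Rightarrow> ('p, 'e) tpoint set" where
  "tangent_bundle A U = Sigma U (tangent_space A)"

text \<open>The induced chart \<open>(q, v)\<close> on the part of the tangent bundle over the domain of \<open>\<phi>\<close>.\<close>

definition tangent_chart ::
  "('p, 'e::euclidean_space) chart set \<Rightarrow> ('p, 'e) chart \<Rightarrow> (('p, 'e) tpoint, 'e \<times> 'e) chart" where
  "tangent_chart A \<phi> =
     Chart (tangent_bundle A (chart_dom \<phi>)) (\<lambda>w. (chart_map \<phi> (fst w), snd w \<phi>))"

definition tangent_atlas ::
  "('p, 'e::euclidean_space) chart set \<Rightarrow> (('p, 'e) tpoint, 'e \<times> 'e) chart set" where
  "tangent_atlas A = tangent_chart A ` A"

definition smooth_function ::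
  "('p, 'e::euclidean_space) chart set \<Rightarrow> 'p set \<Rightarrow> ('p \<Rightarrow> real) \<Rightarrow> bool" where
  "smooth_function A S F \<longleftrightarrow> (\<forall>\<phi>\<in>A. smooth_on (chart_image \<phi> S) (F \<circ> chart_inv \<phi>))"

definition smooth_vector_field ::
  "('p, 'e::euclidean_space) chart set \<Rightarrow> 'p set \<Rightarrow> ('p \<Rightarrow> ('p, 'e) tvec) \<Rightarrow> bool" where
  "smooth_vector_field A S X \<longleftrightarrow>
     (\<forall>p\<in>S. X p \<in> tangent_space A p) \<and>
     (\<forall>\<phi>\<in>A. smooth_on (chart_image \<phi> S) (\<lambda>x. X (chart_inv \<phi> x) \<phi>))"


section \<open>Second-order fields\<close>

type_synonym ('q, 'n) tq = "('q, real^'n) tpoint"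
type_synonym 'n tcoords = "(real^'n) \<times> (real^'n)"
type_synonym ('q, 'n) tq_field = "('q, 'n) tq \<Rightarrow> (('q, 'n) tq, 'n tcoords) tvec"

definition second_order_field ::
  "('q, real^'n) chart set \<Rightarrow> ('q, 'n::finite) tq_field \<Rightarrow> bool" where
  "second_order_field A \<Gamma> \<longleftrightarrow>
     smooth_vector_field (tangent_atlas A) (tangent_bundle A UNIV) \<Gamma> \<and>
     (\<forall>\<phi>\<in>A. \<forall>w\<in>tangent_bundle A (chart_dom \<phi>). fst (\<Gamma> w (tangent_chart A \<phi>)) = snd w \<phi>)"

text \<open>The coefficients \<open>f\<^sup>i(q, v)\<close> of \<open>\<Gamma>\<close> in the coordinates induced by \<open>\<phi>\<close>.\<close>

definition sode_coeff ::
  "('q, real^'n) chart set \<Rightarrow> ('q, 'n::finite) tq_field \<Rightarrow> ('q, real^'n) chart \<Rightarrow>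
   'n tcoords \<Rightarrow> real^'n" where
  "sode_coeff A \<Gamma> \<phi> z = snd (\<Gamma> (chart_inv (tangent_chart A \<phi>) z) (tangent_chart A \<phi>))"

definition fun_coord ::
  "('q, real^'n) chart set \<Rightarrow> (('q, 'n::finite) tq \<Rightarrow> real) \<Rightarrow> ('q, real^'n) chart \<Rightarrow>
   'n tcoords \<Rightarrow> real" where
  "fun_coord A F \<phi> = F \<circ> chart_inv (tangent_chart A \<phi>)"


section \<open>Type (0,2) tensor fields along the tangent bundle projection\<close>

type_synonym ('q, 'n) tensor02 =
  "('q, 'n) tq \<Rightarrow> ('q, real^'n) tvec \<Rightarrow> ('q, real^'n) tvec \<Rightarrow> real"

definition coord_vec ::
  "('q, real^'n) chart set \<Rightarrow> ('q, real^'n) chart \<Rightarrow> real^'n \<Rightarrow> 'n::finite \<Rightarrow> ('q, real^'n) tvec" where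
  "coord_vec A \<phi> x i = snd (chart_inv (tangent_chart A \<phi>) (x, axis i 1))"

definition tensor_coord ::
  "('q, real^'n) chart set \<Rightarrow> ('q, 'n::finite) tensor02 \<Rightarrow> ('q, real^'n) chart \<Rightarrow>
   'n \<Rightarrow> 'n \<Rightarrow> 'n tcoords \<Rightarrow> real" where
  "tensor_coord A g \<phi> i j z =
     g (chart_inv (tangent_chart A \<phi>) z) (coord_vec A \<phi> (fst z) i) (coord_vec A \<phi> (fst z) j)"

definition tensor02_along ::
  "('q, real^'n) chart set \<Rightarrow> 'q set \<Rightarrow> ('q, 'n::finite) tensor02 \<Rightarrow> bool" where
  "tensor02_along A U g \<longleftrightarrow>
     (\<forall>w\<in>tangent_bundle A U. \<forall>X\<in>tangent_space A (fst w). \<forall>X'\<in>tangent_space A (fst w).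
        \<forall>Y\<in>tangent_space A (fst w). \<forall>a b.
          g w (\<lambda>\<phi>. a *\<^sub>R X \<phi> + b *\<^sub>R X' \<phi>) Y = a * g w X Y + b * g w X' Y \<and>
          g w Y (\<lambda>\<phi>. a *\<^sub>R X \<phi> + b *\<^sub>R X' \<phi>) = a * g w Y X + b * g w Y X') \<and>
     (\<forall>\<phi>\<in>A. \<forall>i j. smooth_on (chart_image (tangent_chart A \<phi>) (tangent_bundle A U))
        (tensor_coord A g \<phi> i j))"

definition symmetric_tensor ::
  "('q, real^'n) chart set \<Rightarrow> 'q set \<Rightarrow> ('q, 'n::finite) tensor02 \<Rightarrow> bool" where
  "symmetric_tensor A U g \<longleftrightarrow>
     (\<forall>w\<in>tangent_bundle A U. \<forall>X\<in>tangent_space A (fst w). \<forall>Y\<in>tangent_space A (fst w).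
        g w X Y = g w Y X)"

definition nonsingular_tensor ::
  "('q, real^'n) chart set \<Rightarrow> 'q set \<Rightarrow> ('q, 'n::finite) tensor02 \<Rightarrow> bool" where
  "nonsingular_tensor A U g \<longleftrightarrow>
     (\<forall>\<phi>\<in>A. \<forall>z\<in>chart_image (tangent_chart A \<phi>) (tangent_bundle A U).
        invertible ((\<chi> i j. tensor_coord A g \<phi> i j z) :: real^'n^'n))"


section \<open>Calculus in induced coordinates\<close>

text \<open>
  Tensor fields and forms along the projection are represented by their components in the
  coordinates induced by a chart; \<open>f\<close> stands for the coefficients of the second-order field.
\<close>

definition dq :: "'n \<Rightarrow> ('n::finite tcoords \<Rightarrow> real) \<Rightarrow> 'n tcoords \<Rightarrow> real" where
  "dq i F z = frechet_derivative F (at z) (axis i 1, 0)"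

definition V :: "'n \<Rightarrow> ('n::finite tcoords \<Rightarrow> real) \<Rightarrow> 'n tcoords \<Rightarrow> real" where
  "V i F z = frechet_derivative F (at z) (0, axis i 1)"

text \<open>\<open>conn f j i\<close> is the connection coefficient with upper index \<open>j\<close> and lower index \<open>i\<close>.\<close>

definition conn ::
  "('n::finite tcoords \<Rightarrow> real^'n) \<Rightarrow> 'n \<Rightarrow> 'n \<Rightarrow> 'n tcoords \<Rightarrow> real" where
  "conn f j i z = - (1/2) * V i (\<lambda>z. f z $ j) z"

definition H ::
  "('n::finite tcoords \<Rightarrow> real^'n) \<Rightarrow> 'n \<Rightarrow> ('n tcoords \<Rightarrow> real) \<Rightarrow> 'n tcoords \<Rightarrow> real" where
  "H f i F z = dq i F z - (\<Sum>j\<in>UNIV. conn f j i z * V j F z)"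

definition sode_derivation ::
  "('n::finite tcoords \<Rightarrow> real^'n) \<Rightarrow> ('n tcoords \<Rightarrow> real) \<Rightarrow> 'n tcoords \<Rightarrow> real" where
  "sode_derivation f F z = (\<Sum>i\<in>UNIV. snd z $ i * dq i F z) + (\<Sum>i\<in>UNIV. f z $ i * V i F z)"

text \<open>Vertical covariant derivative of functions, 1-forms and type (0,2) tensor fields; the first
  index is that of the direction of differentiation.\<close>

definition DV_fun :: "('n::finite tcoords \<Rightarrow> real) \<Rightarrow> 'n \<Rightarrow> 'n tcoords \<Rightarrow> real" where
  "DV_fun F k = V k F"

definition DV_form :: "('n::finite \<Rightarrow> 'n tcoords \<Rightarrow> real) \<Rightarrow> 'n \<Rightarrow> 'n \<Rightarrow> 'n tcoords \<Rightarrow> real" where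
  "DV_form \<alpha> k i = V k (\<alpha> i)"

definition DV_tensor ::
  "('n::finite \<Rightarrow> 'n \<Rightarrow> 'n tcoords \<Rightarrow> real) \<Rightarrow> 'n \<Rightarrow> 'n \<Rightarrow> 'n \<Rightarrow> 'n tcoords \<Rightarrow> real" where
  "DV_tensor g k i j = V k (g i j)"

text \<open>The derivation property applied to \<open>g\<^sub>i\<^sub>j dq\<^sup>i \<otimes> dq\<^sup>j\<close>, with
  \<open>\<nabla> dq\<^sup>k = - \<Gamma>\<^sup>k\<^sub>i dq\<^sup>i\<close>.\<close>

definition nabla_tensor ::
  "('n::finite tcoords \<Rightarrow> real^'n) \<Rightarrow> ('n \<Rightarrow> 'n \<Rightarrow> 'n tcoords \<Rightarrow> real) \<Rightarrow>
   'n \<Rightarrow> 'n \<Rightarrow> 'n tcoords \<Rightarrow> real" where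
  "nabla_tensor f g i j z = sode_derivation f (g i j) z
     - (\<Sum>k\<in>UNIV. conn f k i z * g k j z) - (\<Sum>k\<in>UNIV. conn f k j z * g i k z)"

text \<open>\<open>jacobi f i j\<close> is the component with upper index \<open>i\<close> and lower index \<open>j\<close>.\<close>

definition jacobi ::
  "('n::finite tcoords \<Rightarrow> real^'n) \<Rightarrow> 'n \<Rightarrow> 'n \<Rightarrow> 'n tcoords \<Rightarrow> real" where
  "jacobi f i j z = - dq j (\<lambda>z. f z $ i) z - (\<Sum>k\<in>UNIV. conn f k j z * conn f i k z)
     - sode_derivation f (conn f i j) z"

definition jacobi_antisym ::
  "('n::finite tcoords \<Rightarrow> real^'n) \<Rightarrow> ('n \<Rightarrow> 'n \<Rightarrow> 'n tcoords \<Rightarrow> real) \<Rightarrow>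
   'n \<Rightarrow> 'n \<Rightarrow> 'n tcoords \<Rightarrow> real" where
  "jacobi_antisym f g i j z =
     (\<Sum>k\<in>UNIV. jacobi f k i z * g k j z) - (\<Sum>k\<in>UNIV. jacobi f k j z * g i k z)"

definition dH_fun ::
  "('n::finite tcoords \<Rightarrow> real^'n) \<Rightarrow> ('n tcoords \<Rightarrow> real) \<Rightarrow> 'n \<Rightarrow> 'n tcoords \<Rightarrow> real" where
  "dH_fun f F i = H f i F"

text \<open>The value on the coordinate fields \<open>i\<close>, \<open>j\<close> of
  \<open>d\<^sup>V(\<alpha>\<^sub>l dq\<^sup>l) = V\<^sub>k(\<alpha>\<^sub>l) dq\<^sup>k \<and> dq\<^sup>l\<close>, where
  \<open>(\<alpha> \<and> \<beta>)(X, Y) = \<alpha>(X) \<beta>(Y) - \<alpha>(Y) \<beta>(X)\<close>.\<close>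

definition dV_form :: "('n::finite \<Rightarrow> 'n tcoords \<Rightarrow> real) \<Rightarrow> 'n \<Rightarrow> 'n \<Rightarrow> 'n tcoords \<Rightarrow> real" where
  "dV_form \<alpha> i j z = V i (\<alpha> j) z - V j (\<alpha> i) z"


section \<open>Regular functions and systems of equations\<close>

definition regular ::
  "('q, real^'n) chart set \<Rightarrow> 'q set \<Rightarrow> (('q, 'n::finite) tq \<Rightarrow> real) \<Rightarrow> bool" where
  "regular A U L \<longleftrightarrow>
     (\<forall>\<phi>\<in>A. \<forall>z\<in>chart_image (tangent_chart A \<phi>) (tangent_bundle A U).
        invertible ((\<chi> i j. V i (V j (fun_coord A L \<phi>)) z) :: real^'n^'n))"

definition smooth_curve ::
  "('q::topological_space, real^'n) chart set \<Rightarrow> 'q set \<Rightarrow> real set \<Rightarrow> (real \<Rightarrow> 'q) \<Rightarrow> bool" where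
  "smooth_curve A U I c \<longleftrightarrow> c ` I \<subseteq> U \<and> continuous_on I c \<and>
     (\<forall>\<phi>\<in>A. smooth_on {t\<in>I. c t \<in> chart_dom \<phi>} (chart_map \<phi> \<circ> c))"

definition velocity :: "('q, real^'n) chart \<Rightarrow> (real \<Rightarrow> 'q) \<Rightarrow> real \<Rightarrow> real^'n" where
  "velocity \<phi> c t = vector_derivative (chart_map \<phi> \<circ> c) (at t)"

definition lift_coord :: "('q, real^'n) chart \<Rightarrow> (real \<Rightarrow> 'q) \<Rightarrow> real \<Rightarrow> 'n tcoords" where
  "lift_coord \<phi> c t = (chart_map \<phi> (c t), velocity \<phi> c t)"

definition sode_solution ::
  "('q::topological_space, real^'n) chart set \<Rightarrow> ('q, 'n::finite) tq_field \<Rightarrow> 'q set \<Rightarrow>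
   real set \<Rightarrow> (real \<Rightarrow> 'q) \<Rightarrow> bool" where
  "sode_solution A \<Gamma> U I c \<longleftrightarrow> smooth_curve A U I c \<and>
     (\<forall>\<phi>\<in>A. \<forall>t\<in>I. c t \<in> chart_dom \<phi> \<longrightarrow>
        vector_derivative (velocity \<phi> c) (at t) = sode_coeff A \<Gamma> \<phi> (lift_coord \<phi> c t))"

definition dissipative_solution ::
  "('q::topological_space, real^'n) chart set \<Rightarrow> (('q, 'n::finite) tq \<Rightarrow> real) \<Rightarrow>
   (('q, 'n) tq \<Rightarrow> real) \<Rightarrow> 'q set \<Rightarrow> real set \<Rightarrow> (real \<Rightarrow> 'q) \<Rightarrow> bool" where
  "dissipative_solution A L D U I c \<longleftrightarrow> smooth_curve A U I c \<and>
     (\<forall>\<phi>\<in>A. \<forall>t\<in>I. c t \<in> chart_dom \<phi> \<longrightarrow> (\<forall>i.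
        deriv (\<lambda>s. V i (fun_coord A L \<phi>) (lift_coord \<phi> c s)) t
          - dq i (fun_coord A L \<phi>) (lift_coord \<phi> c t)
        = V i (fun_coord A D \<phi>) (lift_coord \<phi> c t)))"

definition equivalent_systems ::
  "('q::topological_space, real^'n) chart set \<Rightarrow> ('q, 'n::finite) tq_field \<Rightarrow> 'q set \<Rightarrow>
   (('q, 'n) tq \<Rightarrow> real) \<Rightarrow> (('q, 'n) tq \<Rightarrow> real) \<Rightarrow> bool" where
  "equivalent_systems A \<Gamma> U L D \<longleftrightarrow>
     (\<forall>I c. open I \<and> is_interval I \<longrightarrow>
        (dissipative_solution A L D U I c \<longleftrightarrow> sode_solution A \<Gamma> U I c))"


section \<open>Tensorial conditions\<close>

definition DV_symmetric ::
  "('q, real^'n) chart set \<Rightarrow> 'q set \<Rightarrow> ('q, 'n::finite) tensor02 \<Rightarrow> bool" where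
  "DV_symmetric A U g \<longleftrightarrow>
     (\<forall>\<phi>\<in>A. \<forall>z\<in>chart_image (tangent_chart A \<phi>) (tangent_bundle A U).
        let T = DV_tensor (tensor_coord A g \<phi>)
        in \<forall>i j k. T i j k z = T j i k z \<and> T i j k z = T i k j z)"

definition nabla_condition ::
  "('q, real^'n) chart set \<Rightarrow> ('q, 'n::finite) tq_field \<Rightarrow> 'q set \<Rightarrow> ('q, 'n) tensor02 \<Rightarrow>
   (('q, 'n) tq \<Rightarrow> real) \<Rightarrow> bool" where
  "nabla_condition A \<Gamma> U g D \<longleftrightarrow>
     (\<forall>\<phi>\<in>A. \<forall>z\<in>chart_image (tangent_chart A \<phi>) (tangent_bundle A U). \<forall>i j.
        nabla_tensor (sode_coeff A \<Gamma> \<phi>) (tensor_coord A g \<phi>) i j z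
          = DV_form (DV_fun (fun_coord A D \<phi>)) i j z)"

definition jacobi_condition ::
  "('q, real^'n) chart set \<Rightarrow> ('q, 'n::finite) tq_field \<Rightarrow> 'q set \<Rightarrow> ('q, 'n) tensor02 \<Rightarrow>
   (('q, 'n) tq \<Rightarrow> real) \<Rightarrow> bool" where
  "jacobi_condition A \<Gamma> U g D \<longleftrightarrow>
     (\<forall>\<phi>\<in>A. \<forall>z\<in>chart_image (tangent_chart A \<phi>) (tangent_bundle A U). \<forall>i j.
        jacobi_antisym (sode_coeff A \<Gamma> \<phi>) (tensor_coord A g \<phi>) i j z
          = dV_form (dH_fun (sode_coeff A \<Gamma> \<phi>) (fun_coord A D \<phi>)) i j z)"

end

theory Submission
  imports Defs
begin

text \<open>
  Write \<open>E\<^sub>i = \<Gamma>(V\<^sub>i L) - \<partial>L/\<partial>q\<^sup>i - V\<^sub>i D\<close> and \<open>g\<^sub>i\<^sub>j = V\<^sub>i V\<^sub>j L\<close>. Along a curve the Euler-Lagrange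
  equations read \<open>E\<^sub>i + g\<^sub>i\<^sub>j (q''\<^sup>j - f\<^sup>j) = 0\<close>, so for regular \<open>L\<close> they are equivalent to the
  second-order equations iff all \<open>E\<^sub>i\<close> vanish; here the existence of solutions through every point of
  \<open>TQ\<close> is needed. Two identities relate \<open>E\<close> to the tensorial conditions:
  \<open>V\<^sub>j E\<^sub>i + V\<^sub>i E\<^sub>j = 2 (\<nabla> g - D\<^sup>V D\<^sup>V D)\<^sub>i\<^sub>j\<close> and, once this vanishes,
  \<open>\<partial>E\<^sub>j/\<partial>q\<^sup>i - \<partial>E\<^sub>i/\<partial>q\<^sup>j - \<Gamma>(V\<^sub>i E\<^sub>j) = d\<^sup>V d\<^sup>H D - (\<Phi> \<lrcorner> g - (\<Phi> \<lrcorner> g)\<^sup>T)\<close>.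
  Conversely, symmetry of \<open>D\<^sup>V g\<close> gives a function \<open>F\<close> with fibre Hessian \<open>g\<close>, the first
  identity makes its \<open>E\<^sub>i = e\<^sub>i(q) + r\<^sub>k\<^sub>i(q) v\<^sup>k\<close> affine in the velocities with \<open>r\<close> antisymmetric, and the
  second one says that the 1-form \<open>e\<close> and the 2-form \<open>r\<close> on the base are closed. With local
  potentials \<open>e = d\<beta>\<close> and \<open>r = d\<alpha>\<close>, the function \<open>L = F - \<alpha>\<^sub>k v\<^sup>k + \<beta>\<close> has \<open>E = 0\<close>.
\<close>


section \<open>Smooth maps and directional derivatives\<close>

text \<open>Two obstacles shape the proof. First, the conditions are imposed in every chart, while
  the computations live in one. Hence the transformation laws under tangent maps of coordinate
  changes: fibre Hessians are tensors because the Jacobian does not depend on the velocities, and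
  Euler-Lagrange expressions along a curve form a covector because the second derivatives of the
  coordinate change cancel. The Lagrangian is built over a ball in one chart; its regularity in the
  other charts is inherited from \<open>g\<close>, whose components its Hessian reproduces there.
  Second, potentials found on the fibres must also be smooth in the base point. The Poincare lemma
  is therefore proved for forms on convex fibres over an open parameter space, by integration along
  rays; the base is treated by exchanging the two factors. Throughout the converse \<open>D\<close>
  stays fixed. The only freedom left for the Lagrangian is to add terms affine in the velocities:
  they do not change the Hessian, and they shift \<open>E\<close> by the differential of a function
  and the contraction of an exact 2-form with the velocity, which is just the kind of remainder to
  be removed.\<close>

definition dird :: "('a::real_normed_vector \<Rightarrow> 'b::real_normed_vector) \<Rightarrow> 'a \<Rightarrow> 'a \<Rightarrow> 'b" where
  "dird f v x = frechet_derivative f (at x) v"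

lemma dird_eqI: "(f has_derivative f') (at x) \<Longrightarrow> dird f v x = f' v"
  by (simp add: dird_def frechet_derivative_at[symmetric])

lemma has_derivative_dird: "f differentiable (at x) \<Longrightarrow> (f has_derivative (\<lambda>v. dird f v x)) (at x)"
  by (simp add: dird_def frechet_derivative_works)

lemma dird_linear: "f differentiable (at x) \<Longrightarrow> linear (\<lambda>v. dird f v x)"
  using has_derivative_dird has_derivative_linear by blast

lemma dird_Basis:
  fixes f :: "'a::euclidean_space \<Rightarrow> 'b::real_normed_vector"
  assumes "f differentiable (at x)"
  shows "dird f v x = (\<Sum>b\<in>Basis. (v \<bullet> b) *\<^sub>R dird f b x)"
proof -
  note lin = dird_linear[OF assms]
  have "dird f v x = dird f (\<Sum>b\<in>Basis. (v \<bullet> b) *\<^sub>R b) x"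
    by (simp add: euclidean_representation)
  also have "\<dots> = (\<Sum>b\<in>Basis. (v \<bullet> b) *\<^sub>R dird f b x)"
    using linear_sum[OF lin, of "\<lambda>b. (v \<bullet> b) *\<^sub>R b" Basis] linear_scale[OF lin] by simp
  finally show ?thesis .
qed

lemma linear_axis_expand:
  fixes T :: "real^'n \<Rightarrow> 'b::real_vector"
  assumes "linear T"
  shows "T v = (\<Sum>i\<in>UNIV. v $ i *\<^sub>R T (axis i 1))"
proof -
  have "T v = T (\<Sum>i\<in>UNIV. v $ i *\<^sub>R axis i 1)"
    unfolding scalar_mult_eq_scaleR[symmetric] basis_expansion ..
  then show ?thesis
    by (simp add: linear_sum[OF assms] linear_scale[OF assms])
qed

lemma dird_cong:
  assumes "open S" "x \<in> S" "\<And>y. y \<in> S \<Longrightarrow> f y = g y"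
  shows "dird f v x = dird g v x"
proof (cases "f differentiable (at x)")
  case True
  then have "(g has_derivative (\<lambda>v. dird f v x)) (at x)"
    using has_derivative_transform_within_open[OF has_derivative_dird assms(1,2)] assms(3) by metis
  then show ?thesis by (simp add: dird_eqI)
next
  case False
  \<comment> \<open>Without a derivative both sides are arbitrary choices; they agree because the
    same maps qualify as derivatives of \<open>f\<close> and of \<open>g\<close>.\<close>
  have iff: "(f has_derivative f') (at x) \<longleftrightarrow> (g has_derivative f') (at x)" for f'
    using has_derivative_transform_within_open[of f f' x UNIV S g]
      has_derivative_transform_within_open[of g f' x UNIV S f] assms by auto
  then show ?thesis by (simp add: dird_def frechet_derivative_def)
qed

lemma differentiable_cong_open:
  assumes "open S" "x \<in> S" "\<And>y. y \<in> S \<Longrightarrow> f y = g y" "f differentiable (at x)"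
  shows "g differentiable (at x)"
  using has_derivative_transform_within_open[OF has_derivative_dird[OF assms(4)] assms(1,2)] assms(3)
  unfolding differentiable_def by metis

text \<open>With the direction as an early argument of \<open>dird\<close>, each directional
  derivative is a function of the point, so derivatives can be iterated.\<close>

lemma Ck_on_Suc:
  "Ck_on (Suc k) S f \<longleftrightarrow> (\<forall>x\<in>S. f differentiable (at x)) \<and> (\<forall>v. Ck_on k S (dird f v))"
  by (simp add: dird_def[abs_def])

lemma Ck_on_cong:
  assumes "open S" "\<And>x. x \<in> S \<Longrightarrow> f x = g x" "Ck_on k S f"
  shows "Ck_on k S g"
  using assms(2,3)
proof (induction k arbitrary: f g)
  case 0
  then show ?case by (metis Ck_on.simps(1) continuous_on_cong)
next
  case (Suc k)
  have "\<forall>x\<in>S. g differentiable (at x)"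
    using Suc.prems differentiable_cong_open[OF \<open>open S\<close>, of _ f g] unfolding Ck_on_Suc by blast
  moreover have "Ck_on k S (dird g v)" for v
    using Suc.IH[of "dird f v" "dird g v"] dird_cong[OF \<open>open S\<close>, of _ f g v] Suc.prems
    unfolding Ck_on_Suc by blast
  ultimately show ?case unfolding Ck_on_Suc by blast
qed

lemma Ck_on_subset: "Ck_on k S f \<Longrightarrow> T \<subseteq> S \<Longrightarrow> Ck_on k T f"
  by (induction k arbitrary: f) (auto simp del: Ck_on.simps(2) simp: Ck_on_Suc intro: continuous_on_subset)

lemma Ck_on_SucD: "Ck_on (Suc k) S f \<Longrightarrow> Ck_on k S f"
proof (induction k arbitrary: f)
  case 0
  then show ?case
    by (auto intro!: continuous_at_imp_continuous_on differentiable_imp_continuous_within)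
next
  case (Suc k)
  then show ?case unfolding Ck_on_Suc[of "Suc k"] unfolding Ck_on_Suc[of k]
    using Ck_on_Suc by blast
qed

text \<open>Most closure rules combine this with induction on the order: an explicit derivative is
  exhibited, and its value in each fixed direction is shown to have one order less.\<close>

lemma Ck_on_SucI:
  assumes "open S" "\<And>x. x \<in> S \<Longrightarrow> (f has_derivative f' x) (at x)"
    "\<And>v. Ck_on k S (\<lambda>x. f' x v)"
  shows "Ck_on (Suc k) S f"
  unfolding Ck_on_Suc
proof (intro conjI allI ballI)
  show "f differentiable (at x)" if "x \<in> S" for x using assms(2)[OF that] by (rule differentiableI)
  show "Ck_on k S (dird f v)" for v
    by (rule Ck_on_cong[OF assms(1) _ assms(3)[of v]]) (simp add: dird_eqI[OF assms(2)])
qed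

lemma Ck_on_has_derivative:
  "Ck_on (Suc k) S f \<Longrightarrow> x \<in> S \<Longrightarrow> (f has_derivative (\<lambda>v. dird f v x)) (at x)"
  unfolding Ck_on_Suc by (blast intro: has_derivative_dird)

lemma Ck_on_const: "open S \<Longrightarrow> Ck_on k S (\<lambda>x. c)"
  by (induction k arbitrary: c) (auto simp del: Ck_on.simps(2) intro!: Ck_on_SucI[of _ _ "\<lambda>x v. 0"])

lemma Ck_on_add: "open S \<Longrightarrow> Ck_on k S f \<Longrightarrow> Ck_on k S g \<Longrightarrow> Ck_on k S (\<lambda>x. f x + g x)"
proof (induction k arbitrary: f g)
  case 0
  then show ?case by (auto intro: continuous_intros)
next
  case (Suc k)
  show ?case
    by (rule Ck_on_SucI[OF Suc.prems(1) has_derivative_add[OF Ck_on_has_derivative[OF Suc.prems(2)]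
            Ck_on_has_derivative[OF Suc.prems(3)]]])
      (use Suc in \<open>auto simp: Ck_on_Suc simp del: Ck_on.simps\<close>)
qed

lemma Ck_on_sum:
  "open S \<Longrightarrow> (\<And>i. i \<in> I \<Longrightarrow> Ck_on k S (f i)) \<Longrightarrow> Ck_on k S (\<lambda>x. \<Sum>i\<in>I. f i x)"
  by (induction I rule: infinite_finite_induct) (auto intro: Ck_on_const Ck_on_add)

lemma Ck_on_bounded_linear_comp:
  assumes "bounded_linear h" "open S" "Ck_on k S f"
  shows "Ck_on k S (\<lambda>x. h (f x))"
  using assms(3)
proof (induction k arbitrary: f)
  case 0
  then show ?case using bounded_linear.continuous_on[OF assms(1)] by auto
next
  case (Suc k)
  show ?case
    by (rule Ck_on_SucI[OF assms(2) bounded_linear.has_derivative[OF assms(1)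
            Ck_on_has_derivative[OF Suc.prems]]])
      (use Suc in \<open>auto simp: Ck_on_Suc simp del: Ck_on.simps\<close>)
qed

lemma Ck_on_bounded_bilinear:
  assumes "bounded_bilinear b" "open S" "Ck_on k S f" "Ck_on k S g"
  shows "Ck_on k S (\<lambda>x. b (f x) (g x))"
  using assms(3,4)
proof (induction k arbitrary: f g)
  case 0
  then show ?case using bounded_bilinear.continuous_on[OF assms(1)] by auto
next
  case (Suc k)
  \<comment> \<open>The product rule contains \<open>f\<close> and \<open>g\<close>
    undifferentiated, so their own order has to be lowered too.\<close>
  note sm = Ck_on_SucD[OF Suc.prems(1)] Ck_on_SucD[OF Suc.prems(2)]
  show ?case
    by (rule Ck_on_SucI[OF assms(2) bounded_bilinear.FDERIV[OF assms(1)
            Ck_on_has_derivative[OF Suc.prems(1)] Ck_on_has_derivative[OF Suc.prems(2)]]])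
      (use Suc.IH Suc.prems sm in \<open>auto simp: Ck_on_Suc simp del: Ck_on.simps intro!: Ck_on_add assms(2)\<close>)
qed

lemma Ck_on_compose:
  fixes f :: "'a::real_normed_vector \<Rightarrow> 'b::euclidean_space"
    and g :: "'b \<Rightarrow> 'c::real_normed_vector"
  assumes "open S" "open T" "\<And>x. x \<in> S \<Longrightarrow> f x \<in> T" "Ck_on k S f" "Ck_on k T g"
  shows "Ck_on k S (\<lambda>x. g (f x))"
  using assms(4,5)
proof (induction k arbitrary: g)
  case 0
  then show ?case using assms(3) continuous_on_compose2[of T g S f] by auto
next
  case (Suc k)
  \<comment> \<open>The chain rule puts the varying vector \<open>dird f v x\<close> into the
    direction slot of \<open>dird g\<close>. Expanding it in a basis leaves fixed directions only,
    to which the induction hypothesis applies.\<close>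
  have d: "((\<lambda>x. g (f x)) has_derivative (\<lambda>v. \<Sum>b\<in>Basis. (dird f v x \<bullet> b) *\<^sub>R dird g b (f x))) (at x)"
    if x: "x \<in> S" for x
  proof -
    have g: "(g has_derivative (\<lambda>v. dird g v (f x))) (at (f x))"
      using Ck_on_has_derivative[OF Suc.prems(2)] assms(3)[OF x] by blast
    then have "dird g w (f x) = (\<Sum>b\<in>Basis. (w \<bullet> b) *\<^sub>R dird g b (f x))" for w
      by (intro dird_Basis differentiableI)
    then show ?thesis
      by (intro has_derivative_eq_rhs[OF has_derivative_compose[OF Ck_on_has_derivative[OF Suc.prems(1) x] g]]) blast
  qed
  show ?case
  proof (rule Ck_on_SucI[OF assms(1) d])
    fix v
    show "Ck_on k S (\<lambda>x. \<Sum>b\<in>Basis. (dird f v x \<bullet> b) *\<^sub>R dird g b (f x))"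
      using Suc.IH[of "dird g _"] Suc.prems Ck_on_SucD[OF Suc.prems(1)]
      by (auto intro!: Ck_on_sum Ck_on_bounded_bilinear[OF bounded_bilinear_scaleR] assms(1)
          Ck_on_bounded_linear_comp[OF bounded_linear_inner_left] simp: Ck_on_Suc simp del: Ck_on.simps)
  qed
qed

lemma smooth_on_cong:
  "open S \<Longrightarrow> (\<And>x. x \<in> S \<Longrightarrow> f x = g x) \<Longrightarrow> smooth_on S f \<Longrightarrow> smooth_on S g"
  unfolding smooth_on_def by (blast intro: Ck_on_cong)

lemma smooth_on_subset: "smooth_on S f \<Longrightarrow> T \<subseteq> S \<Longrightarrow> smooth_on T f"
  unfolding smooth_on_def by (blast intro: Ck_on_subset)

lemma smooth_on_dird: "smooth_on S f \<Longrightarrow> smooth_on S (dird f v)"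
  unfolding smooth_on_def using Ck_on_Suc by metis

lemma smooth_on_differentiable: "smooth_on S f \<Longrightarrow> x \<in> S \<Longrightarrow> f differentiable (at x)"
  unfolding smooth_on_def using Ck_on_Suc by metis

lemma smooth_on_has_derivative:
  "smooth_on S f \<Longrightarrow> x \<in> S \<Longrightarrow> (f has_derivative (\<lambda>v. dird f v x)) (at x)"
  by (simp add: smooth_on_differentiable has_derivative_dird)

lemma smooth_on_continuous_on: "smooth_on S f \<Longrightarrow> continuous_on S f"
  unfolding smooth_on_def using Ck_on.simps(1) by metis

lemma smooth_on_const: "open S \<Longrightarrow> smooth_on S (\<lambda>x. c)"
  by (simp add: smooth_on_def Ck_on_const)

lemma smooth_on_add: "open S \<Longrightarrow> smooth_on S f \<Longrightarrow> smooth_on S g \<Longrightarrow> smooth_on S (\<lambda>x. f x + g x)"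
  by (simp add: smooth_on_def Ck_on_add)

lemma smooth_on_sum:
  "open S \<Longrightarrow> (\<And>i. i \<in> I \<Longrightarrow> smooth_on S (f i)) \<Longrightarrow> smooth_on S (\<lambda>x. \<Sum>i\<in>I. f i x)"
  by (simp add: smooth_on_def Ck_on_sum)

lemma smooth_on_bounded_linear_comp:
  "bounded_linear h \<Longrightarrow> open S \<Longrightarrow> smooth_on S f \<Longrightarrow> smooth_on S (\<lambda>x. h (f x))"
  by (simp add: smooth_on_def Ck_on_bounded_linear_comp)

lemma smooth_on_bounded_bilinear:
  "bounded_bilinear b \<Longrightarrow> open S \<Longrightarrow> smooth_on S f \<Longrightarrow> smooth_on S g \<Longrightarrow>
    smooth_on S (\<lambda>x. b (f x) (g x))"
  by (simp add: smooth_on_def Ck_on_bounded_bilinear)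

lemmas smooth_on_mult = smooth_on_bounded_bilinear[OF bounded_bilinear_mult]
  and smooth_on_scaleR = smooth_on_bounded_bilinear[OF bounded_bilinear_scaleR]
  and smooth_on_minus = smooth_on_bounded_linear_comp[OF bounded_linear_minus[OF bounded_linear_ident]]
  and smooth_on_nth = smooth_on_bounded_linear_comp[OF bounded_linear_vec_nth]
  and smooth_on_fst = smooth_on_bounded_linear_comp[OF bounded_linear_fst]
  and smooth_on_snd = smooth_on_bounded_linear_comp[OF bounded_linear_snd]

lemma smooth_on_diff: "open S \<Longrightarrow> smooth_on S f \<Longrightarrow> smooth_on S g \<Longrightarrow> smooth_on S (\<lambda>x. f x - g x)"
  using smooth_on_add[OF _ _ smooth_on_minus, of S f g] by simp

lemma smooth_on_compose:
  fixes f :: "'a::real_normed_vector \<Rightarrow> 'b::euclidean_space"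
  assumes "open S" "open T" "\<And>x. x \<in> S \<Longrightarrow> f x \<in> T" "smooth_on S f" "smooth_on T g"
  shows "smooth_on S (\<lambda>x. g (f x))"
  using assms(4,5) unfolding smooth_on_def by (blast intro: Ck_on_compose[OF assms(1,2)] assms(3))

lemma Ck_on_ident: "open S \<Longrightarrow> Ck_on k S (\<lambda>x. x)"
proof (cases k)
  case (Suc m)
  assume "open S"
  then show ?thesis unfolding Suc
    by (intro Ck_on_SucI[of _ _ "\<lambda>x v. v"] Ck_on_const has_derivative_ident)
qed (simp add: continuous_on_id)

lemma smooth_on_ident: "open S \<Longrightarrow> smooth_on S (\<lambda>x. x)"
  by (simp add: smooth_on_def Ck_on_ident)

lemma smooth_on_linear: "bounded_linear h \<Longrightarrow> open S \<Longrightarrow> smooth_on S h"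
  using smooth_on_bounded_linear_comp[OF _ _ smooth_on_ident] by blast

lemma smooth_on_Pair:
  assumes "open S" "smooth_on S f" "smooth_on S g"
  shows "smooth_on S (\<lambda>x. (f x, g x))"
proof -
  have "smooth_on S (\<lambda>x. (f x, 0) + (0, g x))"
    by (intro smooth_on_add assms smooth_on_bounded_linear_comp[where h="\<lambda>y. (y, 0)"]
        smooth_on_bounded_linear_comp[where h="\<lambda>y. (0, y)"]
        bounded_linear_Pair bounded_linear_ident bounded_linear_zero)
  then show ?thesis by simp
qed

text \<open>Differentiation under the integral sign of the fundamental theorem of calculus along \<open>v\<close>.\<close>

lemma dird_commute:
  fixes F :: "'a::real_normed_vector \<Rightarrow> 'b::banach"
  assumes "open S" "smooth_on S F" "z \<in> S"
  shows "dird (dird F v) u z = dird (dird F u) v z"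
proof -
  define p where "p = (\<lambda>(s::real, t::real). z + s *\<^sub>R u + t *\<^sub>R v)"
  have "continuous_on UNIV p"
    unfolding p_def by (auto intro!: continuous_intros simp: split_beta)
  then have "open (p -` S)" using assms(1) open_vimage by blast
  moreover have "(0,0) \<in> p -` S" using assms(3) by (simp add: p_def)
  ultimately obtain e0 where e0: "e0 > 0" "ball (0,0) e0 \<subseteq> p -` S"
    using openE by blast
  \<comment> \<open>With a third of the radius, the sum of the two parameters still stays below
    \<open>e0\<close>.\<close>
  define e where "e = e0 / 3"
  have e: "e > 0" using e0 by (simp add: e_def)
  have inS: "z + s *\<^sub>R u + t *\<^sub>R v \<in> S" if "\<bar>s\<bar> \<le> e" "\<bar>t\<bar> \<le> e" for s t
  proof -
    have "norm (s,t) \<le> \<bar>s\<bar> + \<bar>t\<bar>" using norm_Pair_le[of s t] by simp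
    also have "\<dots> < e0" using that e0 e_def by linarith
    finally have "(s,t) \<in> ball (0,0) e0" using norm_minus_cancel[of "(s,t)"] by (simp add: dist_norm)
    then show ?thesis using e0 by (auto simp: p_def)
  qed
  have vd: "((\<lambda>t. G (z + s *\<^sub>R u + t *\<^sub>R v)) has_vector_derivative dird G v (z + s *\<^sub>R u + t *\<^sub>R v)) (at t within T)"
    and vs: "((\<lambda>s. G (z + s *\<^sub>R u + t *\<^sub>R v)) has_vector_derivative dird G u (z + s *\<^sub>R u + t *\<^sub>R v)) (at s within T)"
    if "smooth_on S G" "\<bar>s\<bar> \<le> e" "\<bar>t\<bar> \<le> e" for s t T and G :: "'a \<Rightarrow> 'b"
  proof -
    note G = smooth_on_has_derivative[OF that(1) inS[OF that(2,3)]]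
    note lin = linear_scale[OF has_derivative_linear[OF G]]
    have "((\<lambda>t. z + s *\<^sub>R u + t *\<^sub>R v) has_derivative (\<lambda>h. h *\<^sub>R v)) (at t)"
      by (auto intro!: derivative_eq_intros)
    from has_derivative_compose[OF this G] lin
    show "((\<lambda>t. G (z + s *\<^sub>R u + t *\<^sub>R v)) has_vector_derivative dird G v (z + s *\<^sub>R u + t *\<^sub>R v)) (at t within T)"
      by (auto simp: has_vector_derivative_def intro: has_derivative_at_withinI)
    have "((\<lambda>s. z + s *\<^sub>R u + t *\<^sub>R v) has_derivative (\<lambda>h. h *\<^sub>R u)) (at s)"
      by (auto intro!: derivative_eq_intros)
    from has_derivative_compose[OF this G] lin
    show "((\<lambda>s. G (z + s *\<^sub>R u + t *\<^sub>R v)) has_vector_derivative dird G u (z + s *\<^sub>R u + t *\<^sub>R v)) (at s within T)"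
      by (auto simp: has_vector_derivative_def intro: has_derivative_at_withinI)
  qed
  have cont: "continuous_on ({-e..e} \<times> {-e..e}) (\<lambda>(s,t). G (z + s *\<^sub>R u + t *\<^sub>R v))"
    if "smooth_on S G" for G :: "'a \<Rightarrow> 'b"
    unfolding split_beta
    by (rule continuous_on_compose2[OF smooth_on_continuous_on[OF that]])
      (auto intro!: continuous_intros inS)
  have cont1: "continuous_on {-e..e} (\<lambda>t. G (z + s *\<^sub>R u + t *\<^sub>R v))"
    if "smooth_on S G" "\<bar>s\<bar> \<le> e" for s and G :: "'a \<Rightarrow> 'b"
    by (rule continuous_on_compose2[OF smooth_on_continuous_on[OF that(1)]])
      (auto intro!: continuous_intros inS that)
  note sv = smooth_on_dird[OF assms(2), of v] and suv = smooth_on_dird[OF smooth_on_dird[OF assms(2), of v], of u]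
  \<comment> \<open>The fundamental theorem in \<open>t\<close> expresses \<open>F\<close> through
    \<open>dird F v\<close>; its derivative in \<open>s\<close> at 0 is this identity.
    Differentiating once more, in \<open>t\<close> at 0, gives the claim.\<close>
  have key: "dird F u (z + t *\<^sub>R v) = dird F u (z + (-e) *\<^sub>R v)
      + integral {-e..t} (\<lambda>t. dird (dird F v) u (z + t *\<^sub>R v))" if t: "\<bar>t\<bar> < e" for t
  proof -
    have eq: "F (z + s *\<^sub>R u + t *\<^sub>R v) = F (z + s *\<^sub>R u + (-e) *\<^sub>R v)
        + integral {-e..t} (\<lambda>t. dird F v (z + s *\<^sub>R u + t *\<^sub>R v))" if s: "s \<in> {-e<..<e}" for s
    proof -
      have "((\<lambda>t. dird F v (z + s *\<^sub>R u + t *\<^sub>R v)) has_integral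
          (F (z + s *\<^sub>R u + t *\<^sub>R v) - F (z + s *\<^sub>R u + (-e) *\<^sub>R v))) {-e..t}"
        by (rule fundamental_theorem_of_calculus) (use t s in \<open>auto intro!: vd assms\<close>)
      then show ?thesis by (simp add: integral_unique)
    qed
    have "((\<lambda>s. integral (cbox (-e) t) (\<lambda>t. dird F v (z + s *\<^sub>R u + t *\<^sub>R v))) has_vector_derivative
       integral (cbox (-e) t) (\<lambda>t. dird (dird F v) u (z + 0 *\<^sub>R u + t *\<^sub>R v))) (at 0 within {-e<..<e})"
    proof (rule leibniz_rule_vector_derivative)
      show "continuous_on ({-e<..<e} \<times> cbox (-e) t) (\<lambda>(s,t). dird (dird F v) u (z + s *\<^sub>R u + t *\<^sub>R v))"
        by (rule continuous_on_subset[OF cont[OF suv]]) (use t in auto)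
      show "(\<lambda>t. dird F v (z + s *\<^sub>R u + t *\<^sub>R v)) integrable_on cbox (-e) t" if "s \<in> {-e<..<e}" for s
        by (rule integrable_continuous, rule continuous_on_subset[OF cont1[OF sv]]) (use t that in auto)
    qed (use e t in \<open>auto intro!: vs sv\<close>)
    then have I: "((\<lambda>s. integral {-e..t} (\<lambda>t. dird F v (z + s *\<^sub>R u + t *\<^sub>R v))) has_vector_derivative
       integral {-e..t} (\<lambda>t. dird (dird F v) u (z + t *\<^sub>R v))) (at 0)"
      using at_within_open[of "0::real" "{-e<..<e}"] e by simp
    have "((\<lambda>s. F (z + s *\<^sub>R u + (-e) *\<^sub>R v) + integral {-e..t} (\<lambda>t. dird F v (z + s *\<^sub>R u + t *\<^sub>R v))) has_vector_derivative
       dird F u (z + 0 *\<^sub>R u + (-e) *\<^sub>R v) + integral {-e..t} (\<lambda>t. dird (dird F v) u (z + t *\<^sub>R v))) (at 0)"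
      by (rule has_vector_derivative_add[OF vs I]) (use e assms in auto)
    then have "((\<lambda>s. F (z + s *\<^sub>R u + t *\<^sub>R v)) has_vector_derivative
       dird F u (z + 0 *\<^sub>R u + (-e) *\<^sub>R v) + integral {-e..t} (\<lambda>t. dird (dird F v) u (z + t *\<^sub>R v))) (at 0)"
      using has_vector_derivative_transform_within_open[of _ _ 0 "{-e<..<e}" "\<lambda>s. F (z + s *\<^sub>R u + t *\<^sub>R v)"] eq e
      by simp
    moreover have "((\<lambda>s. F (z + s *\<^sub>R u + t *\<^sub>R v)) has_vector_derivative
       dird F u (z + 0 *\<^sub>R u + t *\<^sub>R v)) (at 0)"
      by (rule vs) (use assms e t in auto)
    ultimately show ?thesis
      using vector_derivative_unique_at by fastforce
  qed
  have "((\<lambda>t. integral {-e..t} (\<lambda>t. dird (dird F v) u (z + t *\<^sub>R v))) has_vector_derivative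
      dird (dird F v) u (z + 0 *\<^sub>R v)) (at 0 within {-e..e})"
    by (rule integral_has_vector_derivative) (use cont1[OF suv, of 0] e in auto)
  then have "((\<lambda>t. integral {-e..t} (\<lambda>t. dird (dird F v) u (z + t *\<^sub>R v))) has_vector_derivative
      dird (dird F v) u z) (at 0)"
    using at_within_interior[of "0::real" "{-e..e}"] e by (simp add: interior_atLeastAtMost_real)
  then have "((\<lambda>t. dird F u (z + (-e) *\<^sub>R v) + integral {-e..t} (\<lambda>t. dird (dird F v) u (z + t *\<^sub>R v))) has_vector_derivative
      0 + dird (dird F v) u z) (at 0)"
    by (intro has_vector_derivative_add has_vector_derivative_const)
  then have "((\<lambda>t. dird F u (z + t *\<^sub>R v)) has_vector_derivative 0 + dird (dird F v) u z) (at 0)"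
    by (rule has_vector_derivative_transform_within_open[of _ _ 0 "{-e<..<e}"]) (use e key in auto)
  moreover have "((\<lambda>t. dird F u (z + 0 *\<^sub>R u + t *\<^sub>R v)) has_vector_derivative dird (dird F u) v (z + 0 *\<^sub>R u + 0 *\<^sub>R v)) (at 0)"
    by (rule vd) (use assms e smooth_on_dird in auto)
  ultimately show ?thesis
    using vector_derivative_unique_at by fastforce
qed


section \<open>Euler-Lagrange expressions in coordinates\<close>

lemma dq_eq_dird: "dq i F = dird F (axis i 1, 0)"
  and V_eq_dird: "V i F = dird F (0, axis i 1)"
  by (auto simp: dq_def V_def dird_def)

lemma dird_vec:
  fixes F :: "real^'n \<Rightarrow> 'b::real_normed_vector"
  assumes "F differentiable (at x)"
  shows "dird F a x = (\<Sum>i\<in>UNIV. a $ i *\<^sub>R dird F (axis i 1) x)"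
  by (rule linear_axis_expand[OF dird_linear[OF assms]])

lemma dird_tcoords:
  fixes F :: "'n::finite tcoords \<Rightarrow> real"
  assumes "F differentiable (at z)"
  shows "dird F (a, b) z = (\<Sum>i\<in>UNIV. a $ i * dq i F z) + (\<Sum>i\<in>UNIV. b $ i * V i F z)"
proof -
  note lin = dird_linear[OF assms]
  have "bounded_linear (\<lambda>a::real^'n. (a, 0::real^'n))" "bounded_linear (\<lambda>a::real^'n. (0::real^'n, a))"
    by (auto intro!: bounded_linear_Pair bounded_linear_ident bounded_linear_zero)
  note l = linear_compose[OF bounded_linear.linear[OF this(1)] lin, unfolded o_def]
    linear_compose[OF bounded_linear.linear[OF this(2)] lin, unfolded o_def]
  have "dird F (a, b) z = dird F (a, 0) z + dird F (0, b) z"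
    using linear_add[OF lin, of "(a,0)" "(0,b)"] by simp
  then show ?thesis
    using linear_axis_expand[OF l(1), of a] linear_axis_expand[OF l(2), of b]
    by (simp add: dq_eq_dird V_eq_dird)
qed

lemma sode_derivation_eq_dird:
  "F differentiable (at z) \<Longrightarrow> sode_derivation f F z = dird F (snd z, f z) z"
  by (simp add: sode_derivation_def dird_tcoords)

context
  fixes S :: "'a::real_normed_vector set" and x :: 'a
  assumes x: "x \<in> S"
begin

lemma dird_const: "dird (\<lambda>y. c) v x = 0"
  by (rule dird_eqI[OF has_derivative_const])

lemma dird_add:
  "smooth_on S F \<Longrightarrow> smooth_on S G \<Longrightarrow> dird (\<lambda>y. F y + G y) v x = dird F v x + dird G v x"
  by (rule dird_eqI[OF has_derivative_add]) (auto intro: smooth_on_has_derivative x)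

lemma dird_diff:
  "smooth_on S F \<Longrightarrow> smooth_on S G \<Longrightarrow> dird (\<lambda>y. F y - G y) v x = dird F v x - dird G v x"
  by (rule dird_eqI[OF has_derivative_diff]) (auto intro: smooth_on_has_derivative x)

lemma dird_sum:
  "(\<And>i. i \<in> I \<Longrightarrow> smooth_on S (F i)) \<Longrightarrow> dird (\<lambda>y. \<Sum>i\<in>I. F i y) v x = (\<Sum>i\<in>I. dird (F i) v x)"
  by (rule dird_eqI[OF has_derivative_sum]) (auto intro: smooth_on_has_derivative x)

lemma dird_mult:
  fixes F G :: "'a \<Rightarrow> real"
  shows "smooth_on S F \<Longrightarrow> smooth_on S G \<Longrightarrow>
    dird (\<lambda>y. F y * G y) v x = F x * dird G v x + dird F v x * G x"
  by (rule dird_eqI[OF has_derivative_mult]) (auto intro: smooth_on_has_derivative x)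

lemma dird_bounded_linear:
  "bounded_linear h \<Longrightarrow> smooth_on S F \<Longrightarrow> dird (\<lambda>y. h (F y)) v x = h (dird F v x)"
  by (rule dird_eqI[OF bounded_linear.has_derivative]) (auto intro: smooth_on_has_derivative x)

end

text \<open>Replacing the time derivative by the second-order field makes the equations functions of
  position and velocity, which can be differentiated in all directions.\<close>

definition EL :: "('n::finite tcoords \<Rightarrow> real^'n) \<Rightarrow> ('n tcoords \<Rightarrow> real) \<Rightarrow> ('n tcoords \<Rightarrow> real) \<Rightarrow>
    'n \<Rightarrow> 'n tcoords \<Rightarrow> real" where
  "EL f L D i z = sode_derivation f (V i L) z - dq i L z - V i D z"

text \<open>Several interpretations take the zero field for \<open>f\<close>; they serve only to
  obtain the rules for \<open>V\<close> and \<open>dq\<close> on the open set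
  \<open>W\<close>.\<close>

locale sode_coords =
  fixes W :: "'n::finite tcoords set" and f :: "'n tcoords \<Rightarrow> real^'n"
  assumes open_W: "open W" and smooth_f: "smooth_on W f"
begin

lemma V_smooth: "smooth_on W F \<Longrightarrow> smooth_on W (V i F)"
  and dq_smooth: "smooth_on W F \<Longrightarrow> smooth_on W (dq i F)"
  by (simp_all add: V_eq_dird dq_eq_dird smooth_on_dird)

lemma f_smooth: "smooth_on W (\<lambda>z. f z $ i)"
  by (intro smooth_on_nth open_W smooth_f)

lemma v_smooth: "smooth_on W (\<lambda>z. snd z $ i)"
  by (intro smooth_on_nth open_W smooth_on_snd smooth_on_ident)

lemma conn_smooth: "smooth_on W (conn f j i)"
  unfolding conn_def[abs_def] by (intro smooth_on_mult smooth_on_const open_W V_smooth f_smooth)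

lemma sum_smooth: "(\<And>i. i \<in> I \<Longrightarrow> smooth_on W (F i)) \<Longrightarrow> smooth_on W (\<lambda>x. \<Sum>i\<in>I. F i x)"
  by (rule smooth_on_sum[OF open_W])

lemmas smooth_basic = V_smooth dq_smooth f_smooth v_smooth conn_smooth sum_smooth
  smooth_on_add[OF open_W] smooth_on_diff[OF open_W] smooth_on_mult[OF open_W] smooth_on_const[OF open_W]

lemma sode_smooth: "smooth_on W F \<Longrightarrow> smooth_on W (sode_derivation f F)"
  unfolding sode_derivation_def[abs_def] by (intro smooth_basic)

lemma EL_smooth: "smooth_on W L \<Longrightarrow> smooth_on W D \<Longrightarrow> smooth_on W (EL f L D i)"
  unfolding EL_def[abs_def] by (intro smooth_basic sode_smooth)

lemmas smooths = smooth_basic sode_smooth EL_smooth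

lemma sode_eq_dird: "smooth_on W F \<Longrightarrow> z \<in> W \<Longrightarrow> sode_derivation f F z = dird F (snd z, f z) z"
  by (simp add: sode_derivation_eq_dird smooth_on_differentiable)

lemma V_cong: "(\<And>y. y \<in> W \<Longrightarrow> F y = G y) \<Longrightarrow> z \<in> W \<Longrightarrow> V i F z = V i G z"
  and dq_cong: "(\<And>y. y \<in> W \<Longrightarrow> F y = G y) \<Longrightarrow> z \<in> W \<Longrightarrow> dq i F z = dq i G z"
  unfolding V_eq_dird dq_eq_dird by (rule dird_cong[OF open_W]; simp)+

lemma sode_cong:
  "(\<And>y. y \<in> W \<Longrightarrow> F y = G y) \<Longrightarrow> z \<in> W \<Longrightarrow> sode_derivation f F z = sode_derivation f G z"
  by (simp add: sode_derivation_def V_cong[of F G] dq_cong[of F G])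

context
  fixes z assumes z: "z \<in> W"
begin

lemmas dird_rules = dird_add[OF z, where F=F for F :: "'n tcoords \<Rightarrow> real"]
  dird_diff[OF z, where F=F for F :: "'n tcoords \<Rightarrow> real"]
  dird_sum[OF z, where F=F for F :: "_ \<Rightarrow> 'n tcoords \<Rightarrow> real"] dird_mult[OF z]

lemmas V_rules = dird_rules[where v="(0, axis i 1)" for i, folded V_eq_dird]
  and dq_rules = dird_rules[where v="(axis i 1, 0)" for i, folded dq_eq_dird]

lemma V_v: "V j (\<lambda>z. snd z $ i) z = (if i = j then 1 else 0)"
  and dq_v: "dq j (\<lambda>z. snd z $ i) z = 0"
proof -
  have "((\<lambda>z::'n tcoords. snd z $ i) has_derivative (\<lambda>h. snd h $ i)) (at z)"
    by (intro bounded_linear_imp_has_derivative bounded_linear_compose[OF bounded_linear_vec_nth bounded_linear_snd])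
  from dird_eqI[OF this] show "V j (\<lambda>z. snd z $ i) z = (if i = j then 1 else 0)"
    "dq j (\<lambda>z. snd z $ i) z = 0"
    by (auto simp: V_eq_dird dq_eq_dird axis_def)
qed

lemma V_commute: "smooth_on W F \<Longrightarrow> V i (V j F) z = V j (V i F) z"
  and dq_commute: "smooth_on W F \<Longrightarrow> dq i (dq j F) z = dq j (dq i F) z"
  and dq_V_commute: "smooth_on W F \<Longrightarrow> dq i (V j F) z = V j (dq i F) z"
  unfolding V_eq_dird dq_eq_dird by (auto intro: dird_commute[OF open_W _ z])

lemma sode_add: "smooth_on W F \<Longrightarrow> smooth_on W G \<Longrightarrow>
    sode_derivation f (\<lambda>y. F y + G y) z = sode_derivation f F z + sode_derivation f G z"
  and sode_diff: "smooth_on W F \<Longrightarrow> smooth_on W G \<Longrightarrow>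
    sode_derivation f (\<lambda>y. F y - G y) z = sode_derivation f F z - sode_derivation f G z"
  and sode_mult: "smooth_on W F \<Longrightarrow> smooth_on W G \<Longrightarrow>
    sode_derivation f (\<lambda>y. F y * G y) z = F z * sode_derivation f G z + sode_derivation f F z * G z"
  by (simp_all add: sode_eq_dird[OF _ z] smooths dird_rules)

lemma sode_sum: "(\<And>i. i \<in> I \<Longrightarrow> smooth_on W (F i)) \<Longrightarrow>
    sode_derivation f (\<lambda>y. \<Sum>i\<in>I. F i y) z = (\<Sum>i\<in>I. sode_derivation f (F i) z)"
  by (simp add: sode_eq_dird[OF _ z] smooths dird_rules)

lemma V_f: "V i (\<lambda>z. f z $ j) z = - 2 * conn f j i z"
  by (simp add: conn_def)

text \<open>This is the commutator of \<open>V j\<close> with the field: differentiating the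
  coefficient \<open>snd z $ i\<close> yields \<open>dq j\<close>, differentiating \<open>f\<close>
  yields \<open>- 2 * conn f\<close>.\<close>

lemma V_sode:
  assumes "smooth_on W F"
  shows "V j (sode_derivation f F) z
    = sode_derivation f (V j F) z + dq j F z - 2 * (\<Sum>k\<in>UNIV. conn f k j z * V k F z)"
proof -
  have "V j (sode_derivation f F) z
    = (\<Sum>i\<in>UNIV. snd z $ i * V j (dq i F) z + (if i = j then 1 else 0) * dq i F z)
      + (\<Sum>i\<in>UNIV. f z $ i * V j (V i F) z + V j (\<lambda>z. f z $ i) z * V i F z)"
    unfolding sode_derivation_def[abs_def] using assms by (simp add: V_rules smooths V_v)
  also have "(\<Sum>i\<in>UNIV. snd z $ i * V j (dq i F) z + (if i = j then 1 else 0) * dq i F z)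
      = (\<Sum>i\<in>UNIV. snd z $ i * dq i (V j F) z) + dq j F z"
    using assms by (simp add: sum.distrib dq_V_commute if_distrib[where f="\<lambda>x. x * _"] cong: if_cong)
  also have "(\<Sum>i\<in>UNIV. f z $ i * V j (V i F) z + V j (\<lambda>z. f z $ i) z * V i F z)
      = (\<Sum>i\<in>UNIV. f z $ i * V i (V j F) z) - 2 * (\<Sum>k\<in>UNIV. conn f k j z * V k F z)"
    using assms by (simp add: sum.distrib V_commute[of _ j] V_f sum_distrib_left sum_negf sum_subtractf mult.assoc)
  finally show ?thesis unfolding sode_derivation_def[of f "V j F" z] by simp
qed

text \<open>The commutator with \<open>dq j\<close> has one term only, since among the coefficients
  of the field just \<open>f\<close> depends on the position.\<close>

lemma dq_sode:
  assumes "smooth_on W F"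
  shows "dq j (sode_derivation f F) z
    = sode_derivation f (dq j F) z + (\<Sum>k\<in>UNIV. dq j (\<lambda>z. f z $ k) z * V k F z)"
proof -
  have "dq j (sode_derivation f F) z
    = (\<Sum>i\<in>UNIV. snd z $ i * dq j (dq i F) z)
      + (\<Sum>i\<in>UNIV. f z $ i * dq j (V i F) z + dq j (\<lambda>z. f z $ i) z * V i F z)"
    unfolding sode_derivation_def[abs_def] using assms by (simp add: dq_rules smooths dq_v)
  then show ?thesis
    using assms by (simp add: sum.distrib dq_V_commute dq_commute[of _ j] sode_derivation_def)
qed

text \<open>The commutator contributes \<open>- 2 * conn f\<close>. One half is absorbed by
  \<open>nabla_tensor\<close>, whose second connection term is compensated by the last sum;
  everything beyond the first two terms is then antisymmetric in \<open>i\<close> and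
  \<open>j\<close>.\<close>

lemma V_EL:
  assumes "smooth_on W L" "smooth_on W D"
  shows "V j (EL f L D i) z = nabla_tensor f (\<lambda>i j. V i (V j L)) j i z - V j (V i D) z
    + dq j (V i L) z - dq i (V j L) z
    - (\<Sum>k\<in>UNIV. conn f k j z * V k (V i L) z) + (\<Sum>k\<in>UNIV. conn f k i z * V k (V j L) z)"
proof -
  have "V j (EL f L D i) z = V j (sode_derivation f (V i L)) z - V j (dq i L) z - V j (V i D) z"
    unfolding EL_def[abs_def] using assms by (simp add: V_rules smooths)
  then show ?thesis
    using assms by (simp add: V_sode smooths nabla_tensor_def dq_V_commute V_commute[of _ j])
qed

text \<open>The connection is itself a vertical derivative of \<open>f\<close>, so this is the
  symmetry of second derivatives. It removes the first derivatives of \<open>D\<close> from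
  \<open>EL_curl\<close>.\<close>

lemma V_conn: "V i (conn f k j) z = V j (conn f k i) z"
proof -
  have "V i (conn f k j) z = - (1/2) * V i (V j (\<lambda>z. f z $ k)) z" for i j
    unfolding conn_def[abs_def] V_eq_dird
    by (simp only: dird_rules smooths[unfolded V_eq_dird] dird_const[OF z])
  then show ?thesis by (simp add: V_commute f_smooth)
qed

end

text \<open>All terms of \<open>V_EL\<close> except the first two cancel in the sum by
  antisymmetry.\<close>

lemma V_EL_symmetric_part:
  assumes "smooth_on W L" "smooth_on W D" "z \<in> W"
  shows "V j (EL f L D i) z + V i (EL f L D j) z
    = 2 * (nabla_tensor f (\<lambda>i j. V i (V j L)) i j z - V i (V j D) z)"
proof -
  have "nabla_tensor f (\<lambda>i j. V i (V j L)) j i z = nabla_tensor f (\<lambda>i j. V i (V j L)) i j z"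
    using sode_cong[OF V_commute[OF _ assms(1), of _ j i] assms(3)]
    by (simp add: nabla_tensor_def V_commute[OF assms(3,1), of _ i] V_commute[OF assms(3,1), of _ j])
  then show ?thesis
    using assms by (simp add: V_EL V_commute[OF assms(3,2), of j i])
qed

text \<open>The field derivatives of \<open>dq i (V j L)\<close> occur in the first two terms and in
  the third, and cancel; of \<open>L\<close> only its fibre Hessian survives. The derivative of this
  Hessian along the field is eliminated by \<open>nabla\<close>, and the remaining connection terms
  assemble into \<open>jacobi\<close>.\<close>

lemma EL_curl:
  assumes L: "smooth_on W L" and D: "smooth_on W D" and z: "z \<in> W"
    and nabla: "\<And>z i j. z \<in> W \<Longrightarrow> nabla_tensor f (\<lambda>i j. V i (V j L)) i j z = V i (V j D) z"
  shows "dq i (EL f L D j) z - dq j (EL f L D i) z - sode_derivation f (V i (EL f L D j)) z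
    = dV_form (dH_fun f D) i j z - jacobi_antisym f (\<lambda>i j. V i (V j L)) i j z"
proof -
  define c where "c k i = conn f k i z" for k i
  define G where "G k i = V k (V i L) z" for k i
  define dG where "dG k i = sode_derivation f (V k (V i L)) z" for k i
  define dc where "dc k i = sode_derivation f (conn f k i) z" for k i
  define df where "df i k = dq i (\<lambda>z. f z $ k) z" for i k
  define D2 where "D2 k i = V k (V i D) z" for k i
  note defs = c_def G_def dG_def dc_def df_def D2_def
  have G_sym: "G k l = G l k" for k l
    using V_commute[OF z L] by (simp add: G_def)
  have dG: "dG k l = D2 k l + (\<Sum>m\<in>UNIV. c m k * G m l) + (\<Sum>m\<in>UNIV. c m l * G k m)" for k l
    using nabla[OF z, of k l] by (simp add: nabla_tensor_def defs)
  \<comment> \<open>The hypothesis \<open>nabla\<close> holds on all of \<open>W\<close>, so it may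
    be inserted before the field is applied.\<close>
  have "V i (EL f L D j) y = dq i (V j L) y - dq j (V i L) y
    - (\<Sum>k\<in>UNIV. conn f k i y * V k (V j L) y) + (\<Sum>k\<in>UNIV. conn f k j y * V k (V i L) y)"
    if "y \<in> W" for y
    using V_EL[OF that L D] nabla[OF that] by simp
  from sode_cong[OF this z]
  have 1: "sode_derivation f (V i (EL f L D j)) z = sode_derivation f (dq i (V j L)) z
    - sode_derivation f (dq j (V i L)) z
    - (\<Sum>k\<in>UNIV. c k i * dG k j + dc k i * G k j) + (\<Sum>k\<in>UNIV. c k j * dG k i + dc k j * G k i)"
    using L z by (simp add: sode_add sode_diff sode_sum sode_mult smooths defs)
  have 2: "dq i (EL f L D j) z = sode_derivation f (dq i (V j L)) z + (\<Sum>k\<in>UNIV. df i k * G k j)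
      - dq i (dq j L) z - dq i (V j D) z" for i j
    unfolding EL_def[abs_def] using L D z by (simp add: dq_rules smooths dq_sode defs)
  have 3: "V i (H f j D) z = V i (dq j D) z
     - (\<Sum>k\<in>UNIV. c k j * D2 k i + V i (conn f k j) z * V k D z)" for i j
    unfolding H_def[abs_def] using L D z
    by (simp add: V_rules smooths defs V_commute[OF z D, of i])
  \<comment> \<open>Of the terms quadratic in the connection these are symmetric in \<open>i\<close>
    and \<open>j\<close> and drop out; the others belong to the Jacobi endomorphism.\<close>
  define X where "X i j = (\<Sum>k\<in>UNIV. \<Sum>l\<in>UNIV. c k i * c l j * G k l)" for i j
  have 4: "(\<Sum>k\<in>UNIV. c k i * dG k j) = (\<Sum>k\<in>UNIV. c k i * D2 k j)
      + (\<Sum>k\<in>UNIV. (\<Sum>l\<in>UNIV. c l i * c k l) * G k j) + X i j" for i j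
  proof -
    have "(\<Sum>k\<in>UNIV. c k i * (\<Sum>m\<in>UNIV. c m k * G m j)) = (\<Sum>k\<in>UNIV. (\<Sum>l\<in>UNIV. c l i * c k l) * G k j)"
      unfolding sum_distrib_left sum_distrib_right by (subst sum.swap) (simp add: mult.assoc)
    then show ?thesis
      unfolding dG X_def by (simp add: distrib_left sum.distrib) (simp add: sum_distrib_left mult.assoc)
  qed
  have 5: "X i j = X j i"
    unfolding X_def by (subst sum.swap) (simp add: G_sym mult.commute)
  have 6: "jacobi_antisym f (\<lambda>i j. V i (V j L)) i j z
    = (\<Sum>k\<in>UNIV. (- df i k - (\<Sum>l\<in>UNIV. c l i * c k l) - dc k i) * G k j)
      - (\<Sum>k\<in>UNIV. (- df j k - (\<Sum>l\<in>UNIV. c l j * c k l) - dc k j) * G k i)"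
    unfolding jacobi_antisym_def jacobi_def by (simp add: defs V_commute[OF z L, of i])
  show ?thesis
    unfolding 1 2 6 dV_form_def dH_fun_def 3
    using V_conn[OF z] V_commute[OF z D]
    by (simp add: sum.distrib 4 5 algebra_simps sum_subtractf sum_negf dq_commute[OF z L, of i j]
        dq_V_commute[OF z D])
qed

end


section \<open>Integration along rays and the Poincare lemma\<close>

text \<open>The weight \<open>s\<^sup>m\<close> absorbs the factors \<open>s\<close> produced by derivatives in the second argument.\<close>

definition radial :: "nat \<Rightarrow> 'b::euclidean_space \<Rightarrow> ('a::euclidean_space \<times> 'b \<Rightarrow> real) \<Rightarrow> 'a \<times> 'b \<Rightarrow> real" where
  "radial m c h z = integral {0..1} (\<lambda>s. s ^ m * h (fst z, c + s *\<^sub>R (snd z - c)))"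

text \<open>The factor \<open>S\<close> is a space of parameters. The roles are chosen later: the
  base as \<open>S\<close> and the whole vector space as \<open>C\<close> for forms on the fibres of
  the tangent bundle, and the reverse for forms on the base.\<close>

locale star_fibres =
  fixes S :: "'a::euclidean_space set" and C :: "'b::euclidean_space set" and c :: 'b
  assumes open_S: "open S" and open_C: "open C" and convex_C: "convex C" and c: "c \<in> C"
begin

lemma open_SC: "open (S \<times> C)"
  by (simp add: open_S open_C open_Times)

lemma scaled_mem: "z \<in> S \<times> C \<Longrightarrow> 0 \<le> s \<Longrightarrow> s \<le> 1 \<Longrightarrow> (fst z, c + s *\<^sub>R (snd z - c)) \<in> S \<times> C"
  using convexD_alt[OF convex_C c, of "snd z" s] by (auto simp: algebra_simps)

lemma integrand_continuous:
  assumes "continuous_on (S \<times> C) h" "z \<in> S \<times> C"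
  shows "continuous_on {0..1} (\<lambda>s. s ^ m * h (fst z, c + s *\<^sub>R (snd z - c)))"
  by (intro continuous_on_mult continuous_on_power continuous_on_id continuous_on_compose2[OF assms(1)])
    (use scaled_mem[OF assms(2)] in \<open>force intro!: continuous_intros\<close>)+

lemma integrand_integrable:
  assumes "continuous_on (S \<times> C) h" "z \<in> S \<times> C"
  shows "(\<lambda>s. s ^ m * h (fst z, c + s *\<^sub>R (snd z - c))) integrable_on {0..1}"
  using integrand_continuous[OF assms] by (rule integrable_continuous_real)

lemma scaled_has_derivative:
  assumes "smooth_on (S \<times> C) h" "z \<in> S \<times> C" "0 \<le> s" "s \<le> 1"
  shows "((\<lambda>z. h (fst z, c + s *\<^sub>R (snd z - c))) has_derivative
    (\<lambda>v. dird h (fst v, s *\<^sub>R snd v) (fst z, c + s *\<^sub>R (snd z - c)))) (at z)"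
proof -
  have "((\<lambda>z. (fst z, c + s *\<^sub>R (snd z - c))) has_derivative (\<lambda>v. (fst v, s *\<^sub>R snd v))) (at z)"
    by (auto intro!: derivative_eq_intros simp: algebra_simps)
  from has_derivative_compose[OF this smooth_on_has_derivative[OF assms(1) scaled_mem[OF assms(2-4)]]]
  show ?thesis .
qed

lemma dird_split:
  assumes "smooth_on (S \<times> C) h" "z \<in> S \<times> C"
  shows "dird h (a, s *\<^sub>R b) z = dird h (a, 0) z + s * dird h (0, b) z"
  using linear_add[OF dird_linear, of h z "(a, 0)" "s *\<^sub>R (0, b)"] linear_scale[OF dird_linear, of h z s "(0, b)"]
    smooth_on_differentiable[OF assms] by simp

lemma radial_has_derivative:
  assumes h: "smooth_on (S \<times> C) h" and z: "z \<in> S \<times> C"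
  shows "(radial m c h has_derivative
    (\<lambda>v. radial m c (dird h (fst v, 0)) z + radial (Suc m) c (dird h (0, snd v)) z)) (at z)"
proof -
  obtain e where e: "e > 0" "ball z e \<subseteq> S \<times> C"
    using open_SC z openE by blast
  define f' where "f' x s v = s ^ m * dird h (fst v, s *\<^sub>R snd v) (fst x, c + s *\<^sub>R (snd x - c))"
    for x :: "'a \<times> 'b" and s v
  have der: "((\<lambda>x. s ^ m * h (fst x, c + s *\<^sub>R (snd x - c))) has_derivative f' x s) (at x)"
    if "x \<in> ball z e" "s \<in> {0..1}" for x s
    unfolding f'_def using that e
    by (intro bounded_linear.has_derivative[OF bounded_linear_mult_right] scaled_has_derivative h) auto
  then have app: "blinfun_apply (Blinfun (f' x s)) = f' x s" if "x \<in> ball z e" "s \<in> {0..1}" for x s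
    using that has_derivative_bounded_linear bounded_linear_Blinfun_apply by blast
  have f'_alt: "f' x s v = s ^ m * dird h (fst v, 0) (fst x, c + s *\<^sub>R (snd x - c))
      + s ^ Suc m * dird h (0, snd v) (fst x, c + s *\<^sub>R (snd x - c))"
    if "x \<in> S \<times> C" "s \<in> {0..1}" for x s v
    using dird_split[OF h scaled_mem[OF that(1)], of s "fst v" s "snd v"] that
    by (simp add: f'_def algebra_simps)
  \<comment> \<open>The Leibniz rule asks for continuity of the derivative as a linear map; in
    finite dimension this can be tested on fixed vectors.\<close>
  have cont: "continuous_on (ball z e \<times> cbox 0 1) (\<lambda>(x, s). Blinfun (f' x s))"
  proof (rule continuous_on_blinfun_componentwise)
    fix i :: "'a \<times> 'b"
    have "continuous_on (ball z e \<times> cbox 0 1) (\<lambda>p. dird h w (fst (fst p), c + snd p *\<^sub>R (snd (fst p) - c)))" for w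
    proof (rule continuous_on_compose2[OF smooth_on_continuous_on[OF smooth_on_dird[OF h]]])
      show "(\<lambda>p. (fst (fst p), c + snd p *\<^sub>R (snd (fst p) - c))) ` (ball z e \<times> cbox 0 1) \<subseteq> S \<times> C"
      proof
        fix q assume "q \<in> (\<lambda>p. (fst (fst p), c + snd p *\<^sub>R (snd (fst p) - c))) ` (ball z e \<times> cbox (0::real) 1)"
        then obtain x s where xs: "q = (fst x, c + s *\<^sub>R (snd x - c))" "x \<in> ball z e" "s \<in> cbox (0::real) 1"
          by auto
        then show "q \<in> S \<times> C" using scaled_mem[of x s] e(2) by auto
      qed
    qed (auto intro!: continuous_intros)
    then have "continuous_on (ball z e \<times> cbox 0 1) (\<lambda>p. snd p ^ m * dird h (fst i, 0) (fst (fst p), c + snd p *\<^sub>R (snd (fst p) - c))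
      + snd p ^ Suc m * dird h (0, snd i) (fst (fst p), c + snd p *\<^sub>R (snd (fst p) - c)))"
      by (intro continuous_intros)
    then show "continuous_on (ball z e \<times> cbox 0 1) (\<lambda>p. blinfun_apply (case p of (x, s) \<Rightarrow> Blinfun (f' x s)) i)"
    proof (rule continuous_on_eq)
      fix p assume "p \<in> ball z e \<times> cbox (0::real) 1"
      then have p: "fst p \<in> ball z e" "snd p \<in> {0..1}" by auto
      then have "fst p \<in> S \<times> C" using e by blast
      from f'_alt[OF this p(2), of i] app[OF p]
      show "snd p ^ m * dird h (fst i, 0) (fst (fst p), c + snd p *\<^sub>R (snd (fst p) - c))
        + snd p ^ Suc m * dird h (0, snd i) (fst (fst p), c + snd p *\<^sub>R (snd (fst p) - c))
        = blinfun_apply (case p of (x, s) \<Rightarrow> Blinfun (f' x s)) i"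
        by (simp add: split_beta)
    qed
  qed
  have "((\<lambda>x. integral (cbox 0 1) (\<lambda>s. s ^ m * h (fst x, c + s *\<^sub>R (snd x - c)))) has_derivative
      integral (cbox 0 1) (\<lambda>s. Blinfun (f' z s))) (at z within ball z e)"
  proof (rule leibniz_rule[OF _ _ cont])
    show "(\<lambda>s. s ^ m * h (fst x, c + s *\<^sub>R (snd x - c))) integrable_on cbox 0 1" if "x \<in> ball z e" for x
      using integrand_integrable[OF smooth_on_continuous_on[OF h], of x m] that e by auto
  qed (use e der app in \<open>auto intro: has_derivative_at_withinI\<close>)
  then have D: "(radial m c h has_derivative integral (cbox 0 1) (\<lambda>s. Blinfun (f' z s))) (at z)"
    using e by (simp add: radial_def[abs_def] at_within_open[OF _ open_ball])
  have "(\<lambda>s. Blinfun (f' z s)) integrable_on cbox 0 1"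
    by (rule integrable_continuous)
      (use e in \<open>auto intro!: continuous_on_compose2[OF cont, of _ "\<lambda>s. (z, s)", unfolded prod.case] continuous_intros\<close>)
  then have "blinfun_apply (integral (cbox 0 1) (\<lambda>s. Blinfun (f' z s))) v = integral (cbox 0 1) (\<lambda>s. Blinfun (f' z s) v)" for v
    by (simp add: blinfun_apply_integral)
  also have "integral (cbox 0 1) (\<lambda>s. Blinfun (f' z s) v) = integral {0..1} (\<lambda>s. s ^ m * dird h (fst v, 0) (fst z, c + s *\<^sub>R (snd z - c))
      + s ^ Suc m * dird h (0, snd v) (fst z, c + s *\<^sub>R (snd z - c)))" for v
    by (simp only: box_real, rule integral_cong) (use e app f'_alt[OF z] in auto)
  also have "\<dots> v = radial m c (dird h (fst v, 0)) z + radial (Suc m) c (dird h (0, snd v)) z" for v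
    unfolding radial_def
    by (rule integral_add) (intro integrand_integrable smooth_on_continuous_on smooth_on_dird h z)+
  finally show ?thesis by (intro has_derivative_eq_rhs[OF D] ext)
qed

text \<open>The induction must allow every integrand and weight: the derivative of a radial integral
  is a sum of two others, one of them of higher weight.\<close>

lemma Ck_on_radial: "smooth_on (S \<times> C) h \<Longrightarrow> Ck_on k (S \<times> C) (radial m c h)"
proof (induction k arbitrary: m h)
  case 0
  then show ?case
    using has_derivative_continuous[OF radial_has_derivative[OF 0]]
    by (simp add: continuous_at_imp_continuous_on)
next
  case (Suc k)
  show ?case
    by (rule Ck_on_SucI[OF open_SC radial_has_derivative[OF Suc.prems]])
      (assumption | intro Ck_on_add open_SC Suc.IH smooth_on_dird Suc.prems)+
qed

lemma smooth_on_radial: "smooth_on (S \<times> C) h \<Longrightarrow> smooth_on (S \<times> C) (radial m c h)"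
  by (simp add: smooth_on_def Ck_on_radial[unfolded smooth_on_def])

lemma dird_radial:
  assumes "smooth_on (S \<times> C) h" "z \<in> S \<times> C"
  shows "dird (radial m c h) (0, b) z = radial (Suc m) c (dird h (0, b)) z"
proof -
  have "dird h (0, 0) y = 0" if "y \<in> S \<times> C" for y
    using linear_0[OF dird_linear[OF smooth_on_differentiable[OF assms(1) that]]] by (simp add: zero_prod_def)
  then have "radial m c (dird h (0, 0)) z = integral {0..1} (\<lambda>s::real. 0)"
    unfolding radial_def using scaled_mem[OF assms(2)] by (intro integral_cong) auto
  then show ?thesis
    using dird_eqI[OF radial_has_derivative[OF assms], of m "(0, b)"] by simp
qed

text \<open>This is \<open>\<integral>\<^sub>0\<^sup>1 d/ds (s\<^sup>m\<^sup>+\<^sup>1 h(q, c + s(v - c))) ds = h(q, v)\<close>.\<close>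

lemma radial_homotopy:
  assumes h: "smooth_on (S \<times> C) h" and z: "z \<in> S \<times> C"
  shows "radial (Suc m) c (dird h (0, snd z - c)) z + real (Suc m) * radial m c h z = h z"
proof -
  let ?y = "\<lambda>s. (fst z, c + s *\<^sub>R (snd z - c))"
  have der: "((\<lambda>s. s ^ Suc m * h (?y s)) has_vector_derivative
      (s ^ Suc m * dird h (0, snd z - c) (?y s) + real (Suc m) * (s ^ m * h (?y s)))) (at s within {0..1})"
    if s: "s \<in> {0..1}" for s
  proof -
    note H = smooth_on_has_derivative[OF h scaled_mem[OF z, of s]]
    have "((\<lambda>s. ?y s) has_derivative (\<lambda>d. d *\<^sub>R (0, snd z - c))) (at s)"
      by (auto intro!: derivative_eq_intros)
    from has_derivative_compose[OF this H] s
    have "((\<lambda>s. h (?y s)) has_derivative (\<lambda>d. d * dird h (0, snd z - c) (?y s))) (at s)"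
      using linear_scale[OF dird_linear[OF smooth_on_differentiable[OF h scaled_mem[OF z, of s]]],
          of _ "(0, snd z - c)"] by simp
    then have "((\<lambda>s. h (?y s)) has_field_derivative dird h (0, snd z - c) (?y s)) (at s)"
      by (simp add: has_field_derivative_def mult_commute_abs)
    then have "((\<lambda>s. s ^ Suc m * h (?y s)) has_field_derivative
      (s ^ Suc m * dird h (0, snd z - c) (?y s) + real (Suc m) * (s ^ m * h (?y s)))) (at s)"
      by (auto intro!: derivative_eq_intros simp del: power_Suc of_nat_Suc)
    then show ?thesis
      unfolding has_real_derivative_iff_has_vector_derivative[symmetric]
      by (rule has_field_derivative_at_within)
  qed
  have "((\<lambda>s. s ^ Suc m * dird h (0, snd z - c) (?y s) + real (Suc m) * (s ^ m * h (?y s)))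
      has_integral (1 ^ Suc m * h (?y 1) - 0 ^ Suc m * h (?y 0))) {0..1}"
    by (rule fundamental_theorem_of_calculus) (use der in auto)
  then have "h z = integral {0..1} (\<lambda>s. s ^ Suc m * dird h (0, snd z - c) (?y s) + real (Suc m) * (s ^ m * h (?y s)))"
    by (simp add: integral_unique)
  also have "\<dots> = radial (Suc m) c (dird h (0, snd z - c)) z + real (Suc m) * radial m c h z"
    unfolding radial_def integral_mult_right[symmetric]
    by (intro integral_add integrable_on_mult_right integrand_integrable smooth_on_continuous_on smooth_on_dird h z)
  finally show ?thesis ..
qed

lemma radial_sum:
  assumes "\<And>i. i \<in> I \<Longrightarrow> smooth_on (S \<times> C) (h i)" "z \<in> S \<times> C"
    "\<And>y. y \<in> S \<times> C \<Longrightarrow> G y = (\<Sum>i\<in>I. a i * h i y)"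
  shows "radial m c G z = (\<Sum>i\<in>I. a i * radial m c (h i) z)"
proof -
  have int: "(\<lambda>s. s ^ m * h i (fst z, c + s *\<^sub>R (snd z - c))) integrable_on {0..1}" if "i \<in> I" for i
    by (intro integrand_integrable smooth_on_continuous_on assms that)
  have "radial m c G z = integral {0..1} (\<lambda>s. \<Sum>i\<in>I. a i * (s ^ m * h i (fst z, c + s *\<^sub>R (snd z - c))))"
    unfolding radial_def
  proof (rule integral_cong)
    fix s :: real assume "s \<in> {0..1}"
    then show "s ^ m * G (fst z, c + s *\<^sub>R (snd z - c)) = (\<Sum>i\<in>I. a i * (s ^ m * h i (fst z, c + s *\<^sub>R (snd z - c))))"
      by (subst assms(3)[OF scaled_mem[OF assms(2)]]) (auto simp: sum_distrib_left algebra_simps)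
  qed
  also have "\<dots> = (\<Sum>i\<in>I. integral {0..1} (\<lambda>s. a i * (s ^ m * h i (fst z, c + s *\<^sub>R (snd z - c)))))"
  proof (cases "finite I")
    case True
    then show ?thesis by (intro integral_sum integrable_on_mult_right int)
  qed simp
  finally show ?thesis by (simp add: radial_def)
qed

end

locale star_fibres_vec = star_fibres S C c
  for S :: "(real^'n::finite) set" and C :: "(real^'n) set" and c
begin

sublocale sode_coords "S \<times> C" "\<lambda>z. 0"
  by unfold_locales (auto intro: open_SC smooth_on_const)

lemma V_radial:
  "smooth_on (S \<times> C) h \<Longrightarrow> z \<in> S \<times> C \<Longrightarrow> V i (radial m c h) z = radial (Suc m) c (V i h) z"
  by (simp add: V_eq_dird dird_radial)

lemma radial_homotopy_V:
  assumes "smooth_on (S \<times> C) h" "z \<in> S \<times> C"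
  shows "(\<Sum>i\<in>UNIV. (snd z $ i - c $ i) * radial (Suc m) c (V i h) z) + real (Suc m) * radial m c h z = h z"
proof -
  have "radial (Suc m) c (dird h (0, snd z - c)) z = (\<Sum>i\<in>UNIV. (snd z $ i - c $ i) * radial (Suc m) c (V i h) z)"
    by (rule radial_sum[OF _ assms(2)])
      (simp_all add: V_smooth assms dird_tcoords smooth_on_differentiable[OF assms(1)])
  then show ?thesis using radial_homotopy[OF assms, of m] by simp
qed

text \<open>Contracting radial integrals with the ray vector is the homotopy operator of the
  Poincare lemma. The first term comes from differentiating the ray vector.\<close>

lemma V_contract_radial:
  assumes "\<And>i. smooth_on (S \<times> C) (h i)" "z \<in> S \<times> C"
  shows "V k (\<lambda>z. \<Sum>i\<in>UNIV. (snd z $ i - c $ i) * radial m c (h i) z) z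
    = radial m c (h k) z + (\<Sum>i\<in>UNIV. (snd z $ i - c $ i) * radial (Suc m) c (V k (h i)) z)"
proof -
  have V_c: "V k (\<lambda>z. c $ i) z = 0" for k i
    by (simp add: V_eq_dird dird_const[OF assms(2)])
  show ?thesis
    using assms by (simp add: V_rules smooths smooth_on_radial V_radial V_v V_c sum.distrib
        if_distrib[where f="\<lambda>x. x * _"] cong: if_cong)
qed

lemma contract_radial_smooth:
  "(\<And>i. smooth_on (S \<times> C) (h i)) \<Longrightarrow>
    smooth_on (S \<times> C) (\<lambda>z. \<Sum>i\<in>UNIV. (snd z $ i - c $ i) * radial m c (h i) z)"
  by (intro smooths smooth_on_radial)

text \<open>Closedness turns the sum in \<open>V_contract_radial\<close> into the one of the
  homotopy formula with \<open>m = 0\<close>. The potential is jointly smooth in the parameter and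
  the fibre variable.\<close>

lemma poincare_1form:
  assumes sm: "\<And>i. smooth_on (S \<times> C) (\<omega> i)"
    and closed: "\<And>i j z. z \<in> S \<times> C \<Longrightarrow> V i (\<omega> j) z = V j (\<omega> i) z"
  shows "\<exists>F. smooth_on (S \<times> C) F \<and> (\<forall>i. \<forall>z\<in>S \<times> C. V i F z = \<omega> i z)"
proof (intro exI conjI allI ballI)
  let ?F = "\<lambda>z. \<Sum>i\<in>UNIV. (snd z $ i - c $ i) * radial 0 c (\<omega> i) z"
  show "smooth_on (S \<times> C) ?F" by (rule contract_radial_smooth[OF sm])
  fix k z assume z: "z \<in> S \<times> C"
  have "radial (Suc 0) c (V k (\<omega> i)) z = radial (Suc 0) c (V i (\<omega> k)) z" for i
    unfolding radial_def using closed scaled_mem[OF z] by (intro integral_cong) auto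
  then show "V k ?F z = \<omega> k z"
    unfolding V_contract_radial[OF sm z] using radial_homotopy_V[OF sm z, of 0 k] by simp
qed

lemma poincare_2form:
  assumes sm: "\<And>i j. smooth_on (S \<times> C) (r i j)"
    and antisym: "\<And>i j z. z \<in> S \<times> C \<Longrightarrow> r i j z = - r j i z"
    and closed: "\<And>i j k z. z \<in> S \<times> C \<Longrightarrow> V i (r j k) z + V j (r k i) z + V k (r i j) z = 0"
  shows "\<exists>\<alpha>. (\<forall>i. smooth_on (S \<times> C) (\<alpha> i)) \<and> (\<forall>i j. \<forall>z\<in>S \<times> C. V i (\<alpha> j) z - V j (\<alpha> i) z = r i j z)"
proof (intro exI conjI allI ballI)
  \<comment> \<open>The homotopy operator for p-forms has the weight \<open>s ^ (p - 1)\<close>,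
    hence \<open>radial 1\<close> for a 2-form.\<close>
  let ?\<alpha> = "\<lambda>j z. \<Sum>i\<in>UNIV. (snd z $ i - c $ i) * radial 1 c (r i j) z"
  show "smooth_on (S \<times> C) (?\<alpha> j)" for j by (rule contract_radial_smooth[OF sm])
  fix k j z assume z: "z \<in> S \<times> C"
  have eq: "V k (r i j) y = V j (r i k) y + V i (r k j) y" if y: "y \<in> S \<times> C" for i y
  proof -
    have anti: "V a (r b d) y = - V a (r d b) y" for a b d
    proof -
      have "V a (r b d) y = V a (\<lambda>y. (-1) * r d b y) y"
        by (rule V_cong) (use antisym[of _ b d] y in auto)
      also have "\<dots> = - V a (r d b) y"
        unfolding V_eq_dird
        using dird_mult[OF y smooth_on_const[OF open_SC] sm[of d b], of "-1"] dird_const[OF y, of "-1::real"] by simp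
      finally show ?thesis .
    qed
    show ?thesis using closed[OF y, of k i j] anti[of i j k] anti[of j k i] by simp
  qed
  \<comment> \<open>Additivity of the radial integral, obtained as a sum over the two-element index
    type \<open>bool\<close>.\<close>
  have rad: "radial 2 c (V k (r i j)) z = radial 2 c (V j (r i k)) z + radial 2 c (V i (r k j)) z" for i
    using radial_sum[where I="UNIV::bool set" and h="\<lambda>b. if b then V j (r i k) else V i (r k j)"
        and a="\<lambda>_. 1" and G="V k (r i j)" and z=z and m=2] V_smooth[OF sm] z eq
    by (simp add: UNIV_bool)
  have anti1: "radial 1 c (r j k) z = - radial 1 c (r k j) z"
    using radial_sum[where I="{()}" and h="\<lambda>_. r k j" and a="\<lambda>_. -1" and G="r j k" and z=z and m=1] sm z antisym[of _ j k]
    by simp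
  \<comment> \<open>The undifferentiated terms of the two derivatives are negatives of each other,
    which yields the factor 2 required by the homotopy formula with \<open>m = 1\<close>.\<close>
  have "V k (?\<alpha> j) z - V j (?\<alpha> k) z = 2 * radial 1 c (r k j) z
     + (\<Sum>i\<in>UNIV. (snd z $ i - c $ i) * radial 2 c (V i (r k j)) z)"
  proof -
    have "(\<Sum>i\<in>UNIV. (snd z $ i - c $ i) * radial 2 c (V k (r i j)) z)
      = (\<Sum>i\<in>UNIV. (snd z $ i - c $ i) * radial 2 c (V j (r i k)) z)
        + (\<Sum>i\<in>UNIV. (snd z $ i - c $ i) * radial 2 c (V i (r k j)) z)"
      unfolding rad by (simp only: distrib_left sum.distrib)
    moreover have "V a (?\<alpha> b) z = radial 1 c (r a b) z
        + (\<Sum>i\<in>UNIV. (snd z $ i - c $ i) * radial 2 c (V a (r i b)) z)" for a b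
      using V_contract_radial[OF sm z, where m=1] by (simp only: numeral_2_eq_2 One_nat_def)
    ultimately show ?thesis using anti1 by simp
  qed
  then show "V k (?\<alpha> j) z - V j (?\<alpha> k) z = r k j z"
    using radial_homotopy_V[OF sm z, of 1 k j] by (simp add: numeral_2_eq_2)
qed

end


section \<open>Local existence of a Lagrangian\<close>

context sode_coords
begin

lemma nabla_cong:
  assumes "\<And>i j y. y \<in> W \<Longrightarrow> g i j y = g' i j y" "z \<in> W"
  shows "nabla_tensor f g i j z = nabla_tensor f g' i j z"
  using sode_cong[of "g i j" "g' i j" z] assms by (simp add: nabla_tensor_def)

lemma V_minus: "smooth_on W F \<Longrightarrow> z \<in> W \<Longrightarrow> V i (\<lambda>y. - F y) z = - V i F z"
  unfolding V_eq_dird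
  by (rule dird_bounded_linear[where S=W]) (auto intro: bounded_linear_minus bounded_linear_ident)

lemma V_zero: "(\<And>y. y \<in> W \<Longrightarrow> F y = 0) \<Longrightarrow> z \<in> W \<Longrightarrow> V i F z = 0"
  and dq_zero: "(\<And>y. y \<in> W \<Longrightarrow> F y = 0) \<Longrightarrow> z \<in> W \<Longrightarrow> dq i F z = 0"
  using V_cong[of F "\<lambda>_. 0"] dq_cong[of F "\<lambda>_. 0"] dird_const[of z W "0::real"]
  by (simp_all add: V_eq_dird dq_eq_dird)

end

section \<open>Velocity-independent functions, and the exchange of base and fibre\<close>

lemma fibre_constant:
  fixes h :: "'n::finite tcoords \<Rightarrow> real"
  assumes h: "smooth_on (B \<times> UNIV) h" and V0: "\<And>i z. fst z \<in> B \<Longrightarrow> V i h z = 0" and z: "fst z \<in> B"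
  shows "h z = h (fst z, 0)"
proof -
  have "((\<lambda>v. h (fst z, v)) has_derivative (\<lambda>b. 0)) (at v within UNIV)" for v
  proof -
    have mem: "(fst z, v) \<in> B \<times> UNIV" using z by simp
    have "((\<lambda>v. (fst z, v)) has_derivative (\<lambda>b. (0, b))) (at v)"
      by (auto intro!: derivative_eq_intros)
    from has_derivative_compose[OF this smooth_on_has_derivative[OF h mem]]
    show ?thesis
      using dird_tcoords[OF smooth_on_differentiable[OF h mem], of 0] V0[of "(fst z, v)"] z by simp
  qed
  from has_derivative_zero_unique[OF convex_UNIV this, of "snd z" 0] show ?thesis by simp
qed

text \<open>Restricting to zero velocity and moving the base point to the second slot, with a dummy
  first slot, turns \<open>dq\<close> into \<open>V\<close>. In this form the Poincare lemma for
  fibres applies to forms on the base.\<close>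

lemma base_to_fibre:
  fixes h :: "'n::finite tcoords \<Rightarrow> real"
  assumes B: "open B" and h: "smooth_on (B \<times> UNIV) h"
  shows "smooth_on (UNIV \<times> B) (\<lambda>z::'n tcoords. h (snd z, 0))"
    and "z \<in> UNIV \<times> B \<Longrightarrow> V i (\<lambda>z. h (snd z, 0)) z = dq i h (snd z, 0)"
proof -
  have op: "open ((UNIV :: (real^'n) set) \<times> B)" "open (B \<times> (UNIV :: (real^'n) set))" using B by (auto intro: open_Times)
  have bl: "bounded_linear (\<lambda>z::'n tcoords. (snd z, 0::real^'n))"
    by (intro bounded_linear_Pair bounded_linear_snd bounded_linear_zero)
  show "smooth_on (UNIV \<times> B) (\<lambda>z::'n tcoords. h (snd z, 0))"
    using smooth_on_compose[where g=h, OF op(1,2) _ smooth_on_linear[OF bl op(1)] h] by auto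
  assume "z \<in> UNIV \<times> B"
  then have "(snd z, 0) \<in> B \<times> UNIV" by auto
  from dird_eqI[OF has_derivative_compose[OF bounded_linear_imp_has_derivative[OF bl] smooth_on_has_derivative[OF h this]]]
  show "V i (\<lambda>z. h (snd z, 0)) z = dq i h (snd z, 0)"
    by (simp add: V_eq_dird dq_eq_dird)
qed

text \<open>The way back: potentials found on the base become functions that do not depend on the
  velocity.\<close>

lemma fibre_to_base:
  fixes h :: "'n::finite tcoords \<Rightarrow> real"
  assumes B: "open B" and h: "smooth_on (UNIV \<times> B) h"
  shows "smooth_on (B \<times> UNIV) (\<lambda>z::'n tcoords. h (0, fst z))"
    and "z \<in> B \<times> UNIV \<Longrightarrow> dq i (\<lambda>z. h (0, fst z)) z = V i h (0, fst z)"
    and "z \<in> B \<times> UNIV \<Longrightarrow> V i (\<lambda>z. h (0, fst z)) z = 0"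
proof -
  have op: "open ((UNIV :: (real^'n) set) \<times> B)" "open (B \<times> (UNIV :: (real^'n) set))" using B by (auto intro: open_Times)
  have bl: "bounded_linear (\<lambda>z::'n tcoords. (0::real^'n, fst z))"
    by (intro bounded_linear_Pair bounded_linear_fst bounded_linear_zero)
  show "smooth_on (B \<times> UNIV) (\<lambda>z::'n tcoords. h (0, fst z))"
    using smooth_on_compose[where g=h, OF op(2,1) _ smooth_on_linear[OF bl op(2)] h] by auto
  assume "z \<in> B \<times> UNIV"
  then have mem: "(0, fst z) \<in> UNIV \<times> B" by auto
  note D = has_derivative_compose[OF bounded_linear_imp_has_derivative[OF bl] smooth_on_has_derivative[OF h mem]]
  show "dq i (\<lambda>z. h (0, fst z)) z = V i h (0, fst z)"
    using dird_eqI[OF D] by (simp add: V_eq_dird dq_eq_dird)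
  show "V i (\<lambda>z. h (0, fst z)) z = 0"
    using dird_eqI[OF D] linear_0[OF dird_linear[OF smooth_on_differentiable[OF h mem]]]
    by (simp add: V_eq_dird zero_prod_def)
qed

text \<open>Over a convex \<open>B\<close> both Poincare lemmas are available: the fibres are whole
  vector spaces, so only the base has to be shrunk.\<close>

theorem local_lagrangian:
  fixes B :: "(real^'n::finite) set" and g :: "'n \<Rightarrow> 'n \<Rightarrow> 'n tcoords \<Rightarrow> real"
  assumes B: "open B" "convex B" "c \<in> B"
    and f: "smooth_on (B \<times> UNIV) f" and D: "smooth_on (B \<times> UNIV) D"
    and g: "\<And>i j. smooth_on (B \<times> UNIV) (g i j)"
    and g_sym: "\<And>i j z. fst z \<in> B \<Longrightarrow> g i j z = g j i z"
    and Vg_sym: "\<And>i j k z. fst z \<in> B \<Longrightarrow> V i (g j k) z = V j (g i k) z"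
    and nabla: "\<And>i j z. fst z \<in> B \<Longrightarrow> nabla_tensor f g i j z = V i (V j D) z"
    and jac: "\<And>i j z. fst z \<in> B \<Longrightarrow> jacobi_antisym f g i j z = dV_form (dH_fun f D) i j z"
  shows "\<exists>L. smooth_on (B \<times> UNIV) L \<and> (\<forall>i j z. fst z \<in> B \<longrightarrow> V i (V j L) z = g i j z) \<and>
    (\<forall>i z. fst z \<in> B \<longrightarrow> EL f L D i z = 0)"
proof -
  let ?W = "B \<times> (UNIV :: (real^'n) set)"
  have op: "open ?W" using B by (auto intro: open_Times)
  interpret W: sode_coords ?W f by unfold_locales (use op f in auto)
  interpret fib: star_fibres_vec B UNIV 0 by unfold_locales (use B in auto)
  interpret base: star_fibres_vec UNIV B c by unfold_locales (use B in auto)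
  have mem: "z \<in> ?W \<longleftrightarrow> fst z \<in> B" for z by (auto simp: mem_Times_iff)
  \<comment> \<open>Two integrations along the fibres: each row of \<open>g\<close> is closed by the
    symmetry of its vertical derivative, and the potentials of the rows form a closed form by the
    symmetry of \<open>g\<close> itself.\<close>
  have "\<exists>F. smooth_on ?W F \<and> (\<forall>j. \<forall>z\<in>?W. V j F z = g i j z)" for i
    by (rule fib.poincare_1form[OF g]) (metis mem Vg_sym g_sym W.V_cong)
  then obtain \<theta> where \<theta>: "\<And>i. smooth_on ?W (\<theta> i)" "\<And>i j z. z \<in> ?W \<Longrightarrow> V j (\<theta> i) z = g i j z"
    by metis
  have "V i (\<theta> j) z = V j (\<theta> i) z" if "z \<in> ?W" for i j z
    using \<theta>(2)[OF that] g_sym that mem by simp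
  from fib.poincare_1form[OF \<theta>(1) this]
  obtain F where F: "smooth_on ?W F" "\<And>i z. z \<in> ?W \<Longrightarrow> V i F z = \<theta> i z"
    by blast
  have HF: "V i (V j F) z = g i j z" if "z \<in> ?W" for i j z
    using W.V_cong[of "V j F" "\<theta> j" z i, OF F(2) that] \<theta>(2)[OF that, of i j] g_sym[of z i j] that mem by simp
  have nablaF: "nabla_tensor f (\<lambda>i j. V i (V j F)) i j z = V i (V j D) z" if "z \<in> ?W" for i j z
    using W.nabla_cong[of "\<lambda>i j. V i (V j F)" g, OF HF that] nabla that mem by metis
  define E where "E i = EL f F D i" for i
  have E: "smooth_on ?W (E i)" for i
    unfolding E_def by (intro W.smooths F D)
  \<comment> \<open>These are the slopes of \<open>E\<close> in the velocities, the \<open>r\<close>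
    of the overview; \<open>VR\<close> shows that they are constant on fibres.\<close>
  define R where "R i j = V i (E j)" for i j
  have R: "smooth_on ?W (R i j)" for i j
    unfolding R_def by (intro W.smooths E)
  have R_anti: "R i j z = - R j i z" if "z \<in> ?W" for i j z
    using W.V_EL_symmetric_part[OF F(1) D that, of i j] nablaF[OF that]
    by (simp add: R_def E_def)
  have VR: "V k (R i j) z = 0" if z: "z \<in> ?W" for i j k z
  proof -
    have sym: "V k (R i j) z = V i (R k j) z" for i j k
      unfolding R_def using W.V_commute[OF z E] .
    have anti: "V k (R i j) z = - V k (R j i) z" for i j k
      by (rule trans[OF W.V_cong[OF R_anti z] W.V_minus[OF R z]])
    \<comment> \<open>symmetry in the first and antisymmetry in the last two indices leave only zero\<close>
    show ?thesis
      using sym[of k i j] anti[of k i j] sym[of i j k] anti[of i j k] sym[of j k i] anti[of j k i]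
      by linarith
  qed
  \<comment> \<open>Subtracting the linear part leaves a function constant on fibres, by
    \<open>Ve\<close>.\<close>
  define e where "e j z = E j z - (\<Sum>k\<in>UNIV. snd z $ k * R k j z)" for j z
  have e: "smooth_on ?W (e j)" for j
    unfolding e_def by (intro W.smooths E R)
  have Ve: "V i (e j) z = 0" if z: "z \<in> ?W" for i j z
    unfolding e_def[abs_def] using z E R
    by (simp add: W.V_rules W.smooths W.V_v VR if_distrib[where f="\<lambda>x. x * _"] cong: if_cong)
       (simp add: R_def)
  have E_eq: "E j z = e j z + (\<Sum>k\<in>UNIV. snd z $ k * R k j z)" for j z
    by (simp add: e_def)
  have V_dq0: "V l (dq i h) z = 0"
    if "smooth_on ?W h" "\<And>k y. y \<in> ?W \<Longrightarrow> V k h y = 0" "z \<in> ?W" for l i z h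
    using W.dq_V_commute[OF that(3,1), of i l] W.dq_zero[OF that(2,3)] by simp
  have const: "h z = h (fst z, 0)"
    if "smooth_on ?W h" "\<And>k y. y \<in> ?W \<Longrightarrow> V k h y = 0" "fst z \<in> B" for h z
    using fibre_constant[OF that(1) _ that(3)] that(2) mem by blast
  have const_dq: "dq i h z = dq i h (fst z, 0)"
    if "smooth_on ?W h" "\<And>k y. y \<in> ?W \<Longrightarrow> V k h y = 0" "fst z \<in> B" for i h z
    by (rule const[OF W.dq_smooth[OF that(1)] V_dq0[OF that(1,2)] that(3)])
  \<comment> \<open>On the fibre over \<open>q\<close> the identity \<open>EL_curl\<close> is affine
    in \<open>v\<close>. Its constant term states that \<open>e\<close> is closed, its linear
    coefficients that \<open>R\<close> is closed.\<close>
  have curl: "dq i (e j) (q, 0) - dq j (e i) (q, 0)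
      + (\<Sum>k\<in>UNIV. v $ k * (dq i (R k j) (q, 0) - dq j (R k i) (q, 0) - dq k (R i j) (q, 0))) = 0"
    if q: "q \<in> B" for i j q v
  proof -
    let ?z = "(q, v)"
    have z: "?z \<in> ?W" using q by simp
    have dqE: "dq i (E j) ?z = dq i (e j) ?z + (\<Sum>k\<in>UNIV. v $ k * dq i (R k j) ?z)" for i j
      unfolding E_eq[abs_def] using z e R
      by (simp add: W.dq_rules W.smooths W.dq_v)
    have "jacobi_antisym f (\<lambda>i j. V i (V j F)) i j ?z = jacobi_antisym f g i j ?z"
      using HF[OF z] by (simp add: jacobi_antisym_def)
    then have "dq i (E j) ?z - dq j (E i) ?z - sode_derivation f (R i j) ?z = 0"
      using W.EL_curl[OF F(1) D z nablaF, of i j] jac[of ?z i j] q by (simp add: E_def R_def)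
    moreover have "sode_derivation f (R i j) ?z = (\<Sum>k\<in>UNIV. v $ k * dq k (R i j) ?z)"
      using VR[OF z] by (simp add: sode_derivation_def)
    moreover have "dq a (R b d) ?z = dq a (R b d) (q, 0)" "dq a (e b) ?z = dq a (e b) (q, 0)" for a b d
      using const_dq[of "R b d" ?z a, OF R VR] const_dq[of "e b" ?z a, OF e Ve] q by simp_all
    ultimately show ?thesis
      by (simp add: dqE right_diff_distrib sum_subtractf)
  qed
  have e_closed: "dq i (e j) (q, 0) = dq j (e i) (q, 0)" if "q \<in> B" for i j q
    using curl[OF that, of i j 0] by simp
  have R_closed: "dq i (R j k) (q, 0) + dq j (R k i) (q, 0) + dq k (R i j) (q, 0) = 0"
    if q: "q \<in> B" for i j k q
  proof -
    have z: "(q, 0) \<in> ?W" using q by simp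
    have anti: "dq a (R b d) (q, 0) = - dq a (R d b) (q, 0)" for a b d
    proof -
      have "dq a (R b d) (q, 0) = dq a (\<lambda>y. - R d b y) (q, 0)"
        by (rule W.dq_cong[OF _ z]) (rule R_anti)
      also have "\<dots> = - dq a (R d b) (q, 0)"
        unfolding dq_eq_dird
        by (rule dird_bounded_linear[OF z _ R]) (intro bounded_linear_minus bounded_linear_ident)
      finally show ?thesis .
    qed
    \<comment> \<open>The constant term vanishes by \<open>e_closed\<close>, and a basis vector as
      velocity isolates one linear coefficient.\<close>
    have "dq i (R k j) (q, 0) - dq j (R k i) (q, 0) - dq k (R i j) (q, 0) = 0"
      using curl[OF q, of i j "axis k 1"] e_closed[OF q, of i j]
      by (simp add: axis_def if_distrib[where f="\<lambda>x. x * _"] cong: if_cong)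
    then show ?thesis using anti[of i j k] by simp
  qed
  have "\<exists>\<beta>. smooth_on (UNIV \<times> B) \<beta> \<and> (\<forall>i. \<forall>z\<in>UNIV \<times> B. V i \<beta> z = e i (snd z, 0))"
    by (rule base.poincare_1form) (auto simp: base_to_fibre[OF B(1) e] e_closed)
  then obtain \<beta> where \<beta>: "smooth_on (UNIV \<times> B) \<beta>" "\<And>i z. z \<in> UNIV \<times> B \<Longrightarrow> V i \<beta> z = e i (snd z, 0)"
    by metis
  have "\<exists>\<alpha>. (\<forall>i. smooth_on (UNIV \<times> B) (\<alpha> i)) \<and>
    (\<forall>i j. \<forall>z\<in>UNIV \<times> B. V i (\<alpha> j) z - V j (\<alpha> i) z = R i j (snd z, 0))"
    by (rule base.poincare_2form)
      (auto simp: base_to_fibre[OF B(1) R] R_closed intro: R_anti)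
  then obtain \<alpha> where \<alpha>: "\<And>i. smooth_on (UNIV \<times> B) (\<alpha> i)"
    "\<And>i j z. z \<in> UNIV \<times> B \<Longrightarrow> V i (\<alpha> j) z - V j (\<alpha> i) z = R i j (snd z, 0)"
    by metis
  define a where "a j z = \<alpha> j (0, fst z)" for j and z :: "'n tcoords"
  define b where "b z = \<beta> (0, fst z)" for z :: "'n tcoords"
  have ab: "smooth_on ?W (a j)" "smooth_on ?W b" for j
    unfolding a_def[abs_def] b_def[abs_def] by (intro fibre_to_base B \<alpha> \<beta>)+
  have Vab: "V i (a j) z = 0" "V i b z = 0" if "z \<in> ?W" for i j z
    unfolding a_def[abs_def] b_def[abs_def]
    by (rule fibre_to_base(3)[OF B(1) \<alpha>(1) that], rule fibre_to_base(3)[OF B(1) \<beta>(1) that])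
  have dqab: "dq i (a j) z = V i (\<alpha> j) (0, fst z)" "dq i b z = V i \<beta> (0, fst z)" if "z \<in> ?W" for i j z
    unfolding a_def[abs_def] b_def[abs_def]
    by (rule fibre_to_base(2)[OF B(1) \<alpha>(1) that], rule fibre_to_base(2)[OF B(1) \<beta>(1) that])
  \<comment> \<open>The correction is affine in the velocities, so the Hessian of \<open>F\<close>
    is kept. The \<open>a\<close> term subtracts the velocity contracted with the exterior
    derivative of \<open>a\<close>, which is \<open>R\<close>, and the \<open>b\<close> term
    subtracts the differential of \<open>b\<close>, which is \<open>e\<close>.\<close>
  define L where "L z = F z - (\<Sum>k\<in>UNIV. snd z $ k * a k z) + b z" for z
  have L: "smooth_on ?W L"
    unfolding L_def[abs_def] by (intro W.smooths F ab)
  have VL: "V i L z = V i F z - a i z" if z: "z \<in> ?W" for i z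
    unfolding L_def[abs_def] using z F ab
    by (simp add: W.V_rules W.smooths W.V_v Vab if_distrib[where f="\<lambda>x. x * _"] cong: if_cong)
  have dqL: "dq i L z = dq i F z - (\<Sum>k\<in>UNIV. snd z $ k * dq i (a k) z) + dq i b z" if z: "z \<in> ?W" for i z
    unfolding L_def[abs_def] using z F ab by (simp add: W.dq_rules W.smooths W.dq_v)
  have "V i (V j L) z = g i j z" if z: "z \<in> ?W" for i j z
    using W.V_cong[of "V j L" "\<lambda>z. V j F z - a j z" z i, OF VL z] z F ab by (simp add: W.V_rules W.smooths Vab HF)
  moreover have "EL f L D i z = 0" if z: "z \<in> ?W" for i z
  proof -
    have zB: "(0, fst z) \<in> UNIV \<times> B" using z by auto
    have "sode_derivation f (V i L) z = sode_derivation f (V i F) z - (\<Sum>k\<in>UNIV. snd z $ k * dq k (a i) z)"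
      using W.sode_cong[of "V i L" "\<lambda>z. V i F z - a i z" z, OF VL z] z F ab by (simp add: W.sode_diff W.smooths sode_derivation_def[of _ "a i"] Vab)
    then have "EL f L D i z = E i z - (\<Sum>k\<in>UNIV. snd z $ k * (dq k (a i) z - dq i (a k) z)) - dq i b z"
      by (simp add: EL_def E_def dqL[OF z] right_diff_distrib sum_subtractf)
    also have "\<dots> = E i z - (\<Sum>k\<in>UNIV. snd z $ k * R k i (fst z, 0)) - e i (fst z, 0)"
      using \<alpha>(2)[OF zB] \<beta>(2)[OF zB] by (simp add: dqab[OF z])
    also have "\<dots> = E i z - (\<Sum>k\<in>UNIV. snd z $ k * R k i z) - e i z"
      using const[of "R _ _" z, OF R VR] const[of "e _" z, OF e Ve] z mem by simp
    finally show ?thesis by (simp add: e_def)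
  qed
  ultimately show ?thesis using L mem by blast
qed


section \<open>Smooth solutions of ordinary differential equations\<close>

text \<open>Partial derivatives are bounded on the compact ball, and its convexity allows the mean
  value inequality.\<close>

lemma smooth_lipschitz_on_cball:
  fixes F :: "'a::euclidean_space \<Rightarrow> 'b::real_normed_vector"
  assumes "smooth_on W F" "cball x0 r \<subseteq> W"
  obtains K where "K > 0" "\<And>x y. x \<in> cball x0 r \<Longrightarrow> y \<in> cball x0 r \<Longrightarrow> dist (F x) (F y) \<le> K * dist x y"
proof -
  have "continuous_on (cball x0 r) (\<lambda>x. \<Sum>b\<in>Basis. norm (dird F b x))"
    by (intro continuous_intros continuous_on_subset[OF smooth_on_continuous_on[OF smooth_on_dird[OF assms(1)]] assms(2)])
  then have "bounded ((\<lambda>x. \<Sum>b\<in>Basis. norm (dird F b x)) ` cball x0 r)"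
    by (intro compact_imp_bounded compact_continuous_image compact_cball)
  then obtain K where "K > 0" "\<forall>x\<in>cball x0 r. norm (\<Sum>b\<in>Basis. norm (dird F b x)) \<le> K"
    unfolding bounded_pos by blast
  then have K: "K > 0" "\<And>x. x \<in> cball x0 r \<Longrightarrow> (\<Sum>b\<in>Basis. norm (dird F b x)) \<le> K"
    by (auto simp: abs_le_iff)
  have "norm (F x - F y) \<le> K * norm (x - y)" if "x \<in> cball x0 r" "y \<in> cball x0 r" for x y
  proof (rule differentiable_bound[OF convex_cball _ _ that])
    fix z assume z: "z \<in> cball x0 r"
    then have zW: "z \<in> W" using assms by blast
    show "(F has_derivative (\<lambda>v. dird F v z)) (at z within cball x0 r)"
      by (rule has_derivative_at_withinI[OF smooth_on_has_derivative[OF assms(1) zW]])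
    show "onorm (\<lambda>v. dird F v z) \<le> K"
    proof (rule onorm_le)
      fix v
      have "norm (dird F v z) = norm (\<Sum>b\<in>Basis. (v \<bullet> b) *\<^sub>R dird F b z)"
        using dird_Basis[OF smooth_on_differentiable[OF assms(1) zW]] by metis
      also have "\<dots> \<le> (\<Sum>b\<in>Basis. norm v * norm (dird F b z))"
        by (intro sum_norm_le) (auto intro!: mult_right_mono Basis_le_norm)
      also have "\<dots> \<le> K * norm v"
        using mult_left_mono[OF K(2)[OF z] norm_ge_zero[of v]] by (simp add: sum_distrib_left mult.commute)
      finally show "norm (dird F v z) \<le> K * norm v" .
    qed
  qed
  with K(1) that show thesis by (simp add: dist_norm)
qed

text \<open>The Banach fixed point theorem is applied to the whole type of bounded continuous
  functions on the line. To have no side conditions, the right-hand side is made global in space and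
  the time is clamped.\<close>

lemma picard_lindelof:
  fixes F :: "'a::euclidean_space \<Rightarrow> 'a"
  assumes r: "r > 0" and K: "K > 0"
    and lip: "\<And>x y. x \<in> cball x0 r \<Longrightarrow> y \<in> cball x0 r \<Longrightarrow> dist (F x) (F y) \<le> K * dist x y"
  obtains h y where "h > 0" "y 0 = x0" "\<And>t. \<bar>t\<bar> < h \<Longrightarrow> y t \<in> cball x0 r"
    "\<And>t. \<bar>t\<bar> < h \<Longrightarrow> (y has_vector_derivative F (y t)) (at t)"
proof -
  \<comment> \<open>the projection onto the ball turns \<open>F\<close> into a globally bounded and Lipschitz map\<close>
  define G where "G x = F (closest_point (cball x0 r) x)" for x
  have cl: "closest_point (cball x0 r) x \<in> cball x0 r" for x
    by (rule closest_point_in_set) (use r in auto)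
  have G_lip: "dist (G x) (G y) \<le> K * dist x y" for x y
  proof -
    have "dist (G x) (G y) \<le> K * dist (closest_point (cball x0 r) x) (closest_point (cball x0 r) y)"
      unfolding G_def by (rule lip[OF cl cl])
    also have "\<dots> \<le> K * dist x y"
      using closest_point_lipschitz[of "cball x0 r" x y] r K by simp
    finally show ?thesis .
  qed
  have G_cont: "continuous_on UNIV G"
    by (rule lipschitz_on_continuous_on[of K]) (use G_lip K in \<open>auto simp: lipschitz_on_def\<close>)
  define M where "M = norm (F x0) + K * r"
  have G_bound: "norm (G x) \<le> M" for x
  proof -
    have "dist (F (closest_point (cball x0 r) x)) (F x0) \<le> K * dist (closest_point (cball x0 r) x) x0"
      by (rule lip[OF cl]) (use r in auto)
    also have "\<dots> \<le> K * r"
      using cl[of x] K by (simp add: dist_commute)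
    finally have "norm (G x - F x0) \<le> K * r" by (simp add: G_def dist_norm)
    then show ?thesis using norm_triangle_ineq2[of "G x" "F x0"] by (simp add: M_def)
  qed
  have M: "M > 0" using r K by (simp add: M_def add_nonneg_pos)
  \<comment> \<open>A difference of two integrals over lengths at most \<open>2 * h\<close> is
    estimated below: \<open>1 / (8 * K)\<close> gives the contraction factor 1/2, and
    \<open>r / (4 * M)\<close> keeps the iterates in the ball.\<close>
  define h where "h = min (1 / (8 * K)) (r / (4 * M))"
  have h: "h > 0" "4 * h * K \<le> 1/2" "4 * h * M \<le> r"
    using r K M by (auto simp: h_def min_def field_simps)
  define I where "I y t = integral {-h..t} (\<lambda>s. G (apply_bcontfun y s))" for y t
  \<comment> \<open>Clamping makes the iterates functions on the whole line; inside the interval it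
    is the identity.\<close>
  define c where "c t = max (-h) (min h t)" for t :: real
  have c: "-h \<le> c t" "c t \<le> h" for t using h by (auto simp: c_def)
  have Gy_cont: "continuous_on S (\<lambda>s. G (apply_bcontfun y s))" for S and y
    by (rule continuous_on_compose2[OF G_cont]) auto
  have int: "(\<lambda>s. G (apply_bcontfun y s)) integrable_on {-h..t}" for y t
    by (rule integrable_continuous_real[OF Gy_cont])
  have I_deriv: "(I y has_vector_derivative G (apply_bcontfun y t)) (at t within {-h..h})" if "t \<in> {-h..h}" for y t
    unfolding I_def by (rule integral_has_vector_derivative[OF Gy_cont that])
  have I_cont: "continuous_on {-h..h} (I y)" for y
    using has_vector_derivative_continuous[OF I_deriv] by (simp add: continuous_on_eq_continuous_within)
  have I_bound: "norm (I y t) \<le> 2 * h * M" if "-h \<le> t" "t \<le> h" for y t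
  proof -
    have "norm (I y t) \<le> M * (t - (-h))"
      unfolding I_def by (rule integral_bound[OF that(1) Gy_cont]) (rule G_bound)
    also have "\<dots> \<le> M * (2 * h)" using that M by (intro mult_left_mono) auto
    finally show ?thesis by (simp add: mult_ac)
  qed
  have I_diff: "norm (I y t - I w t) \<le> 2 * h * K * dist y w" if "-h \<le> t" "t \<le> h" for y w t
  proof -
    have "I y t - I w t = integral {-h..t} (\<lambda>s. G (apply_bcontfun y s) - G (apply_bcontfun w s))"
      unfolding I_def by (rule integral_diff[symmetric]) (rule int)+
    also have "norm \<dots> \<le> (K * dist y w) * (t - (-h))"
    proof (rule integral_bound[OF that(1)])
      show "continuous_on {-h..t} (\<lambda>s. G (apply_bcontfun y s) - G (apply_bcontfun w s))"
        by (intro continuous_intros Gy_cont)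
      show "norm (G (apply_bcontfun y s) - G (apply_bcontfun w s)) \<le> K * dist y w" for s
        using order_trans[OF G_lip[of "apply_bcontfun y s" "apply_bcontfun w s"]
            mult_left_mono[OF dist_bounded[of y s w], of K]] K
        by (simp add: dist_norm[of "G _"])
    qed
    also have "\<dots> \<le> (K * dist y w) * (2 * h)" using that K by (intro mult_left_mono) auto
    finally show ?thesis by (simp add: mult_ac)
  qed
  \<comment> \<open>The integrals start at \<open>-h\<close>, so that one formula serves both signs
    of time; subtracting the value at 0 restores the initial condition.\<close>
  define T where "T y t = x0 + (I y (c t) - I y (c 0))" for y t
  have T_bound: "norm (T y t - x0) \<le> r" for y t
    using norm_triangle_ineq4[of "I y (c t)" "I y (c 0)"] I_bound[OF c, of y t] I_bound[OF c, of y 0] h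
    by (simp add: T_def)
  have "T y \<in> bcontfun" for y
  proof -
    have "continuous_on UNIV c" unfolding c_def[abs_def] by (intro continuous_intros)
    then have "continuous_on UNIV (\<lambda>t. I y (c t))"
      by (rule continuous_on_compose2[OF I_cont]) (use c in auto)
    then have "continuous_on UNIV (T y)"
      unfolding T_def[abs_def] by (intro continuous_intros)
    moreover have "bounded (range (T y))"
      by (rule bounded_subset[OF bounded_cball[of x0 r]])
        (use T_bound in \<open>auto simp: dist_norm norm_minus_commute\<close>)
    ultimately show ?thesis by (simp add: bcontfun_def)
  qed
  then have app: "apply_bcontfun (Bcontfun (T y)) = T y" for y
    by (simp add: Bcontfun_inverse)
  have "\<exists>!y. Bcontfun (T y) = y"
  proof (rule banach_fix_type)
    show "\<forall>y w. dist (Bcontfun (T y)) (Bcontfun (T w)) \<le> 1/2 * dist y w"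
    proof (intro allI dist_bound)
      fix y w t
      have "T y t - T w t = (I y (c t) - I w (c t)) - (I y (c 0) - I w (c 0))"
        by (simp add: T_def)
      then have "norm (T y t - T w t) \<le> norm (I y (c t) - I w (c t)) + norm (I y (c 0) - I w (c 0))"
        by (metis norm_triangle_ineq4)
      also have "\<dots> \<le> (4 * h * K) * dist y w"
        using I_diff[OF c, of y t w] I_diff[OF c, of y 0 w] by simp
      also have "\<dots> \<le> 1/2 * dist y w"
        using h by (intro mult_right_mono) auto
      finally show "dist (apply_bcontfun (Bcontfun (T y)) t) (apply_bcontfun (Bcontfun (T w)) t) \<le> 1/2 * dist y w"
        by (simp add: app dist_norm)
    qed
  qed auto
  then obtain y where y: "apply_bcontfun y = T y" using app by metis
  show thesis
  proof
    show "h > 0" by (rule h)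
    show "T y 0 = x0" by (simp add: T_def)
    show in_ball: "T y t \<in> cball x0 r" for t
      using T_bound[of y t] by (simp add: dist_norm norm_minus_commute)
    fix t :: real assume t: "\<bar>t\<bar> < h"
    have "(I y has_vector_derivative G (T y t)) (at t)"
      using I_deriv[of t y] t at_within_interior[of t "{-h..h}"] y by (simp add: abs_less_iff)
    then have "((\<lambda>t. x0 + (I y t - I y (c 0))) has_vector_derivative G (T y t)) (at t)"
      by (auto intro!: derivative_eq_intros)
    then have "(T y has_vector_derivative G (T y t)) (at t)"
      by (rule has_vector_derivative_transform_within_open[where S="{-h<..<h}"])
        (use t in \<open>auto simp: T_def c_def min_def max_def\<close>)
    moreover have "G (T y t) = F (T y t)"
      using in_ball by (simp add: G_def closest_point_self)
    ultimately show "(T y has_vector_derivative F (T y t)) (at t)" by simp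
  qed
qed

text \<open>Smoothness is bootstrapped: if \<open>y\<close> is of order \<open>k\<close>, so is its
  derivative \<open>F (y t)\<close>, and \<open>y\<close> is of order \<open>k + 1\<close>.\<close>

lemma smooth_ode_solution:
  fixes F :: "'a::euclidean_space \<Rightarrow> 'a"
  assumes W: "open W" "smooth_on W F" "x0 \<in> W"
  obtains h y where "h > 0" "y 0 = x0" "\<And>t. \<bar>t\<bar> < h \<Longrightarrow> y t \<in> W"
    "\<And>t. \<bar>t\<bar> < h \<Longrightarrow> (y has_vector_derivative F (y t)) (at t)" "smooth_on {-h<..<h} y"
proof -
  obtain r where r: "r > 0" "cball x0 r \<subseteq> W"
    using W open_contains_cball by blast
  obtain K where "K > 0" "\<And>x y. x \<in> cball x0 r \<Longrightarrow> y \<in> cball x0 r \<Longrightarrow> dist (F x) (F y) \<le> K * dist x y"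
    using smooth_lipschitz_on_cball[OF W(2) r(2)] by blast
  from picard_lindelof[OF r(1) this]
  obtain h y where y: "h > 0" "y 0 = x0" "\<And>t. \<bar>t\<bar> < h \<Longrightarrow> y t \<in> cball x0 r"
    "\<And>t. \<bar>t\<bar> < h \<Longrightarrow> (y has_vector_derivative F (y t)) (at t)" by metis
  have yW: "y t \<in> W" if "\<bar>t\<bar> < h" for t using y(3)[OF that] r by blast
  have "Ck_on k {-h<..<h} y" for k
  proof (induction k)
    case 0
    have "continuous_on {-h<..<h} y"
      by (intro continuous_at_imp_continuous_on ballI has_vector_derivative_continuous[OF y(4)]) auto
    then show ?case by simp
  next
    case (Suc k)
    have FY: "Ck_on k {-h<..<h} (\<lambda>t. F (y t))"
      by (rule Ck_on_compose[OF _ W(1) _ Suc]) (use W yW in \<open>auto simp: smooth_on_def\<close>)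
    show ?case
    proof (rule Ck_on_SucI)
      show "(y has_derivative (\<lambda>v. v *\<^sub>R F (y t))) (at t)" if "t \<in> {-h<..<h}" for t
        using y(4)[of t] that by (simp add: has_vector_derivative_def abs_less_iff)
    qed (auto intro!: Ck_on_bounded_linear_comp[OF bounded_linear_scaleR_right] FY)
  qed
  then have "smooth_on {-h<..<h} y" by (simp add: smooth_on_def)
  with y yW that show thesis by blast
qed


section \<open>Prolonged coordinate changes\<close>

text \<open>This is the tangent map of \<open>h\<close>. For a change of charts on the base it is
  the change of the induced charts on the tangent bundle.\<close>

definition prolong :: "(real^'n \<Rightarrow> real^'n) \<Rightarrow> 'n::finite tcoords \<Rightarrow> 'n tcoords" where
  "prolong h z = (h (fst z), dird h (snd z) (fst z))"

locale coordinate_transition =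
  fixes X Y :: "(real^'n::finite) set" and h :: "real^'n \<Rightarrow> real^'n"
  assumes open_X: "open X" and open_Y: "open Y" and h: "smooth_on X h" and hX: "\<And>x. x \<in> X \<Longrightarrow> h x \<in> Y"
begin

lemma opens: "open (X \<times> (UNIV :: (real^'n) set))" "open (Y \<times> (UNIV :: (real^'n) set))"
  using open_X open_Y by (auto intro: open_Times)

sublocale X: sode_coords "X \<times> UNIV" "\<lambda>z. 0" by unfold_locales (use opens in \<open>auto intro: smooth_on_const\<close>)
sublocale Y: sode_coords "Y \<times> UNIV" "\<lambda>z. 0" by unfold_locales (use opens in \<open>auto intro: smooth_on_const\<close>)

lemma prolong_mem: "z \<in> X \<times> UNIV \<Longrightarrow> prolong h z \<in> Y \<times> UNIV"
  using hX by (auto simp: prolong_def)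

lemma base_smooth: "smooth_on X k \<Longrightarrow> smooth_on (X \<times> (UNIV :: (real^'n) set)) (\<lambda>z. k (fst z))"
  by (rule smooth_on_compose[OF opens(1) open_X _ smooth_on_fst[OF opens(1) smooth_on_ident[OF opens(1)]]]) auto

text \<open>Fixed directions replace the varying direction \<open>snd z\<close>, so that the rules
  for smoothness and for derivatives apply.\<close>

lemma prolong_eq: "z \<in> X \<times> UNIV \<Longrightarrow>
    prolong h z = (h (fst z), \<Sum>j\<in>UNIV. snd z $ j *\<^sub>R dird h (axis j 1) (fst z))"
  unfolding prolong_def using dird_vec[OF smooth_on_differentiable[OF h]] by auto

lemma prolong_smooth: "smooth_on (X \<times> UNIV) (prolong h)"
proof (rule smooth_on_cong[OF opens(1) prolong_eq[symmetric]])
  show "smooth_on (X \<times> UNIV) (\<lambda>z. (h (fst z), \<Sum>j\<in>UNIV. snd z $ j *\<^sub>R dird h (axis j 1) (fst z)))"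
    by (intro smooth_on_Pair smooth_on_sum smooth_on_scaleR X.v_smooth base_smooth smooth_on_dird h opens)
qed

lemma prolong_has_derivative:
  assumes z: "z \<in> X \<times> UNIV"
  shows "(prolong h has_derivative
    (\<lambda>w. (dird h (fst w) (fst z), dird (dird h (fst w)) (snd z) (fst z) + dird h (snd w) (fst z)))) (at z)"
proof -
  have x: "fst z \<in> X" using z by auto
  have base: "((\<lambda>z. k (fst z)) has_derivative (\<lambda>w. dird k (fst w) (fst z))) (at z)"
    if "smooth_on X k" for k :: "real^'n \<Rightarrow> real^'n"
    using has_derivative_compose[OF has_derivative_fst[OF has_derivative_ident] smooth_on_has_derivative[OF that x]] .
  have nth: "((\<lambda>z. snd z $ j) has_derivative (\<lambda>w. snd w $ j)) (at z)" for j
    by (intro bounded_linear_imp_has_derivative bounded_linear_compose[OF bounded_linear_vec_nth bounded_linear_snd])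
  have "((\<lambda>z. (h (fst z), \<Sum>j\<in>UNIV. snd z $ j *\<^sub>R dird h (axis j 1) (fst z))) has_derivative
      (\<lambda>w. (dird h (fst w) (fst z), \<Sum>j\<in>UNIV. snd z $ j *\<^sub>R dird (dird h (axis j 1)) (fst w) (fst z)
        + snd w $ j *\<^sub>R dird h (axis j 1) (fst z)))) (at z)"
    by (intro has_derivative_Pair has_derivative_sum has_derivative_scaleR nth base h smooth_on_dird)
  moreover have "(\<Sum>j\<in>UNIV. snd z $ j *\<^sub>R dird (dird h (axis j 1)) a (fst z) + b $ j *\<^sub>R dird h (axis j 1) (fst z))
      = dird (dird h a) (snd z) (fst z) + dird h b (fst z)" for a b
  proof -
    \<comment> \<open>Symmetry of second derivatives turns this into the derivative of a Jacobian
      column along the velocity, the form that cancels in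
      \<open>EL_curve_transition\<close>.\<close>
    have "dird (dird h (axis j 1)) a (fst z) = dird (dird h a) (axis j 1) (fst z)" for j
      by (rule dird_commute[OF open_X h x])
    then show ?thesis
      using dird_vec[OF smooth_on_differentiable[OF smooth_on_dird[OF h] x], of a "snd z"]
        dird_vec[OF smooth_on_differentiable[OF h x], of b]
      by (simp add: sum.distrib)
  qed
  ultimately have "((\<lambda>z. (h (fst z), \<Sum>j\<in>UNIV. snd z $ j *\<^sub>R dird h (axis j 1) (fst z))) has_derivative
      (\<lambda>w. (dird h (fst w) (fst z), dird (dird h (fst w)) (snd z) (fst z) + dird h (snd w) (fst z)))) (at z)"
    by simp
  then show ?thesis
    by (rule has_derivative_transform_within_open[OF _ opens(1) z]) (simp add: prolong_eq)
qed

lemma comp_prolong_smooth: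
  fixes G :: "'n tcoords \<Rightarrow> real"
  shows "smooth_on (Y \<times> UNIV) G \<Longrightarrow> smooth_on (X \<times> UNIV) (\<lambda>z. G (prolong h z))"
  using smooth_on_compose[OF opens prolong_mem prolong_smooth] by blast

context
  fixes G :: "'n tcoords \<Rightarrow> real" and z :: "'n tcoords"
  assumes G: "smooth_on (Y \<times> UNIV) G" and z: "z \<in> X \<times> UNIV"
begin

lemma dird_comp_prolong:
  "dird (\<lambda>z. G (prolong h z)) w z = (\<Sum>a\<in>UNIV. dird h (fst w) (fst z) $ a * dq a G (prolong h z))
    + (\<Sum>a\<in>UNIV. (dird (dird h (fst w)) (snd z) (fst z) + dird h (snd w) (fst z)) $ a * V a G (prolong h z))"
  using dird_eqI[OF has_derivative_compose[OF prolong_has_derivative[OF z]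
        smooth_on_has_derivative[OF G prolong_mem[OF z]]], of w]
    dird_tcoords[OF smooth_on_differentiable[OF G prolong_mem[OF z]]] by simp

text \<open>A vertical vector has no base component, so the second derivatives of \<open>h\<close>
  disappear and \<open>V\<close> transforms by the Jacobian alone.\<close>

lemma V_comp_prolong:
  "V i (\<lambda>z. G (prolong h z)) z = (\<Sum>a\<in>UNIV. dird h (axis i 1) (fst z) $ a * V a G (prolong h z))"
proof -
  have x: "fst z \<in> X" using z by auto
  have h0: "dird h 0 y = 0" if "y \<in> X" for y
    using linear_0[OF dird_linear[OF smooth_on_differentiable[OF h that]]] .
  have "dird (dird h 0) (snd z) (fst z) = dird (\<lambda>_. 0) (snd z) (fst z)"
    by (rule dird_cong[OF open_X x h0])
  then show ?thesis
    unfolding V_eq_dird[of i] dird_comp_prolong by (simp add: h0[OF x] dird_const[OF x])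
qed

lemma dq_comp_prolong:
  "dq i (\<lambda>z. G (prolong h z)) z = (\<Sum>a\<in>UNIV. dird h (axis i 1) (fst z) $ a * dq a G (prolong h z))
    + (\<Sum>a\<in>UNIV. dird (dird h (axis i 1)) (snd z) (fst z) $ a * V a G (prolong h z))"
  using linear_0[OF dird_linear[OF smooth_on_differentiable[OF h], of "fst z"]] z
  unfolding dq_eq_dird[of i] dird_comp_prolong by auto

end

text \<open>The Jacobian depends on the base point only, so a second vertical derivative passes
  through it; this is why fibre Hessians are tensors.\<close>

lemma hessian_comp_prolong:
  fixes G :: "'n tcoords \<Rightarrow> real"
  assumes G: "smooth_on (Y \<times> UNIV) G" and z: "z \<in> X \<times> UNIV"
  shows "V i (V j (\<lambda>z. G (prolong h z))) z = (\<Sum>a\<in>UNIV. \<Sum>b\<in>UNIV.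
    dird h (axis i 1) (fst z) $ a * dird h (axis j 1) (fst z) $ b * V a (V b G) (prolong h z))"
proof -
  have Vb: "V i (\<lambda>z. dird h (axis j 1) (fst z) $ b) z = 0" for b
  proof -
    have x: "fst z \<in> X" using z by auto
    have "((\<lambda>z::'n tcoords. dird h (axis j 1) (fst z) $ b) has_derivative
        (\<lambda>w. dird (dird h (axis j 1)) (fst w) (fst z) $ b)) (at z)"
      by (intro bounded_linear.has_derivative[OF bounded_linear_vec_nth]
          has_derivative_compose[OF has_derivative_fst[OF has_derivative_ident] smooth_on_has_derivative[OF _ x]]
          smooth_on_dird h)
    from dird_eqI[OF this] show ?thesis
      using linear_0[OF dird_linear[OF smooth_on_differentiable[OF smooth_on_dird[OF h] x]]]
      by (simp add: V_eq_dird)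
  qed
  have "V i (V j (\<lambda>z. G (prolong h z))) z
      = V i (\<lambda>z. \<Sum>b\<in>UNIV. dird h (axis j 1) (fst z) $ b * V b G (prolong h z)) z"
    by (rule X.V_cong[OF V_comp_prolong[OF G] z])
  also have "\<dots> = (\<Sum>b\<in>UNIV. dird h (axis j 1) (fst z) $ b *
      (\<Sum>a\<in>UNIV. dird h (axis i 1) (fst z) $ a * V a (V b G) (prolong h z)))"
    using z by (simp add: X.V_rules X.smooths smooth_on_nth opens base_smooth smooth_on_dird h
        comp_prolong_smooth Y.V_smooth G Vb V_comp_prolong)
  also have "\<dots> = (\<Sum>a\<in>UNIV. \<Sum>b\<in>UNIV.
    dird h (axis i 1) (fst z) $ a * dird h (axis j 1) (fst z) $ b * V a (V b G) (prolong h z))"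
    unfolding sum_distrib_left by (subst sum.swap) (simp add: mult_ac)
  finally show ?thesis .
qed

text \<open>The time derivative also hits the Jacobian, giving second derivatives of
  \<open>h\<close> along the velocity. The same terms occur in \<open>dq_comp_prolong\<close> and
  cancel because the base part of \<open>y\<close> moves with velocity
  \<open>snd (y t)\<close>.\<close>

lemma EL_curve_transition:
  fixes L :: "'n tcoords \<Rightarrow> real"
  assumes L: "smooth_on (Y \<times> UNIV) L" and t: "y t \<in> X \<times> UNIV"
    and y: "(y has_vector_derivative (snd (y t), a)) (at t)"
  shows "deriv (\<lambda>s. V i (\<lambda>z. L (prolong h z)) (y s)) t - dq i (\<lambda>z. L (prolong h z)) (y t)
    = (\<Sum>k\<in>UNIV. dird h (axis i 1) (fst (y t)) $ k *
        (deriv (\<lambda>s. V k L (prolong h (y s))) t - dq k L (prolong h (y t))))"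
proof -
  let ?x = "fst (y t)" and ?u = "snd (y t)"
  have x: "?x \<in> X" using t by auto
  have comp: "((\<lambda>s. k (y s)) has_field_derivative dird k (?u, a) (y t)) (at t)"
    if "smooth_on (X \<times> UNIV) k" for k :: "'n tcoords \<Rightarrow> real"
  proof -
    note D = smooth_on_has_derivative[OF that t]
    have "((\<lambda>s. k (y s)) has_derivative (\<lambda>d. dird k (d *\<^sub>R (?u, a)) (y t))) (at t)"
      using has_derivative_compose[OF y[unfolded has_vector_derivative_def] D] .
    then show ?thesis
      using linear_scale[OF has_derivative_linear[OF D], of _ "(?u, a)"]
      by (simp add: has_field_derivative_def mult_commute_abs)
  qed
  have J: "((\<lambda>s. dird h (axis i 1) (fst (y s)) $ k) has_field_derivative
      dird (dird h (axis i 1)) ?u ?x $ k) (at t)" for k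
  proof -
    have "((\<lambda>z::'n tcoords. dird h (axis i 1) (fst z) $ k) has_derivative
        (\<lambda>w. dird (dird h (axis i 1)) (fst w) ?x $ k)) (at (y t))"
      by (intro bounded_linear.has_derivative[OF bounded_linear_vec_nth]
          has_derivative_compose[OF has_derivative_fst[OF has_derivative_ident] smooth_on_has_derivative[OF _ x]]
          smooth_on_dird h)
    from dird_eqI[OF this, of "(?u, a)"]
    have "dird (\<lambda>z::'n tcoords. dird h (axis i 1) (fst z) $ k) (?u, a) (y t) = dird (dird h (axis i 1)) ?u ?x $ k"
      by simp
    then show ?thesis
      using comp[of "\<lambda>z. dird h (axis i 1) (fst z) $ k"]
      by (simp add: smooth_on_nth opens base_smooth smooth_on_dird h)
  qed
  have VL: "((\<lambda>s. V k L (prolong h (y s))) has_field_derivative deriv (\<lambda>s. V k L (prolong h (y s))) t) (at t)" for k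
    using comp[OF comp_prolong_smooth[OF Y.V_smooth[OF L]]] DERIV_deriv_iff_has_field_derivative by metis
  have D: "((\<lambda>s. \<Sum>k\<in>UNIV. dird h (axis i 1) (fst (y s)) $ k * V k L (prolong h (y s))) has_field_derivative
      (\<Sum>k\<in>UNIV. dird (dird h (axis i 1)) ?u ?x $ k * V k L (prolong h (y t))
        + deriv (\<lambda>s. V k L (prolong h (y s))) t * dird h (axis i 1) ?x $ k)) (at t)"
    by (intro DERIV_sum DERIV_mult J VL)
  have "((\<lambda>s. V i (\<lambda>z. L (prolong h z)) (y s)) has_field_derivative
      (\<Sum>k\<in>UNIV. dird (dird h (axis i 1)) ?u ?x $ k * V k L (prolong h (y t))
        + deriv (\<lambda>s. V k L (prolong h (y s))) t * dird h (axis i 1) ?x $ k)) (at t)"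
  proof -
    have "isCont y t" using y by (rule has_vector_derivative_continuous)
    then have "\<forall>\<^sub>F s in nhds t. y s \<in> X \<times> UNIV"
      using opens(1) t by (auto simp: isCont_def tendsto_def eventually_at_filter elim!: allE[of _ "X \<times> UNIV"] eventually_mono)
    then have "\<forall>\<^sub>F s in nhds t. (\<Sum>k\<in>UNIV. dird h (axis i 1) (fst (y s)) $ k * V k L (prolong h (y s)))
        = V i (\<lambda>z. L (prolong h z)) (y s)"
      by eventually_elim (simp add: V_comp_prolong[OF L])
    from DERIV_cong_ev[OF refl this refl] D show ?thesis by blast
  qed
  from DERIV_imp_deriv[OF this] show ?thesis
    by (simp add: dq_comp_prolong[OF L t] sum.distrib right_diff_distrib sum_subtractf mult.commute)
qed

end


section \<open>Charts of the tangent bundle\<close>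

text \<open>The tangent vector with coordinates \<open>v\<close> in the chart \<phi>; the value 0
  elsewhere follows the convention of \<open>tangent_space\<close>.\<close>

definition tangent_vector ::
  "('p, 'e::euclidean_space) chart set \<Rightarrow> ('p, 'e) chart \<Rightarrow> 'p \<Rightarrow> 'e \<Rightarrow> ('p, 'e) tvec" where
  "tangent_vector A \<phi> p v =
     (\<lambda>\<psi>. if \<psi> \<in> A \<and> p \<in> chart_dom \<psi> then dird (coord_change \<phi> \<psi>) v (chart_map \<phi> p) else 0)"

locale atlas =
  fixes A :: "('q::topological_space, real^'n::finite) chart set"
  assumes atlas: "smooth_atlas A"
begin

lemma open_chart_dom: "\<phi> \<in> A \<Longrightarrow> open (chart_dom \<phi>)"
  and open_chart_range: "\<phi> \<in> A \<Longrightarrow> open (chart_map \<phi> ` chart_dom \<phi>)"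
  and chart_homeomorphism:
    "\<phi> \<in> A \<Longrightarrow> homeomorphism (chart_dom \<phi>) (chart_map \<phi> ` chart_dom \<phi>) (chart_map \<phi>) (chart_inv \<phi>)"
  and ex_chart: "\<exists>\<phi>\<in>A. p \<in> chart_dom \<phi>"
  using atlas unfolding smooth_atlas_def by auto

lemma chart_inv_map: "\<phi> \<in> A \<Longrightarrow> p \<in> chart_dom \<phi> \<Longrightarrow> chart_inv \<phi> (chart_map \<phi> p) = p"
  using homeomorphism_apply1[OF chart_homeomorphism] .

lemma chart_map_continuous: "\<phi> \<in> A \<Longrightarrow> continuous_on (chart_dom \<phi>) (chart_map \<phi>)"
  using homeomorphism_cont1[OF chart_homeomorphism] .

lemma mem_chart_image:
  "\<phi> \<in> A \<Longrightarrow> x \<in> chart_image \<phi> S \<longleftrightarrow> x \<in> chart_map \<phi> ` chart_dom \<phi> \<and> chart_inv \<phi> x \<in> S"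
  by (auto simp: chart_image_def chart_inv_map)

lemma chart_map_mem: "p \<in> chart_dom \<phi> \<Longrightarrow> p \<in> S \<Longrightarrow> chart_map \<phi> p \<in> chart_image \<phi> S"
  by (auto simp: chart_image_def)

lemma chart_imageD:
  assumes "\<phi> \<in> A" "x \<in> chart_image \<phi> S"
  shows "chart_inv \<phi> x \<in> chart_dom \<phi>" "chart_inv \<phi> x \<in> S" "chart_map \<phi> (chart_inv \<phi> x) = x"
  using assms by (auto simp: chart_image_def chart_inv_map)

lemma chart_image_mono: "S \<subseteq> T \<Longrightarrow> chart_image \<phi> S \<subseteq> chart_image \<phi> T"
  by (auto simp: chart_image_def)

lemma open_chart_image:
  assumes "\<phi> \<in> A" "open S"
  shows "open (chart_image \<phi> S)"
proof -
  have "chart_image \<phi> S = chart_map \<phi> ` chart_dom \<phi> \<inter> chart_inv \<phi> -` S"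
    using mem_chart_image[OF assms(1)] by auto
  then show ?thesis
    using continuous_on_open_vimage[OF open_chart_range[OF assms(1)]]
      homeomorphism_cont2[OF chart_homeomorphism[OF assms(1)]] assms(2) by (metis Int_commute)
qed

lemma coord_change_smooth:
  "\<phi> \<in> A \<Longrightarrow> \<psi> \<in> A \<Longrightarrow> smooth_on (chart_image \<phi> (chart_dom \<psi>)) (coord_change \<phi> \<psi>)"
  using atlas unfolding smooth_atlas_def by blast

lemma coord_change_map:
  "\<phi> \<in> A \<Longrightarrow> p \<in> chart_dom \<phi> \<Longrightarrow> coord_change \<phi> \<psi> (chart_map \<phi> p) = chart_map \<psi> p"
  by (simp add: coord_change_def chart_inv_map)

lemma coord_change_differentiable:
  assumes "\<phi> \<in> A" "\<psi> \<in> A" "p \<in> chart_dom \<phi>" "p \<in> chart_dom \<psi>"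
  shows "coord_change \<phi> \<psi> differentiable (at (chart_map \<phi> p))"
  by (rule smooth_on_differentiable[OF coord_change_smooth]) (use assms chart_map_mem in auto)

lemma transition:
  assumes "\<phi> \<in> A" "\<psi> \<in> A" "open U"
  shows "coordinate_transition (chart_image \<phi> (U \<inter> chart_dom \<psi>)) (chart_image \<psi> (U \<inter> chart_dom \<phi>))
    (coord_change \<phi> \<psi>)"
proof
  show "open (chart_image \<phi> (U \<inter> chart_dom \<psi>))" "open (chart_image \<psi> (U \<inter> chart_dom \<phi>))"
    using assms by (auto intro!: open_chart_image open_chart_dom)
  show "smooth_on (chart_image \<phi> (U \<inter> chart_dom \<psi>)) (coord_change \<phi> \<psi>)"
    by (rule smooth_on_subset[OF coord_change_smooth]) (use assms in \<open>auto simp: chart_image_def\<close>)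
  show "coord_change \<phi> \<psi> x \<in> chart_image \<psi> (U \<inter> chart_dom \<phi>)" if "x \<in> chart_image \<phi> (U \<inter> chart_dom \<psi>)" for x
    using chart_imageD[OF assms(1) that] by (auto simp: coord_change_def intro: chart_map_mem)
qed

lemma coord_change_cocycle:
  assumes "\<phi> \<in> A" "\<psi> \<in> A" "\<theta> \<in> A" "p \<in> chart_dom \<phi>" "p \<in> chart_dom \<psi>" "p \<in> chart_dom \<theta>"
  shows "dird (coord_change \<phi> \<theta>) v (chart_map \<phi> p)
    = dird (coord_change \<psi> \<theta>) (dird (coord_change \<phi> \<psi>) v (chart_map \<phi> p)) (chart_map \<psi> p)"
proof -
  have op: "open (chart_image \<phi> (chart_dom \<psi> \<inter> chart_dom \<theta>))"
    using assms by (auto intro!: open_chart_image open_chart_dom)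
  have D: "((\<lambda>x. coord_change \<psi> \<theta> (coord_change \<phi> \<psi> x)) has_derivative
     (\<lambda>v. dird (coord_change \<psi> \<theta>) (dird (coord_change \<phi> \<psi>) v (chart_map \<phi> p)) (chart_map \<psi> p))) (at (chart_map \<phi> p))"
    using has_derivative_compose[OF has_derivative_dird[OF coord_change_differentiable[OF assms(1,2,4,5)]], of "coord_change \<psi> \<theta>"]
      has_derivative_dird[OF coord_change_differentiable[OF assms(2,3,5,6)]]
    by (simp add: coord_change_map assms)
  have "(coord_change \<phi> \<theta> has_derivative
     (\<lambda>v. dird (coord_change \<psi> \<theta>) (dird (coord_change \<phi> \<psi>) v (chart_map \<phi> p)) (chart_map \<psi> p))) (at (chart_map \<phi> p))"
    by (rule has_derivative_transform_within_open[OF D op chart_map_mem])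
      (use assms in \<open>auto simp: coord_change_def chart_image_def chart_inv_map\<close>)
  then show ?thesis by (rule dird_eqI)
qed

lemma coord_change_self:
  assumes "\<phi> \<in> A" "p \<in> chart_dom \<phi>"
  shows "dird (coord_change \<phi> \<phi>) v (chart_map \<phi> p) = v"
proof -
  have "(coord_change \<phi> \<phi> has_derivative (\<lambda>v. v)) (at (chart_map \<phi> p))"
    by (rule has_derivative_transform_within_open[OF has_derivative_ident open_chart_range[OF assms(1)]])
      (use assms in \<open>auto simp: coord_change_map\<close>)
  then show ?thesis by (rule dird_eqI)
qed

lemma tangent_vector_mem:
  assumes "\<phi> \<in> A" "p \<in> chart_dom \<phi>"
  shows "tangent_vector A \<phi> p v \<in> tangent_space A p"
  unfolding tangent_space_def
proof (intro CollectI conjI ballI allI impI)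
  fix \<psi> \<theta> assume "\<psi> \<in> A" "\<theta> \<in> A" "p \<in> chart_dom \<psi>" "p \<in> chart_dom \<theta>"
  then show "tangent_vector A \<phi> p v \<theta>
      = frechet_derivative (coord_change \<psi> \<theta>) (at (chart_map \<psi> p)) (tangent_vector A \<phi> p v \<psi>)"
    using coord_change_cocycle[OF assms(1) \<open>\<psi> \<in> A\<close> \<open>\<theta> \<in> A\<close> assms(2), of v]
    by (simp add: tangent_vector_def dird_def)
qed (simp only: tangent_vector_def if_False)

lemma tangent_vector_at: "\<phi> \<in> A \<Longrightarrow> p \<in> chart_dom \<phi> \<Longrightarrow> tangent_vector A \<phi> p v \<phi> = v"
  by (simp add: tangent_vector_def coord_change_self)

lemma tangent_space_coords:
  assumes "\<xi> \<in> tangent_space A p" "\<phi> \<in> A" "p \<in> chart_dom \<phi>"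
  shows "\<xi> = tangent_vector A \<phi> p (\<xi> \<phi>)"
proof
  fix \<psi>
  show "\<xi> \<psi> = tangent_vector A \<phi> p (\<xi> \<phi>) \<psi>"
  proof (cases "\<psi> \<in> A \<and> p \<in> chart_dom \<psi>")
    case True
    then have "\<xi> \<psi> = frechet_derivative (coord_change \<phi> \<psi>) (at (chart_map \<phi> p)) (\<xi> \<phi>)"
      using assms unfolding tangent_space_def by blast
    then show ?thesis using True by (simp only: tangent_vector_def dird_def if_True simp_thms)
  next
    case False
    then have "\<xi> \<psi> = 0" using assms(1) unfolding tangent_space_def by blast
    then show ?thesis using False by (simp only: tangent_vector_def if_False)
  qed
qed

lemma tangent_vector_change:
  assumes "\<phi> \<in> A" "\<psi> \<in> A" "p \<in> chart_dom \<phi>" "p \<in> chart_dom \<psi>"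
  shows "tangent_vector A \<phi> p v = tangent_vector A \<psi> p (dird (coord_change \<phi> \<psi>) v (chart_map \<phi> p))"
proof
  fix \<theta>
  show "tangent_vector A \<phi> p v \<theta> = tangent_vector A \<psi> p (dird (coord_change \<phi> \<psi>) v (chart_map \<phi> p)) \<theta>"
    unfolding tangent_vector_def using coord_change_cocycle[OF assms(1,2) _ assms(3,4), of \<theta> v] by (metis (full_types))
qed

lemma tangent_chart_dom: "chart_dom (tangent_chart A \<phi>) = tangent_bundle A (chart_dom \<phi>)"
  and tangent_chart_map: "chart_map (tangent_chart A \<phi>) w = (chart_map \<phi> (fst w), snd w \<phi>)"
  by (simp_all add: tangent_chart_def)

lemma tangent_bundleE:
  assumes "w \<in> tangent_bundle A U" "\<phi> \<in> A" "fst w \<in> chart_dom \<phi>"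
  shows "w = (fst w, tangent_vector A \<phi> (fst w) (snd w \<phi>))"
  using assms tangent_space_coords[of "snd w" "fst w" \<phi>] by (cases w) (auto simp: tangent_bundle_def)

lemma tangent_chart_inj: "\<phi> \<in> A \<Longrightarrow> inj_on (chart_map (tangent_chart A \<phi>)) (tangent_bundle A (chart_dom \<phi>))"
proof (rule inj_onI)
  fix w w'
  assume \<phi>: "\<phi> \<in> A" and w: "w \<in> tangent_bundle A (chart_dom \<phi>)" "w' \<in> tangent_bundle A (chart_dom \<phi>)"
    and eq: "chart_map (tangent_chart A \<phi>) w = chart_map (tangent_chart A \<phi>) w'"
  then have d: "fst w \<in> chart_dom \<phi>" "fst w' \<in> chart_dom \<phi>" by (auto simp: tangent_bundle_def)
  then have "fst w = fst w'"
    using eq \<phi> chart_inv_map[OF \<phi>] by (metis tangent_chart_map prod.inject)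
  moreover have "snd w \<phi> = snd w' \<phi>" using eq by (simp add: tangent_chart_map)
  ultimately show "w = w'"
    using tangent_bundleE[OF w(1) \<phi> d(1)] tangent_bundleE[OF w(2) \<phi> d(2)] by simp
qed

lemma tangent_chart_inv_map:
  assumes "\<phi> \<in> A" "w \<in> tangent_bundle A U" "fst w \<in> chart_dom \<phi>"
  shows "chart_inv (tangent_chart A \<phi>) (chart_map \<phi> (fst w), snd w \<phi>) = w"
proof -
  have "w \<in> tangent_bundle A (chart_dom \<phi>)" using assms by (auto simp: tangent_bundle_def)
  then show ?thesis
    using the_inv_into_f_f[OF tangent_chart_inj[OF assms(1)]]
    by (simp add: chart_inv_def tangent_chart_dom tangent_chart_map)
qed

lemma tangent_chart_inv:
  assumes "\<phi> \<in> A" "x \<in> chart_image \<phi> S"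
  shows "chart_inv (tangent_chart A \<phi>) (x, v) = (chart_inv \<phi> x, tangent_vector A \<phi> (chart_inv \<phi> x) v)"
  using tangent_chart_inv_map[of \<phi> "(chart_inv \<phi> x, tangent_vector A \<phi> (chart_inv \<phi> x) v)" UNIV]
    chart_imageD[OF assms] assms
  by (simp add: tangent_vector_at tangent_bundle_def tangent_vector_mem)

lemma tangent_chart_image:
  assumes "\<phi> \<in> A"
  shows "chart_image (tangent_chart A \<phi>) (tangent_bundle A U) = chart_image \<phi> U \<times> UNIV"
proof (intro set_eqI iffI)
  fix z assume "z \<in> chart_image (tangent_chart A \<phi>) (tangent_bundle A U)"
  then show "z \<in> chart_image \<phi> U \<times> UNIV"
    by (auto simp: chart_image_def tangent_chart_dom tangent_chart_map tangent_bundle_def)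
next
  fix z assume "z \<in> chart_image \<phi> U \<times> (UNIV :: (real^'n) set)"
  then obtain x v where z: "z = (x, v)" and x: "x \<in> chart_image \<phi> U" by auto
  note d = chart_imageD[OF assms x]
  let ?w = "(chart_inv \<phi> x, tangent_vector A \<phi> (chart_inv \<phi> x) v)"
  have "?w \<in> chart_dom (tangent_chart A \<phi>) \<inter> tangent_bundle A U"
    using d tangent_vector_mem[OF assms d(1)] by (simp add: tangent_chart_dom tangent_bundle_def)
  moreover have "chart_map (tangent_chart A \<phi>) ?w = z"
    using d by (simp add: z tangent_chart_map tangent_vector_at assms)
  ultimately show "z \<in> chart_image (tangent_chart A \<phi>) (tangent_bundle A U)"
    unfolding chart_image_def by blast
qed

text \<open>This identifies the coordinate change between induced charts with
  \<open>prolong\<close>, on which all chart comparisons below rest.\<close>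

lemma tangent_chart_inv_change:
  assumes "\<phi> \<in> A" "\<psi> \<in> A" "z \<in> chart_image \<phi> (U \<inter> chart_dom \<psi>) \<times> UNIV"
  shows "chart_inv (tangent_chart A \<phi>) z = chart_inv (tangent_chart A \<psi>) (prolong (coord_change \<phi> \<psi>) z)"
proof -
  obtain x v where z: "z = (x, v)" by (cases z)
  then have x: "x \<in> chart_image \<phi> (U \<inter> chart_dom \<psi>)" using assms by auto
  note d = chart_imageD[OF assms(1) x]
  have m: "chart_map \<psi> (chart_inv \<phi> x) \<in> chart_image \<psi> UNIV"
    using d by (intro chart_map_mem) auto
  have "prolong (coord_change \<phi> \<psi>) z
      = (chart_map \<psi> (chart_inv \<phi> x), dird (coord_change \<phi> \<psi>) v x)"
    by (simp add: z prolong_def coord_change_def)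
  then have "chart_inv (tangent_chart A \<psi>) (prolong (coord_change \<phi> \<psi>) z)
      = (chart_inv \<phi> x, tangent_vector A \<psi> (chart_inv \<phi> x) (dird (coord_change \<phi> \<psi>) v x))"
    using d assms(2) by (simp only: tangent_chart_inv[OF assms(2) m] chart_inv_map Int_iff)
  also have "\<dots> = (chart_inv \<phi> x, tangent_vector A \<phi> (chart_inv \<phi> x) v)"
    using tangent_vector_change[OF assms(1,2), of "chart_inv \<phi> x" v] d by (simp only: Int_iff)
  finally show ?thesis
    by (simp only: z tangent_chart_inv[OF assms(1) x])
qed

lemma fun_coord_change:
  assumes "\<phi> \<in> A" "\<psi> \<in> A" "z \<in> chart_image \<phi> (U \<inter> chart_dom \<psi>) \<times> UNIV"
  shows "fun_coord A F \<phi> z = fun_coord A F \<psi> (prolong (coord_change \<phi> \<psi>) z)"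
  using tangent_chart_inv_change[OF assms] by (simp add: fun_coord_def)

lemma smooth_function_iff:
  "smooth_function (tangent_atlas A) (tangent_bundle A U) F \<longleftrightarrow>
    (\<forall>\<phi>\<in>A. smooth_on (chart_image \<phi> U \<times> UNIV) (fun_coord A F \<phi>))"
  by (simp add: smooth_function_def tangent_atlas_def tangent_chart_image fun_coord_def)

lemma coord_vec_eq:
  assumes "\<phi> \<in> A" "x \<in> chart_image \<phi> S"
  shows "coord_vec A \<phi> x i = tangent_vector A \<phi> (chart_inv \<phi> x) (axis i 1)"
  by (simp add: coord_vec_def tangent_chart_inv[OF assms])

lemma coord_vec_change:
  assumes "\<phi> \<in> A" "\<psi> \<in> A" "x \<in> chart_image \<phi> (U \<inter> chart_dom \<psi>)"
  shows "coord_vec A \<phi> x i \<psi> = dird (coord_change \<phi> \<psi>) (axis i 1) x"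
  using chart_imageD[OF assms(1,3)] assms by (simp add: coord_vec_eq[OF assms(1,3)] tangent_vector_def)

end


section \<open>Curves and their lifts\<close>

lemma smooth_on_has_vector_derivative:
  assumes "smooth_on S y" "t \<in> S"
  shows "(y has_vector_derivative dird y 1 t) (at t)"
proof -
  note D = smooth_on_has_derivative[OF assms]
  have "(\<lambda>d. dird y d t) = (\<lambda>d. d *\<^sub>R dird y 1 t)"
  proof
    show "dird y d t = d *\<^sub>R dird y 1 t" for d
      using linear_scale[OF has_derivative_linear[OF D], of d 1] by simp
  qed
  then show ?thesis
    unfolding has_vector_derivative_def by (rule has_derivative_eq_rhs[OF D])
qed

lemma has_vector_derivative_compose_dird:
  assumes "(y has_vector_derivative y') (at t)" "G differentiable (at (y t))"
  shows "((\<lambda>s. G (y s)) has_vector_derivative dird G y' (y t)) (at t)"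
proof -
  note D = has_derivative_dird[OF assms(2)]
  show ?thesis
    using has_derivative_compose[OF assms(1)[unfolded has_vector_derivative_def] D]
      linear_scale[OF has_derivative_linear[OF D], of _ y']
    by (simp add: has_vector_derivative_def)
qed

locale atlas_curve = atlas A
  for A :: "('q::topological_space, real^'n::finite) chart set" +
  fixes U :: "'q set" and I :: "real set" and c :: "real \<Rightarrow> 'q"
  assumes open_U: "open U" and open_I: "open I" and curve: "smooth_curve A U I c"
begin

definition chart_times :: "('q, real^'n) chart \<Rightarrow> real set" where
  "chart_times \<phi> = {t \<in> I. c t \<in> chart_dom \<phi>}"

lemma open_chart_times: "\<phi> \<in> A \<Longrightarrow> open (chart_times \<phi>)"
  using continuous_open_preimage[of I c "chart_dom \<phi>"] open_I open_chart_dom curve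
  by (simp add: smooth_curve_def chart_times_def Int_def vimage_def)

lemma coord_smooth: "\<phi> \<in> A \<Longrightarrow> smooth_on (chart_times \<phi>) (chart_map \<phi> \<circ> c)"
  using curve by (simp add: smooth_curve_def chart_times_def)

context
  fixes \<phi> assumes \<phi>: "\<phi> \<in> A"
begin

lemma velocity_eq_dird: "t \<in> chart_times \<phi> \<Longrightarrow> velocity \<phi> c t = dird (chart_map \<phi> \<circ> c) 1 t"
  using smooth_on_has_vector_derivative[OF coord_smooth[OF \<phi>]]
  by (simp add: velocity_def vector_derivative_at)

lemma coord_has_velocity:
  "t \<in> chart_times \<phi> \<Longrightarrow> ((chart_map \<phi> \<circ> c) has_vector_derivative velocity \<phi> c t) (at t)"
  using smooth_on_has_vector_derivative[OF coord_smooth[OF \<phi>]] by (simp add: velocity_eq_dird)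

lemma velocity_smooth: "smooth_on (chart_times \<phi>) (velocity \<phi> c)"
  by (rule smooth_on_cong[OF open_chart_times[OF \<phi>] _ smooth_on_dird[OF coord_smooth[OF \<phi>], of 1]])
    (simp add: velocity_eq_dird)

lemma lift_has_vector_derivative:
  assumes "t \<in> chart_times \<phi>"
  shows "(lift_coord \<phi> c has_vector_derivative (velocity \<phi> c t, vector_derivative (velocity \<phi> c) (at t))) (at t)"
proof -
  have "(velocity \<phi> c has_vector_derivative vector_derivative (velocity \<phi> c) (at t)) (at t)"
    using smooth_on_has_vector_derivative[OF velocity_smooth assms] by (simp add: vector_derivative_at)
  from has_derivative_Pair[OF coord_has_velocity[OF assms, unfolded has_vector_derivative_def]
      this[unfolded has_vector_derivative_def]]
  show ?thesis by (simp add: has_vector_derivative_def lift_coord_def[abs_def])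
qed

lemma lift_mem: "t \<in> chart_times \<phi> \<Longrightarrow> c t \<in> T \<Longrightarrow> lift_coord \<phi> c t \<in> chart_image \<phi> (U \<inter> T) \<times> UNIV"
  using curve by (auto simp: chart_times_def smooth_curve_def lift_coord_def intro!: chart_map_mem)

lemma lift_mem': "t \<in> chart_times \<phi> \<Longrightarrow> lift_coord \<phi> c t \<in> chart_image \<phi> U \<times> UNIV"
  using lift_mem[of t UNIV] by simp

lemma lift_change:
  assumes \<psi>: "\<psi> \<in> A" and t: "t \<in> chart_times \<phi>" "t \<in> chart_times \<psi>"
  shows "lift_coord \<psi> c t = prolong (coord_change \<phi> \<psi>) (lift_coord \<phi> c t)"
proof -
  have ct: "c t \<in> chart_dom \<phi>" "c t \<in> chart_dom \<psi>" using t by (auto simp: chart_times_def)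
  have "((\<lambda>s. coord_change \<phi> \<psi> ((chart_map \<phi> \<circ> c) s)) has_vector_derivative
      dird (coord_change \<phi> \<psi>) (velocity \<phi> c t) ((chart_map \<phi> \<circ> c) t)) (at t)"
    by (rule has_vector_derivative_compose_dird[OF coord_has_velocity[OF t(1)]])
      (simp add: coord_change_differentiable[OF \<phi> \<psi> ct])
  then have "((chart_map \<psi> \<circ> c) has_vector_derivative
      dird (coord_change \<phi> \<psi>) (velocity \<phi> c t) ((chart_map \<phi> \<circ> c) t)) (at t)"
    by (rule has_vector_derivative_transform_within_open[OF _ open_chart_times[OF \<phi>] t(1)])
      (simp add: coord_change_map \<phi> chart_times_def)
  then have "velocity \<psi> c t = dird (coord_change \<phi> \<psi>) (velocity \<phi> c t) (chart_map \<phi> (c t))"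
    unfolding velocity_def[of \<psi>] by (simp add: vector_derivative_at)
  then show ?thesis
    by (simp add: lift_coord_def prolong_def coord_change_map[OF \<phi> ct(1)])
qed

end

definition EL_along ::
  "(('q, 'n) tq \<Rightarrow> real) \<Rightarrow> (('q, 'n) tq \<Rightarrow> real) \<Rightarrow> ('q, real^'n) chart \<Rightarrow> 'n \<Rightarrow> real \<Rightarrow> real" where
  "EL_along L D \<phi> i t = deriv (\<lambda>s. V i (fun_coord A L \<phi>) (lift_coord \<phi> c s)) t
     - dq i (fun_coord A L \<phi>) (lift_coord \<phi> c t) - V i (fun_coord A D \<phi>) (lift_coord \<phi> c t)"

lemma dissipative_solution_iff:
  "dissipative_solution A L D U I c \<longleftrightarrow> (\<forall>\<phi>\<in>A. \<forall>t\<in>chart_times \<phi>. \<forall>i. EL_along L D \<phi> i t = 0)"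
  using curve by (auto simp: dissipative_solution_def EL_along_def chart_times_def)

text \<open>Along a curve the expressions form a covector, so their vanishing in one chart at time
  \<open>t\<close> implies it in every other chart around that point.\<close>

lemma EL_along_change:
  assumes L: "smooth_function (tangent_atlas A) (tangent_bundle A U) L"
    and D: "smooth_function (tangent_atlas A) (tangent_bundle A U) D"
    and \<phi>: "\<phi> \<in> A" and \<psi>: "\<psi> \<in> A" and t: "t \<in> chart_times \<phi>" "t \<in> chart_times \<psi>"
  shows "EL_along L D \<phi> i t = (\<Sum>k\<in>UNIV. dird (coord_change \<phi> \<psi>) (axis i 1) (chart_map \<phi> (c t)) $ k
    * EL_along L D \<psi> k t)"
proof -
  let ?h = "coord_change \<phi> \<psi>" and ?y = "lift_coord \<phi> c"
  let ?X = "chart_image \<phi> (U \<inter> chart_dom \<psi>)" and ?Y = "chart_image \<psi> (U \<inter> chart_dom \<phi>)"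
  interpret T: coordinate_transition ?X ?Y ?h by (rule transition[OF \<phi> \<psi> open_U])
  have sub: "?Y \<times> UNIV \<subseteq> chart_image \<psi> U \<times> (UNIV :: (real^'n) set)"
    by (auto simp: chart_image_def)
  have sm: "smooth_on (?Y \<times> UNIV) (fun_coord A F \<psi>)"
    if "smooth_function (tangent_atlas A) (tangent_bundle A U) F" for F
    by (rule smooth_on_subset[OF _ sub]) (use that \<psi> in \<open>simp add: smooth_function_iff\<close>)
  have eq: "fun_coord A F \<phi> z = fun_coord A F \<psi> (prolong ?h z)" if "z \<in> ?X \<times> UNIV" for F z
    using fun_coord_change[OF \<phi> \<psi> that] .
  have yt: "?y t \<in> ?X \<times> UNIV"
    using lift_mem[OF \<phi> t(1)] t(2) by (simp add: chart_times_def)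
  \<comment> \<open>The time derivatives depend on a neighbourhood of \<open>t\<close>, so the two
    descriptions must agree near \<open>t\<close>, not only at \<open>t\<close>.\<close>
  have ev: "\<forall>\<^sub>F s in nhds t. s \<in> chart_times \<phi> \<inter> chart_times \<psi>"
    using t open_chart_times[OF \<phi>] open_chart_times[OF \<psi>] by (intro eventually_nhds_in_open) auto
  have 1: "deriv (\<lambda>s. V i (fun_coord A L \<phi>) (?y s)) t
      = deriv (\<lambda>s. V i (\<lambda>z. fun_coord A L \<psi> (prolong ?h z)) (?y s)) t"
  proof (rule deriv_cong_ev[OF _ refl])
    show "\<forall>\<^sub>F s in nhds t. V i (fun_coord A L \<phi>) (?y s) = V i (\<lambda>z. fun_coord A L \<psi> (prolong ?h z)) (?y s)"
      using ev
    proof eventually_elim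
      case (elim s)
      then have "?y s \<in> ?X \<times> UNIV" using lift_mem[OF \<phi>] by (simp add: chart_times_def)
      then show ?case by (intro T.X.V_cong eq)
    qed
  qed
  have 2: "deriv (\<lambda>s. V k (fun_coord A L \<psi>) (lift_coord \<psi> c s)) t
      = deriv (\<lambda>s. V k (fun_coord A L \<psi>) (prolong ?h (?y s))) t" for k
  proof (rule deriv_cong_ev[OF _ refl])
    show "\<forall>\<^sub>F s in nhds t. V k (fun_coord A L \<psi>) (lift_coord \<psi> c s) = V k (fun_coord A L \<psi>) (prolong ?h (?y s))"
      using ev by eventually_elim (simp only: lift_change[OF \<phi> \<psi>] Int_iff)
  qed
  have 3: "dq i (fun_coord A L \<phi>) (?y t) = dq i (\<lambda>z. fun_coord A L \<psi> (prolong ?h z)) (?y t)"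
    "V i (fun_coord A D \<phi>) (?y t) = V i (\<lambda>z. fun_coord A D \<psi> (prolong ?h z)) (?y t)"
    by (intro T.X.V_cong T.X.dq_cong eq yt; assumption)+
  have fst_y: "fst (?y t) = chart_map \<phi> (c t)" and snd_y: "snd (?y t) = velocity \<phi> c t"
    by (simp_all add: lift_coord_def)
  have "EL_along L D \<phi> i t = (deriv (\<lambda>s. V i (\<lambda>z. fun_coord A L \<psi> (prolong ?h z)) (?y s)) t
      - dq i (\<lambda>z. fun_coord A L \<psi> (prolong ?h z)) (?y t)) - V i (\<lambda>z. fun_coord A D \<psi> (prolong ?h z)) (?y t)"
    unfolding EL_along_def 1 3 ..
  also have "\<dots> = (\<Sum>k\<in>UNIV. dird ?h (axis i 1) (chart_map \<phi> (c t)) $ k *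
        (deriv (\<lambda>s. V k (fun_coord A L \<psi>) (prolong ?h (?y s))) t - dq k (fun_coord A L \<psi>) (prolong ?h (?y t))))
      - (\<Sum>k\<in>UNIV. dird ?h (axis i 1) (chart_map \<phi> (c t)) $ k * V k (fun_coord A D \<psi>) (prolong ?h (?y t)))"
    using T.EL_curve_transition[where y="?y" and t=t, OF sm[OF L] yt, of "vector_derivative (velocity \<phi> c) (at t)" i]
      lift_has_vector_derivative[OF \<phi> t(1)] T.V_comp_prolong[OF sm[OF D] yt, of i]
    by (simp only: fst_y snd_y)
  also have "\<dots> = (\<Sum>k\<in>UNIV. dird ?h (axis i 1) (chart_map \<phi> (c t)) $ k * EL_along L D \<psi> k t)"
    unfolding EL_along_def 2 lift_change[OF \<phi> \<psi> t] by (simp add: right_diff_distrib sum_subtractf)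
  finally show ?thesis .
qed

text \<open>The chain rule produces the actual acceleration; adding and subtracting \<open>f\<close>
  splits off \<open>EL\<close>. The field enters only through this splitting, so \<open>f\<close> is
  arbitrary.\<close>

lemma EL_along_eq_EL:
  assumes L: "smooth_function (tangent_atlas A) (tangent_bundle A U) L"
    and \<phi>: "\<phi> \<in> A" and t: "t \<in> chart_times \<phi>"
  shows "EL_along L D \<phi> i t = EL f (fun_coord A L \<phi>) (fun_coord A D \<phi>) i (lift_coord \<phi> c t)
    + (\<Sum>j\<in>UNIV. V j (V i (fun_coord A L \<phi>)) (lift_coord \<phi> c t)
        * (vector_derivative (velocity \<phi> c) (at t) $ j - f (lift_coord \<phi> c t) $ j))"
proof -
  let ?L = "fun_coord A L \<phi>" and ?y = "lift_coord \<phi> c"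
  have op: "open (chart_image \<phi> U \<times> (UNIV :: (real^'n) set))"
    using open_chart_image[OF \<phi> open_U] by (auto intro: open_Times)
  interpret W: sode_coords "chart_image \<phi> U \<times> UNIV" "\<lambda>_. 0"
    by unfold_locales (use op in \<open>auto intro: smooth_on_const\<close>)
  have sm: "smooth_on (chart_image \<phi> U \<times> UNIV) ?L" using L \<phi> by (simp add: smooth_function_iff)
  have dif: "V i ?L differentiable (at (?y t))"
    by (rule smooth_on_differentiable[OF W.V_smooth[OF sm] lift_mem'[OF \<phi> t]])
  have "((\<lambda>s. V i ?L (?y s)) has_vector_derivative
      dird (V i ?L) (velocity \<phi> c t, vector_derivative (velocity \<phi> c) (at t)) (?y t)) (at t)"
    by (rule has_vector_derivative_compose_dird[OF lift_has_vector_derivative[OF \<phi> t] dif])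
  then have "deriv (\<lambda>s. V i ?L (?y s)) t
      = dird (V i ?L) (velocity \<phi> c t, vector_derivative (velocity \<phi> c) (at t)) (?y t)"
    by (intro DERIV_imp_deriv) (simp add: has_real_derivative_iff_has_vector_derivative)
  moreover have "velocity \<phi> c t = snd (?y t)" by (simp add: lift_coord_def)
  ultimately show ?thesis
    by (simp add: EL_along_def EL_def dird_tcoords[OF dif] sode_derivation_def right_diff_distrib
        sum_subtractf mult.commute)
qed

end

context atlas
begin

lemma tangent_chart_map_inv:
  assumes "\<phi> \<in> A" "z \<in> chart_image \<phi> S \<times> UNIV"
  shows "chart_map (tangent_chart A \<phi>) (chart_inv (tangent_chart A \<phi>) z) = z"
    and "chart_inv (tangent_chart A \<phi>) z \<in> tangent_bundle A (chart_dom \<phi> \<inter> S)"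
proof -
  obtain x v where z: "z = (x, v)" "x \<in> chart_image \<phi> S" using assms by auto
  note d = chart_imageD[OF assms(1) z(2)]
  show "chart_map (tangent_chart A \<phi>) (chart_inv (tangent_chart A \<phi>) z) = z"
    "chart_inv (tangent_chart A \<phi>) z \<in> tangent_bundle A (chart_dom \<phi> \<inter> S)"
    using d assms(1)
    by (simp_all add: z(1) tangent_chart_inv[OF assms(1) z(2)] tangent_chart_map tangent_vector_at
        tangent_bundle_def tangent_vector_mem)
qed

end

section \<open>The second-order field and its solutions under changes of charts\<close>

locale second_order = atlas A
  for A :: "('q::topological_space, real^'n::finite) chart set" +
  fixes \<Gamma> :: "('q, 'n) tq_field"
  assumes sode: "second_order_field A \<Gamma>"
begin

lemma field_coords:
  assumes "\<phi> \<in> A" "z \<in> chart_image \<phi> S \<times> UNIV"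
  shows "\<Gamma> (chart_inv (tangent_chart A \<phi>) z) (tangent_chart A \<phi>) = (snd z, sode_coeff A \<Gamma> \<phi> z)"
proof -
  let ?w = "chart_inv (tangent_chart A \<phi>) z"
  have "?w \<in> tangent_bundle A (chart_dom \<phi>)"
    using tangent_chart_map_inv(2)[OF assms] by (auto simp: tangent_bundle_def)
  then have "fst (\<Gamma> ?w (tangent_chart A \<phi>)) = snd ?w \<phi>"
    using sode assms(1) unfolding second_order_field_def by blast
  also have "\<dots> = snd z"
    using tangent_chart_map_inv(1)[OF assms] by (metis tangent_chart_map snd_conv)
  finally show ?thesis by (simp add: sode_coeff_def prod_eq_iff)
qed

lemma sode_coeff_smooth:
  assumes "\<phi> \<in> A" "open U"
  shows "smooth_on (chart_image \<phi> U \<times> UNIV) (sode_coeff A \<Gamma> \<phi>)"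
proof -
  have "smooth_on (chart_image \<phi> UNIV \<times> UNIV) (\<lambda>z. \<Gamma> (chart_inv (tangent_chart A \<phi>) z) (tangent_chart A \<phi>))"
    using sode assms(1)
    by (simp add: second_order_field_def smooth_vector_field_def tangent_atlas_def tangent_chart_image)
  then have "smooth_on (chart_image \<phi> U \<times> UNIV) (\<lambda>z. \<Gamma> (chart_inv (tangent_chart A \<phi>) z) (tangent_chart A \<phi>))"
    by (rule smooth_on_subset) (auto simp: chart_image_def)
  then show ?thesis
    unfolding sode_coeff_def[abs_def]
    by (intro smooth_on_snd open_Times open_chart_image assms open_UNIV)
qed

text \<open>The field is a tangent vector of the tangent bundle, so its components change by the
  derivative of the induced coordinate change, which coincides with \<open>prolong\<close> near
  \<open>z\<close>.\<close>

lemma field_change: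
  assumes "\<phi> \<in> A" "\<psi> \<in> A" "z \<in> chart_image \<phi> (chart_dom \<psi>) \<times> UNIV"
  defines "z' \<equiv> prolong (coord_change \<phi> \<psi>) z"
  shows "(snd z', sode_coeff A \<Gamma> \<psi> z') = dird (prolong (coord_change \<phi> \<psi>)) (snd z, sode_coeff A \<Gamma> \<phi> z) z"
proof -
  interpret T: coordinate_transition "chart_image \<phi> (chart_dom \<psi>)" "chart_image \<psi> (chart_dom \<phi>)" "coord_change \<phi> \<psi>"
    using transition[OF assms(1,2) open_UNIV] by simp
  let ?w = "chart_inv (tangent_chart A \<phi>) z"
  have inv: "chart_inv (tangent_chart A \<phi>) y = chart_inv (tangent_chart A \<psi>) (prolong (coord_change \<phi> \<psi>) y)"
    if "y \<in> chart_image \<phi> (chart_dom \<psi>) \<times> UNIV" for y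
    using tangent_chart_inv_change[OF assms(1,2), of y UNIV] that by simp
  have z': "z' \<in> chart_image \<psi> (chart_dom \<phi>) \<times> UNIV"
    unfolding z'_def by (rule T.prolong_mem[OF assms(3)])
  have w': "?w = chart_inv (tangent_chart A \<psi>) z'" using inv[OF assms(3)] by (simp add: z'_def)
  have w: "?w \<in> tangent_bundle A (chart_dom \<phi> \<inter> chart_dom \<psi>)"
    by (rule tangent_chart_map_inv(2)[OF assms(1,3)])
  then have wd: "?w \<in> chart_dom (tangent_chart A \<phi>)" "?w \<in> chart_dom (tangent_chart A \<psi>)" "?w \<in> tangent_bundle A UNIV"
    by (auto simp: tangent_chart_dom tangent_bundle_def)
  then have "\<Gamma> ?w \<in> tangent_space (tangent_atlas A) ?w"
    using sode unfolding second_order_field_def smooth_vector_field_def by blast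
  then have "\<Gamma> ?w (tangent_chart A \<psi>) = dird (coord_change (tangent_chart A \<phi>) (tangent_chart A \<psi>))
      (\<Gamma> ?w (tangent_chart A \<phi>)) (chart_map (tangent_chart A \<phi>) ?w)"
    using wd assms(1,2) unfolding tangent_space_def tangent_atlas_def dird_def by blast
  also have "\<dots> = dird (coord_change (tangent_chart A \<phi>) (tangent_chart A \<psi>)) (snd z, sode_coeff A \<Gamma> \<phi> z) z"
    using tangent_chart_map_inv(1)[OF assms(1,3)] field_coords[OF assms(1,3)] by simp
  also have "\<dots> = dird (prolong (coord_change \<phi> \<psi>)) (snd z, sode_coeff A \<Gamma> \<phi> z) z"
  proof (rule dird_cong[OF T.opens(1) assms(3)])
    fix y assume y: "y \<in> chart_image \<phi> (chart_dom \<psi>) \<times> (UNIV :: (real^'n) set)"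
    show "coord_change (tangent_chart A \<phi>) (tangent_chart A \<psi>) y = prolong (coord_change \<phi> \<psi>) y"
      using tangent_chart_map_inv(1)[OF assms(2) T.prolong_mem[OF y]] inv[OF y]
      by (simp add: coord_change_def[of "tangent_chart A \<phi>"])
  qed
  finally show ?thesis using field_coords[OF assms(2) z'] w' by simp
qed

text \<open>It suffices to check the equation in one chart at each time: \<open>prolong\<close> maps
  the lifted curve of one chart to that of another and, by \<open>field_change\<close>, the field to
  the field.\<close>

lemma sode_solution_charts:
  assumes U: "open U" and I: "open I" and c: "smooth_curve A U I c"
    and sol: "\<And>t. t \<in> I \<Longrightarrow> \<exists>\<phi>\<in>A. c t \<in> chart_dom \<phi> \<and>
      vector_derivative (velocity \<phi> c) (at t) = sode_coeff A \<Gamma> \<phi> (lift_coord \<phi> c t)"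
  shows "sode_solution A \<Gamma> U I c"
  unfolding sode_solution_def
proof (intro conjI ballI impI c)
  interpret C: atlas_curve A U I c by unfold_locales (use U I c in auto)
  fix \<psi> t assume \<psi>: "\<psi> \<in> A" and t: "t \<in> I" "c t \<in> chart_dom \<psi>"
  then obtain \<phi> where \<phi>: "\<phi> \<in> A" "c t \<in> chart_dom \<phi>"
    and eq: "vector_derivative (velocity \<phi> c) (at t) = sode_coeff A \<Gamma> \<phi> (lift_coord \<phi> c t)"
    using sol by blast
  have tt: "t \<in> C.chart_times \<phi>" "t \<in> C.chart_times \<psi>" using t \<phi> by (auto simp: C.chart_times_def)
  interpret T: coordinate_transition "chart_image \<phi> (chart_dom \<psi>)" "chart_image \<psi> (chart_dom \<phi>)" "coord_change \<phi> \<psi>"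
    using transition[OF \<phi>(1) \<psi> open_UNIV] by simp
  let ?K = "prolong (coord_change \<phi> \<psi>)" and ?z = "lift_coord \<phi> c t"
  have z: "?z \<in> chart_image \<phi> (chart_dom \<psi>) \<times> UNIV"
    using t \<phi> by (auto simp: lift_coord_def intro: chart_map_mem)
  have "(lift_coord \<phi> c has_vector_derivative (snd ?z, sode_coeff A \<Gamma> \<phi> ?z)) (at t)"
    using C.lift_has_vector_derivative[OF \<phi>(1) tt(1)] eq by (simp add: lift_coord_def)
  then have "((\<lambda>s. ?K (lift_coord \<phi> c s)) has_vector_derivative dird ?K (snd ?z, sode_coeff A \<Gamma> \<phi> ?z) ?z) (at t)"
    by (rule has_vector_derivative_compose_dird) (rule smooth_on_differentiable[OF T.prolong_smooth z])
  then have "(lift_coord \<psi> c has_vector_derivative dird ?K (snd ?z, sode_coeff A \<Gamma> \<phi> ?z) ?z) (at t)"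
  proof (rule has_vector_derivative_transform_within_open)
    show "open (C.chart_times \<phi> \<inter> C.chart_times \<psi>)"
      by (intro open_Int C.open_chart_times \<phi> \<psi>)
    show "?K (lift_coord \<phi> c s) = lift_coord \<psi> c s" if "s \<in> C.chart_times \<phi> \<inter> C.chart_times \<psi>" for s
      using C.lift_change[OF \<phi>(1) \<psi>, of s] that by simp
  qed (use tt in simp)
  from vector_derivative_unique_at[OF this C.lift_has_vector_derivative[OF \<psi> tt(2)]]
  show "vector_derivative (velocity \<psi> c) (at t) = sode_coeff A \<Gamma> \<psi> (lift_coord \<psi> c t)"
    using field_change[OF \<phi>(1) \<psi> z] C.lift_change[OF \<phi>(1) \<psi> tt] by simp
qed

end


section \<open>Dissipative systems and multiplier tensors\<close>

context atlas
begin

lemma sode_coords_chart: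
  "\<phi> \<in> A \<Longrightarrow> open U \<Longrightarrow> sode_coords (chart_image \<phi> U \<times> UNIV) (\<lambda>_. 0)"
  by unfold_locales (auto intro!: smooth_on_const open_Times open_chart_image)

lemma tangent_vector_lincomb:
  assumes "\<phi> \<in> A" "p \<in> chart_dom \<phi>"
  shows "tangent_vector A \<phi> p (a *\<^sub>R v + b *\<^sub>R v')
    = (\<lambda>\<psi>. a *\<^sub>R tangent_vector A \<phi> p v \<psi> + b *\<^sub>R tangent_vector A \<phi> p v' \<psi>)"
proof
  fix \<psi>
  show "tangent_vector A \<phi> p (a *\<^sub>R v + b *\<^sub>R v') \<psi>
    = a *\<^sub>R tangent_vector A \<phi> p v \<psi> + b *\<^sub>R tangent_vector A \<phi> p v' \<psi>"
  proof (cases "\<psi> \<in> A \<and> p \<in> chart_dom \<psi>")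
    case True
    then have lin: "linear (\<lambda>v. dird (coord_change \<phi> \<psi>) v (chart_map \<phi> p))"
      using assms by (intro dird_linear coord_change_differentiable) auto
    show ?thesis
      using True linear_add[OF lin, of "a *\<^sub>R v" "b *\<^sub>R v'"] linear_scale[OF lin, of a v] linear_scale[OF lin, of b v']
      by (simp add: tangent_vector_def)
  qed (auto simp: tangent_vector_def)
qed

text \<open>Bilinearity makes the components in one chart determine the tensor, hence also its
  components in any other chart.\<close>

lemma tensor_expand:
  assumes g: "tensor02_along A U g" and w: "w \<in> tangent_bundle A U" and \<phi>: "\<phi> \<in> A" "fst w \<in> chart_dom \<phi>"
    and X: "X \<in> tangent_space A (fst w)" and Y: "Y \<in> tangent_space A (fst w)"
  shows "g w X Y = (\<Sum>a\<in>UNIV. \<Sum>b\<in>UNIV. X \<phi> $ a * Y \<phi> $ b * tensor_coord A g \<phi> a b (chart_map (tangent_chart A \<phi>) w))"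
proof -
  let ?p = "fst w" and ?e = "\<lambda>v. tangent_vector A \<phi> (fst w) v"
  have e: "?e v \<in> tangent_space A ?p" for v by (rule tangent_vector_mem[OF \<phi>])
  have bilin: "g w (\<lambda>\<phi>. a *\<^sub>R X \<phi> + b *\<^sub>R X' \<phi>) Y = a * g w X Y + b * g w X' Y"
    "g w Y (\<lambda>\<phi>. a *\<^sub>R X \<phi> + b *\<^sub>R X' \<phi>) = a * g w Y X + b * g w Y X'"
    if "X \<in> tangent_space A ?p" "X' \<in> tangent_space A ?p" "Y \<in> tangent_space A ?p" for X X' Y a b
    using g w that unfolding tensor02_along_def by blast+
  have lin: "linear T" if "\<And>a b v v'. T (a *\<^sub>R v + b *\<^sub>R v') = a * T v + b * T v'" for T :: "real^'n \<Rightarrow> real"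
    using that[of 1 _ 1] that[of _ _ 0] by (intro linearI) simp_all
  have cv: "coord_vec A \<phi> (chart_map \<phi> ?p) a = ?e (axis a 1)" for a
    using coord_vec_eq[OF \<phi>(1) chart_map_mem[OF \<phi>(2), of UNIV]] by (simp add: chart_inv_map \<phi>)
  have tc: "tensor_coord A g \<phi> a b (chart_map (tangent_chart A \<phi>) w) = g w (?e (axis a 1)) (?e (axis b 1))" for a b
    using tangent_chart_inv_map[OF \<phi>(1) w \<phi>(2)] by (simp add: tensor_coord_def tangent_chart_map cv)
  have "g w X Y = g w (?e (X \<phi>)) (?e (Y \<phi>))"
    using tangent_space_coords[OF X \<phi>] tangent_space_coords[OF Y \<phi>] by simp
  also have "\<dots> = (\<Sum>a\<in>UNIV. X \<phi> $ a * g w (?e (axis a 1)) (?e (Y \<phi>)))"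
    by (simp flip: real_scaleR_def, rule linear_axis_expand[where T="\<lambda>v. g w (?e v) (?e (Y \<phi>))"])
      (intro lin, simp only: tangent_vector_lincomb[OF \<phi>] bilin e)
  also have "\<dots> = (\<Sum>a\<in>UNIV. X \<phi> $ a * (\<Sum>b\<in>UNIV. Y \<phi> $ b * g w (?e (axis a 1)) (?e (axis b 1))))"
  proof (rule sum.cong[OF refl])
    fix a
    have "g w (?e (axis a 1)) (?e (Y \<phi>)) = (\<Sum>b\<in>UNIV. Y \<phi> $ b * g w (?e (axis a 1)) (?e (axis b 1)))"
      by (simp flip: real_scaleR_def, rule linear_axis_expand[where T="\<lambda>v. g w (?e (axis a 1)) (?e v)"])
        (intro lin, simp only: tangent_vector_lincomb[OF \<phi>] bilin e)
    then show "X \<phi> $ a * g w (?e (axis a 1)) (?e (Y \<phi>))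
        = X \<phi> $ a * (\<Sum>b\<in>UNIV. Y \<phi> $ b * g w (?e (axis a 1)) (?e (axis b 1)))" by simp
  qed
  finally show ?thesis by (simp add: tc sum_distrib_left mult.assoc)
qed

section \<open>The fibre Hessian of a function as a tensor field along the projection\<close>

lemma hessian_change:
  assumes U: "open U" and L: "smooth_on (chart_image \<phi> U \<times> UNIV) (fun_coord A L \<phi>)"
    and \<phi>: "\<phi> \<in> A" and \<psi>: "\<psi> \<in> A" and z: "z \<in> chart_image \<psi> (U \<inter> chart_dom \<phi>) \<times> UNIV"
  shows "V i (V j (fun_coord A L \<psi>)) z = (\<Sum>a\<in>UNIV. \<Sum>b\<in>UNIV.
    coord_vec A \<psi> (fst z) i \<phi> $ a * coord_vec A \<psi> (fst z) j \<phi> $ b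
      * V a (V b (fun_coord A L \<phi>)) (prolong (coord_change \<psi> \<phi>) z))"
proof -
  let ?h = "coord_change \<psi> \<phi>"
  interpret T: coordinate_transition "chart_image \<psi> (U \<inter> chart_dom \<phi>)" "chart_image \<phi> (U \<inter> chart_dom \<psi>)" ?h
    by (rule transition[OF \<psi> \<phi> U])
  have sm: "smooth_on (chart_image \<phi> (U \<inter> chart_dom \<psi>) \<times> UNIV) (fun_coord A L \<phi>)"
    by (rule smooth_on_subset[OF L]) (auto simp: chart_image_def)
  have eq: "fun_coord A L \<psi> z = fun_coord A L \<phi> (prolong ?h z)" if "z \<in> chart_image \<psi> (U \<inter> chart_dom \<phi>) \<times> UNIV" for z
    by (rule fun_coord_change[OF \<psi> \<phi> that])
  have "V i (V j (fun_coord A L \<psi>)) z = V i (V j (\<lambda>z. fun_coord A L \<phi> (prolong ?h z))) z"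
    by (intro T.X.V_cong eq z; assumption)
  also have "\<dots> = (\<Sum>a\<in>UNIV. \<Sum>b\<in>UNIV. dird ?h (axis i 1) (fst z) $ a * dird ?h (axis j 1) (fst z) $ b
      * V a (V b (fun_coord A L \<phi>)) (prolong ?h z))"
    by (rule T.hessian_comp_prolong[OF sm z])
  finally show ?thesis
    using coord_vec_change[OF \<psi> \<phi>, of "fst z" U] z by (simp add: mem_Times_iff)
qed

text \<open>The chosen chart is irrelevant over sets on which \<open>L\<close> is smooth, by the transformation law of
  Hessians.\<close>

definition hessian_tensor :: "(('q, 'n) tq \<Rightarrow> real) \<Rightarrow> ('q, 'n) tensor02" where
  "hessian_tensor L w X Y = (let \<phi> = (SOME \<phi>. \<phi> \<in> A \<and> fst w \<in> chart_dom \<phi>) in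
     \<Sum>a\<in>UNIV. \<Sum>b\<in>UNIV. X \<phi> $ a * Y \<phi> $ b * V a (V b (fun_coord A L \<phi>)) (chart_map (tangent_chart A \<phi>) w))"

text \<open>The choice of a chart depends on \<open>w\<close> alone, so one chart serves all
  functions and all arguments at \<open>w\<close>.\<close>

lemma hessian_tensor_chart:
  "\<exists>\<phi>\<in>A. fst w \<in> chart_dom \<phi> \<and> (\<forall>L X Y. hessian_tensor L w X Y =
    (\<Sum>a\<in>UNIV. \<Sum>b\<in>UNIV. X \<phi> $ a * Y \<phi> $ b * V a (V b (fun_coord A L \<phi>)) (chart_map (tangent_chart A \<phi>) w)))"
proof -
  define \<phi> where "\<phi> = (SOME \<phi>. \<phi> \<in> A \<and> fst w \<in> chart_dom \<phi>)"
  have "\<exists>\<phi>. \<phi> \<in> A \<and> fst w \<in> chart_dom \<phi>" using ex_chart[of "fst w"] by blast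
  then have "\<phi> \<in> A \<and> fst w \<in> chart_dom \<phi>"
    unfolding \<phi>_def by (rule someI_ex)
  then show ?thesis
    by (intro bexI[of _ \<phi>] conjI) (simp_all add: hessian_tensor_def Let_def flip: \<phi>_def)
qed

lemma hessian_tensor_coord:
  assumes U: "open U" and L: "smooth_function (tangent_atlas A) (tangent_bundle A U) L"
    and \<psi>: "\<psi> \<in> A" and z: "z \<in> chart_image \<psi> U \<times> UNIV"
  shows "tensor_coord A (hessian_tensor L) \<psi> i j z = V i (V j (fun_coord A L \<psi>)) z"
proof -
  let ?w = "chart_inv (tangent_chart A \<psi>) z"
  obtain \<phi> where \<phi>: "\<phi> \<in> A" "fst ?w \<in> chart_dom \<phi>" and H: "\<And>L X Y. hessian_tensor L ?w X Y =
    (\<Sum>a\<in>UNIV. \<Sum>b\<in>UNIV. X \<phi> $ a * Y \<phi> $ b * V a (V b (fun_coord A L \<phi>)) (chart_map (tangent_chart A \<phi>) ?w))"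
    using hessian_tensor_chart[of ?w] by blast
  have w: "fst ?w = chart_inv \<psi> (fst z)"
    using tangent_chart_inv[OF \<psi>, of "fst z" U "snd z"] z by auto
  have z': "z \<in> chart_image \<psi> (U \<inter> chart_dom \<phi>) \<times> UNIV"
    using z \<phi>(2) w mem_chart_image[OF \<psi>] by (simp add: mem_Times_iff)
  interpret T: coordinate_transition "chart_image \<psi> (U \<inter> chart_dom \<phi>)" "chart_image \<phi> (U \<inter> chart_dom \<psi>)" "coord_change \<psi> \<phi>"
    by (rule transition[OF \<psi> \<phi>(1) U])
  have "chart_map (tangent_chart A \<phi>) ?w = prolong (coord_change \<psi> \<phi>) z"
    using tangent_chart_map_inv(1)[OF \<phi>(1) T.prolong_mem[OF z']] tangent_chart_inv_change[OF \<psi> \<phi>(1) z'] by simp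
  moreover have "smooth_on (chart_image \<phi> U \<times> UNIV) (fun_coord A L \<phi>)"
    using L \<phi> by (simp add: smooth_function_iff)
  ultimately show ?thesis
    using hessian_change[OF U _ \<phi>(1) \<psi> z'] by (simp add: tensor_coord_def H)
qed

lemma hessian_tensor_along:
  assumes U: "open U" and L: "smooth_function (tangent_atlas A) (tangent_bundle A U) L"
  shows "tensor02_along A U (hessian_tensor L)"
  unfolding tensor02_along_def
proof (intro conjI ballI allI)
  fix w X X' Y a b
  obtain \<phi> where "\<And>L X Y. hessian_tensor L w X Y =
    (\<Sum>a\<in>UNIV. \<Sum>b\<in>UNIV. X \<phi> $ a * Y \<phi> $ b * V a (V b (fun_coord A L \<phi>)) (chart_map (tangent_chart A \<phi>) w))"
    using hessian_tensor_chart[of w] by blast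
  then show "hessian_tensor L w (\<lambda>\<phi>. a *\<^sub>R X \<phi> + b *\<^sub>R X' \<phi>) Y = a * hessian_tensor L w X Y + b * hessian_tensor L w X' Y"
    "hessian_tensor L w Y (\<lambda>\<phi>. a *\<^sub>R X \<phi> + b *\<^sub>R X' \<phi>) = a * hessian_tensor L w Y X + b * hessian_tensor L w Y X'"
    by (simp_all add: sum.distrib sum_distrib_left algebra_simps)
next
  fix \<psi> i j assume \<psi>: "\<psi> \<in> A"
  interpret W: sode_coords "chart_image \<psi> U \<times> UNIV" "\<lambda>_. 0" by (rule sode_coords_chart[OF \<psi> U])
  have "smooth_on (chart_image \<psi> U \<times> UNIV) (V i (V j (fun_coord A L \<psi>)))"
    using L \<psi> by (intro W.V_smooth) (simp add: smooth_function_iff)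
  then show "smooth_on (chart_image (tangent_chart A \<psi>) (tangent_bundle A U)) (tensor_coord A (hessian_tensor L) \<psi> i j)"
    unfolding tangent_chart_image[OF \<psi>]
    by (rule smooth_on_cong[OF W.open_W, rotated]) (simp add: hessian_tensor_coord[OF U L \<psi>])
qed

lemma hessian_tensor_symmetric:
  assumes U: "open U" and L: "smooth_function (tangent_atlas A) (tangent_bundle A U) L"
  shows "symmetric_tensor A U (hessian_tensor L)"
  unfolding symmetric_tensor_def
proof (intro ballI)
  fix w X Y assume w: "w \<in> tangent_bundle A U"
  obtain \<phi> where \<phi>: "\<phi> \<in> A" "fst w \<in> chart_dom \<phi>" and H: "\<And>L X Y. hessian_tensor L w X Y =
    (\<Sum>a\<in>UNIV. \<Sum>b\<in>UNIV. X \<phi> $ a * Y \<phi> $ b * V a (V b (fun_coord A L \<phi>)) (chart_map (tangent_chart A \<phi>) w))"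
    using hessian_tensor_chart[of w] by blast
  interpret W: sode_coords "chart_image \<phi> U \<times> UNIV" "\<lambda>_. 0" by (rule sode_coords_chart[OF \<phi>(1) U])
  have z: "chart_map (tangent_chart A \<phi>) w \<in> chart_image \<phi> U \<times> UNIV"
    using w \<phi> by (auto simp: tangent_chart_map tangent_bundle_def intro: chart_map_mem)
  have sm: "smooth_on (chart_image \<phi> U \<times> UNIV) (fun_coord A L \<phi>)"
    using L \<phi> by (simp add: smooth_function_iff)
  show "hessian_tensor L w X Y = hessian_tensor L w Y X"
    unfolding H by (subst sum.swap, intro sum.cong refl) (simp add: W.V_commute[OF z sm] mult_ac)
qed

end

lemma (in atlas) smooth_function_mono:
  assumes "smooth_function (tangent_atlas A) (tangent_bundle A U) F" "U' \<subseteq> U"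
  shows "smooth_function (tangent_atlas A) (tangent_bundle A U') F"
  unfolding smooth_function_iff
proof
  fix \<phi> assume "\<phi> \<in> A"
  show "smooth_on (chart_image \<phi> U' \<times> UNIV) (fun_coord A F \<phi>)"
    by (rule smooth_on_subset[of "chart_image \<phi> U \<times> UNIV"])
      (use assms \<open>\<phi> \<in> A\<close> in \<open>auto simp: smooth_function_iff chart_image_def\<close>)
qed

section \<open>From the equations to the tensorial conditions, and back\<close>

context second_order
begin

text \<open>A solution of the second-order equations through \<open>z\<close> also solves the
  dissipative ones; on it the acceleration term of \<open>EL_along_eq_EL\<close> vanishes, and time
  0 gives the value at \<open>z\<close>.\<close>

lemma dissipative_EL_zero:
  assumes U: "open U"
    and L: "smooth_function (tangent_atlas A) (tangent_bundle A U) L"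
    and eqv: "equivalent_systems A \<Gamma> U L D"
    and \<phi>: "\<phi> \<in> A" and z: "z \<in> chart_image \<phi> U \<times> UNIV"
  shows "EL (sode_coeff A \<Gamma> \<phi>) (fun_coord A L \<phi>) (fun_coord A D \<phi>) i z = 0"
proof -
  let ?f = "sode_coeff A \<Gamma> \<phi>" and ?W = "chart_image \<phi> U \<times> (UNIV :: (real^'n) set)"
  have op: "open ?W" using open_chart_image[OF \<phi> U] by (auto intro: open_Times)
  \<comment> \<open>The equation is solved in the chart as a first-order system for position and
    velocity.\<close>
  have "smooth_on ?W (\<lambda>w. (snd w, ?f w))"
    by (intro smooth_on_Pair smooth_on_snd smooth_on_ident sode_coeff_smooth \<phi> U op)
  from smooth_ode_solution[OF op this z]
  obtain h y where h: "h > 0" and y0: "y 0 = z" and yW: "\<And>t. \<bar>t\<bar> < h \<Longrightarrow> y t \<in> ?W"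
    and y': "\<And>t. \<bar>t\<bar> < h \<Longrightarrow> (y has_vector_derivative (snd (y t), ?f (y t))) (at t)"
    and y_smooth: "smooth_on {-h<..<h} y" by metis
  let ?I = "{-h<..<h}"
  have I: "\<bar>t\<bar> < h" if "t \<in> ?I" for t using that by auto
  define c where "c t = chart_inv \<phi> (fst (y t))" for t
  have cU: "c t \<in> chart_dom \<phi>" "c t \<in> U" "chart_map \<phi> (c t) = fst (y t)" if "t \<in> ?I" for t
    using chart_imageD[OF \<phi>, of "fst (y t)" U] yW[OF I[OF that]] by (auto simp: c_def)
  have x_smooth: "smooth_on ?I (\<lambda>t. fst (y t))"
    by (intro smooth_on_fst y_smooth) simp
  have c_cont: "continuous_on ?I c"
    unfolding c_def[abs_def]
  proof (rule continuous_on_compose2[OF homeomorphism_cont2[OF chart_homeomorphism[OF \<phi>]] smooth_on_continuous_on[OF x_smooth]])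
    show "(\<lambda>t. fst (y t)) ` ?I \<subseteq> chart_map \<phi> ` chart_dom \<phi>"
    proof (rule image_subsetI)
      show "fst (y t) \<in> chart_map \<phi> ` chart_dom \<phi>" if "t \<in> ?I" for t
        using imageI[OF cU(1)[OF that], of "chart_map \<phi>"] by (simp only: cU(3)[OF that])
    qed
  qed
  have c_smooth: "smooth_curve A U ?I c"
    unfolding smooth_curve_def
  proof (intro conjI ballI c_cont)
    show "c ` ?I \<subseteq> U" using cU by blast
    fix \<psi> assume \<psi>: "\<psi> \<in> A"
    let ?J = "{t \<in> ?I. c t \<in> chart_dom \<psi>}"
    have J: "open ?J"
      using continuous_open_preimage[OF c_cont _ open_chart_dom[OF \<psi>]] by (simp add: Int_def vimage_def)
    have "smooth_on ?J (\<lambda>t. coord_change \<phi> \<psi> (fst (y t)))"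
    proof (rule smooth_on_compose[OF J open_chart_image[OF \<phi> open_chart_dom[OF \<psi>]] _ _ coord_change_smooth[OF \<phi> \<psi>]])
      show "fst (y t) \<in> chart_image \<phi> (chart_dom \<psi>)" if "t \<in> ?J" for t
        using cU(1,3)[of t] that chart_map_mem[of "c t" \<phi> "chart_dom \<psi>"] by simp
      show "smooth_on ?J (\<lambda>t. fst (y t))" by (rule smooth_on_subset[OF x_smooth]) auto
    qed
    then show "smooth_on ?J (chart_map \<psi> \<circ> c)"
      by (rule smooth_on_cong[OF J, rotated]) (simp add: coord_change_def c_def)
  qed
  interpret C: atlas_curve A U ?I c
    by unfold_locales (use U c_smooth in auto)
  have times: "t \<in> C.chart_times \<phi>" if "t \<in> ?I" for t
    using cU(1)[OF that] that by (simp add: C.chart_times_def)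
  have vel: "velocity \<phi> c t = snd (y t)" if t: "t \<in> ?I" for t
  proof -
    have "((\<lambda>t. fst (y t)) has_vector_derivative snd (y t)) (at t)"
      using bounded_linear.has_vector_derivative[OF bounded_linear_fst y'[OF I[OF t]]] by simp
    then have "((chart_map \<phi> \<circ> c) has_vector_derivative snd (y t)) (at t)"
      by (rule has_vector_derivative_transform_within_open[OF _ _ t]) (simp_all add: cU(3))
    then show ?thesis by (simp add: velocity_def vector_derivative_at)
  qed
  have lift: "lift_coord \<phi> c t = y t" if "t \<in> ?I" for t
    using cU(3)[OF that] vel[OF that] by (simp add: lift_coord_def)
  have acc: "vector_derivative (velocity \<phi> c) (at t) = ?f (y t)" if t: "t \<in> ?I" for t
  proof -
    have "((\<lambda>t. snd (y t)) has_vector_derivative ?f (y t)) (at t)"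
      using bounded_linear.has_vector_derivative[OF bounded_linear_snd y'[OF I[OF t]]] by simp
    then have "(velocity \<phi> c has_vector_derivative ?f (y t)) (at t)"
      by (rule has_vector_derivative_transform_within_open[OF _ _ t]) (simp_all add: vel)
    then show ?thesis by (rule vector_derivative_at)
  qed
  have "sode_solution A \<Gamma> U ?I c"
  proof (rule sode_solution_charts[OF U _ c_smooth])
    show "\<exists>\<phi>\<in>A. c t \<in> chart_dom \<phi> \<and>
        vector_derivative (velocity \<phi> c) (at t) = sode_coeff A \<Gamma> \<phi> (lift_coord \<phi> c t)" if "t \<in> ?I" for t
      using cU(1)[OF that] acc[OF that] lift[OF that] \<phi> by (intro bexI[of _ \<phi>]) simp_all
  qed simp
  then have "dissipative_solution A L D U ?I c"
    using eqv unfolding equivalent_systems_def by (meson is_interval_oo open_greaterThanLessThan)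
  moreover have 0: "0 \<in> ?I" using h by simp
  ultimately have "C.EL_along L D \<phi> i 0 = 0"
    using C.dissipative_solution_iff \<phi> times by blast
  then show ?thesis
    using C.EL_along_eq_EL[OF L \<phi> times[OF 0], of D i ?f] acc[OF 0] lift[OF 0] y0 by simp
qed

text \<open>With the Hessian of \<open>L\<close> as \<open>g\<close>, symmetry of the vertical
  derivative is the commutation of third derivatives. The other two conditions follow from
  \<open>V_EL_symmetric_part\<close> and \<open>EL_curl\<close>, since \<open>EL\<close> and all its
  derivatives vanish.\<close>

lemma dissipative_imp_tensor:
  assumes U: "open U"
    and L: "smooth_function (tangent_atlas A) (tangent_bundle A U) L"
    and D: "smooth_function (tangent_atlas A) (tangent_bundle A U) D"
    and reg: "regular A U L" and eqv: "equivalent_systems A \<Gamma> U L D"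
  defines "g \<equiv> hessian_tensor L"
  shows "tensor02_along A U g" "symmetric_tensor A U g" "nonsingular_tensor A U g"
    "DV_symmetric A U g" "nabla_condition A \<Gamma> U g D" "jacobi_condition A \<Gamma> U g D"
proof -
  show "tensor02_along A U g" "symmetric_tensor A U g"
    unfolding g_def by (rule hessian_tensor_along[OF U L], rule hessian_tensor_symmetric[OF U L])
  note coord = hessian_tensor_coord[OF U L]
  show "nonsingular_tensor A U g"
    using reg by (simp add: nonsingular_tensor_def regular_def g_def tangent_chart_image coord)
  have "(\<forall>i j k. DV_tensor (tensor_coord A g \<phi>) i j k z = DV_tensor (tensor_coord A g \<phi>) j i k z \<and>
        DV_tensor (tensor_coord A g \<phi>) i j k z = DV_tensor (tensor_coord A g \<phi>) i k j z) \<and>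
      (\<forall>i j. nabla_tensor (sode_coeff A \<Gamma> \<phi>) (tensor_coord A g \<phi>) i j z
          = DV_form (DV_fun (fun_coord A D \<phi>)) i j z \<and>
        jacobi_antisym (sode_coeff A \<Gamma> \<phi>) (tensor_coord A g \<phi>) i j z
          = dV_form (dH_fun (sode_coeff A \<Gamma> \<phi>) (fun_coord A D \<phi>)) i j z)"
    if \<phi>: "\<phi> \<in> A" and z: "z \<in> chart_image \<phi> U \<times> UNIV" for \<phi> z
  proof -
    let ?W = "chart_image \<phi> U \<times> (UNIV :: (real^'n) set)"
    let ?f = "sode_coeff A \<Gamma> \<phi>" and ?L = "fun_coord A L \<phi>" and ?D = "fun_coord A D \<phi>"
    interpret W: sode_coords ?W ?f
      by unfold_locales (use \<phi> U sode_coeff_smooth open_chart_image in \<open>auto intro: open_Times\<close>)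
    have sm: "smooth_on ?W ?L" "smooth_on ?W ?D"
      using L D \<phi> by (simp_all add: smooth_function_iff)
    have EL0: "EL ?f ?L ?D i y = 0" if "y \<in> ?W" for i y
      by (rule dissipative_EL_zero[OF U L eqv \<phi> that])
    have g: "tensor_coord A g \<phi> i j y = V i (V j ?L) y" if "y \<in> ?W" for i j y
      using coord[OF \<phi> that] by (simp add: g_def)
    have Vg: "DV_tensor (tensor_coord A g \<phi>) i j k z = V i (V j (V k ?L)) z" for i j k
      unfolding DV_tensor_def by (rule W.V_cong[OF g z])
    have 1: "V i (V j (V k ?L)) z = V j (V i (V k ?L)) z" for i j k
      by (rule W.V_commute[OF z W.V_smooth[OF sm(1)]])
    have 2: "V i (V j (V k ?L)) z = V i (V k (V j ?L)) z" for i j k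
      by (rule W.V_cong[OF W.V_commute[OF _ sm(1)] z])
    have nab: "nabla_tensor ?f (\<lambda>i j. V i (V j ?L)) i j y = V i (V j ?D) y" if y: "y \<in> ?W" for i j y
      using W.V_EL_symmetric_part[OF sm y, of j i] W.V_zero[OF EL0 y] by simp
    have nab_g: "nabla_tensor ?f (tensor_coord A g \<phi>) i j z = V i (V j ?D) z" for i j
      using W.nabla_cong[where g'="\<lambda>i j. V i (V j ?L)", OF g z] nab[OF z] by simp
    have "jacobi_antisym ?f (tensor_coord A g \<phi>) i j z = jacobi_antisym ?f (\<lambda>i j. V i (V j ?L)) i j z" for i j
      using g[OF z] by (simp add: jacobi_antisym_def)
    moreover have "dq i (EL ?f ?L ?D j) z - dq j (EL ?f ?L ?D i) z - sode_derivation ?f (V i (EL ?f ?L ?D j)) z = 0" for i j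
    proof -
      have "sode_derivation ?f (V i (EL ?f ?L ?D j)) z = 0"
        using W.dq_zero[OF W.V_zero[OF EL0] z] W.V_zero[OF W.V_zero[OF EL0] z]
        by (simp add: sode_derivation_def)
      then show ?thesis using W.dq_zero[OF EL0 z] by simp
    qed
    ultimately have "jacobi_antisym ?f (tensor_coord A g \<phi>) i j z = dV_form (dH_fun ?f ?D) i j z" for i j
      using W.EL_curl[OF sm z nab, of i j] by simp
    then show ?thesis
      unfolding Vg nab_g DV_form_def DV_fun_def using 1 2 by blast
  qed
  then show "DV_symmetric A U g" "nabla_condition A \<Gamma> U g D" "jacobi_condition A \<Gamma> U g D"
    unfolding DV_symmetric_def nabla_condition_def jacobi_condition_def Let_def
    by (simp_all add: tangent_chart_image)
qed

text \<open>With \<open>EL\<close> zero, the expressions along a curve are the Hessian applied to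
  the defect of acceleration, and regularity makes one vanish exactly when the other does. One chart
  covers \<open>U\<close>; the remaining charts follow by the transformation laws.\<close>

lemma equivalent_systems_chart:
  assumes U: "open U" and \<phi>: "\<phi> \<in> A" "U \<subseteq> chart_dom \<phi>"
    and L: "smooth_function (tangent_atlas A) (tangent_bundle A U) L"
    and D: "smooth_function (tangent_atlas A) (tangent_bundle A U) D"
    and EL0: "\<And>i z. z \<in> chart_image \<phi> U \<times> UNIV \<Longrightarrow>
      EL (sode_coeff A \<Gamma> \<phi>) (fun_coord A L \<phi>) (fun_coord A D \<phi>) i z = 0"
    and reg: "regular A U L"
  shows "equivalent_systems A \<Gamma> U L D"
  unfolding equivalent_systems_def
proof (intro allI impI)
  fix I :: "real set" and c :: "real \<Rightarrow> 'q" assume "open I \<and> is_interval I"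
  then have I: "open I" by blast
  show "dissipative_solution A L D U I c \<longleftrightarrow> sode_solution A \<Gamma> U I c"
  proof (cases "smooth_curve A U I c")
    case True
    interpret C: atlas_curve A U I c by unfold_locales (use U I True in auto)
    interpret W: sode_coords "chart_image \<phi> U \<times> UNIV" "\<lambda>_. 0" by (rule sode_coords_chart[OF \<phi>(1) U])
    let ?L = "fun_coord A L \<phi>"
    have times: "t \<in> C.chart_times \<phi>" if "t \<in> I" for t
      using True \<phi>(2) that by (auto simp: C.chart_times_def smooth_curve_def)
    have eq: "C.EL_along L D \<phi> i t = (\<Sum>j\<in>UNIV. V j (V i ?L) (lift_coord \<phi> c t)
        * (vector_derivative (velocity \<phi> c) (at t) - sode_coeff A \<Gamma> \<phi> (lift_coord \<phi> c t)) $ j)" if "t \<in> I" for i t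
      using C.EL_along_eq_EL[OF L \<phi>(1) times[OF that], of D i "sode_coeff A \<Gamma> \<phi>"] EL0[OF C.lift_mem'[OF \<phi>(1) times[OF that]]] by simp
    show ?thesis
    proof
      assume dis: "dissipative_solution A L D U I c"
      show "sode_solution A \<Gamma> U I c"
      proof (rule sode_solution_charts[OF U I True])
        fix t assume t: "t \<in> I"
        let ?z = "lift_coord \<phi> c t"
        let ?d = "vector_derivative (velocity \<phi> c) (at t) - sode_coeff A \<Gamma> \<phi> ?z"
        let ?G = "(\<chi> i j. V i (V j ?L) ?z) :: real^'n^'n"
        have z: "?z \<in> chart_image \<phi> U \<times> UNIV" by (rule C.lift_mem'[OF \<phi>(1) times[OF t]])
        have "smooth_on (chart_image \<phi> U \<times> UNIV) ?L" using L \<phi> by (simp add: smooth_function_iff)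
        then have sym: "V j (V i ?L) ?z = V i (V j ?L) ?z" for i j
          by (rule W.V_commute[OF z])
        have "C.EL_along L D \<phi> i t = 0" for i
          using dis C.dissipative_solution_iff \<phi> times[OF t] by blast
        then have "?G *v ?d = 0"
          using eq[OF t] by (simp add: vec_eq_iff matrix_vector_mult_def sym)
        moreover have "invertible ?G"
          using reg z[folded tangent_chart_image[OF \<phi>(1)]] \<phi>(1) unfolding regular_def by blast
        ultimately have "?d = 0"
          using matrix_left_invertible_ker invertible_left_inverse by blast
        then show "\<exists>\<phi>\<in>A. c t \<in> chart_dom \<phi> \<and> vector_derivative (velocity \<phi> c) (at t) = sode_coeff A \<Gamma> \<phi> (lift_coord \<phi> c t)"
          using \<phi>(1) times[OF t] by (intro bexI[of _ \<phi>]) (auto simp: C.chart_times_def)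
      qed
    next
      assume sol: "sode_solution A \<Gamma> U I c"
      have "C.EL_along L D \<psi> i t = 0" if "\<psi> \<in> A" "t \<in> C.chart_times \<psi>" for \<psi> i t
      proof -
        have t: "t \<in> I" using that by (simp add: C.chart_times_def)
        have "C.EL_along L D \<phi> k t = 0" for k
          using eq[OF t] sol \<phi>(1) times[OF t] by (simp add: sode_solution_def C.chart_times_def)
        then show ?thesis
          using C.EL_along_change[OF L D that(1) \<phi>(1) that(2) times[OF t]] by simp
      qed
      then show "dissipative_solution A L D U I c" by (simp add: C.dissipative_solution_iff)
    qed
  qed (simp add: dissipative_solution_def sode_solution_def)
qed

lemma tensor_imp_dissipative:
  assumes U: "open U" "p \<in> U"
    and D: "smooth_function (tangent_atlas A) (tangent_bundle A U) D"
    and g: "tensor02_along A U g" "symmetric_tensor A U g" "nonsingular_tensor A U g"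
      "DV_symmetric A U g" "nabla_condition A \<Gamma> U g D" "jacobi_condition A \<Gamma> U g D"
  shows "\<exists>U'. open U' \<and> p \<in> U' \<and> U' \<subseteq> U \<and>
    (\<exists>L. smooth_function (tangent_atlas A) (tangent_bundle A U') L \<and> regular A U' L \<and>
      equivalent_systems A \<Gamma> U' L D)"
proof -
  obtain \<phi> where \<phi>: "\<phi> \<in> A" "p \<in> chart_dom \<phi>" using ex_chart by blast
  have "chart_map \<phi> p \<in> chart_image \<phi> U" by (rule chart_map_mem[OF \<phi>(2) U(2)])
  then obtain e where e: "e > 0" "ball (chart_map \<phi> p) e \<subseteq> chart_image \<phi> U"
    using open_chart_image[OF \<phi>(1) U(1)] openE by blast
  \<comment> \<open>A ball is taken because \<open>local_lagrangian\<close> needs a convex set; its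
    preimage is the shrunken neighbourhood.\<close>
  define B where "B = ball (chart_map \<phi> p) e"
  define U' where "U' = {q \<in> chart_dom \<phi>. chart_map \<phi> q \<in> B}"
  have U': "open U'"
    using continuous_open_preimage[OF chart_map_continuous[OF \<phi>(1)] open_chart_dom[OF \<phi>(1)], of B]
    by (simp add: U'_def B_def Int_def vimage_def)
  have pU': "p \<in> U'" using \<phi> e by (simp add: U'_def B_def)
  have sub: "U' \<subseteq> U" "U' \<subseteq> chart_dom \<phi>"
    using e chart_imageD(2)[OF \<phi>(1)] chart_inv_map[OF \<phi>(1)] by (auto simp: U'_def B_def) (metis in_mono mem_ball)
  have image: "chart_image \<phi> U' = B"
    using e chart_imageD[OF \<phi>(1)] by (auto simp: U'_def B_def chart_image_def)
  have imageU: "B \<subseteq> chart_image \<phi> U" using e by (simp add: B_def)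
  have in_W: "z \<in> chart_image \<phi> U \<times> UNIV" if "fst z \<in> B" for z :: "'n tcoords" using that imageU by (auto simp: mem_Times_iff)
  let ?f = "sode_coeff A \<Gamma> \<phi>" and ?g = "tensor_coord A g \<phi>" and ?D = "fun_coord A D \<phi>"
  have "\<exists>L. smooth_on (B \<times> UNIV) L \<and> (\<forall>i j z. fst z \<in> B \<longrightarrow> V i (V j L) z = ?g i j z) \<and>
    (\<forall>i z. fst z \<in> B \<longrightarrow> EL ?f L ?D i z = 0)"
  proof (rule local_lagrangian)
    show "open B" "convex B" "chart_map \<phi> p \<in> B" using e by (auto simp: B_def)
    have subW: "B \<times> UNIV \<subseteq> chart_image \<phi> U \<times> (UNIV :: (real^'n) set)" using imageU by auto
    show "smooth_on (B \<times> UNIV) ?f"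
      by (rule smooth_on_subset[OF sode_coeff_smooth[OF \<phi>(1) U(1)] subW])
    show "smooth_on (B \<times> UNIV) ?D"
      by (rule smooth_on_subset[OF _ subW]) (use D \<phi> in \<open>simp add: smooth_function_iff\<close>)
    show "smooth_on (B \<times> UNIV) (?g i j)" for i j
      by (rule smooth_on_subset[OF _ subW])
        (use g(1) \<phi> in \<open>simp add: tensor02_along_def flip: tangent_chart_image\<close>)
    fix i j k and z :: "'n tcoords" assume z: "fst z \<in> B"
    note zW = in_W[OF z]
    note zC = zW[folded tangent_chart_image[OF \<phi>(1)]]
    show "?g i j z = ?g j i z"
    proof -
      have w: "chart_inv (tangent_chart A \<phi>) z \<in> tangent_bundle A U"
        using tangent_chart_map_inv(2)[OF \<phi>(1) zW] by (auto simp: tangent_bundle_def)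
      have x: "fst z \<in> chart_image \<phi> U" using zW by auto
      have "fst (chart_inv (tangent_chart A \<phi>) z) = chart_inv \<phi> (fst z)"
        using tangent_chart_inv[OF \<phi>(1) x, of "snd z"] by simp
      then have "coord_vec A \<phi> (fst z) k \<in> tangent_space A (fst (chart_inv (tangent_chart A \<phi>) z))" for k
        using tangent_vector_mem[OF \<phi>(1) chart_imageD(1)[OF \<phi>(1) x]] by (simp add: coord_vec_eq[OF \<phi>(1) x])
      then show ?thesis
        using g(2) w unfolding symmetric_tensor_def tensor_coord_def by blast
    qed
    show "V i (?g j k) z = V j (?g i k) z"
      using g(4) \<phi>(1) zC unfolding DV_symmetric_def Let_def DV_tensor_def by blast
    show "nabla_tensor ?f ?g i j z = V i (V j ?D) z"
      using g(5) \<phi>(1) zC unfolding nabla_condition_def DV_form_def DV_fun_def by blast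
    show "jacobi_antisym ?f ?g i j z = dV_form (dH_fun ?f ?D) i j z"
      using g(6) \<phi>(1) zC unfolding jacobi_condition_def by blast
  qed
  then obtain Lc where Lc: "smooth_on (B \<times> UNIV) Lc" and H: "\<And>i j z. fst z \<in> B \<Longrightarrow> V i (V j Lc) z = ?g i j z"
    and E: "\<And>i z. fst z \<in> B \<Longrightarrow> EL ?f Lc ?D i z = 0" by blast
  \<comment> \<open>The values away from the fibres over \<open>U'\<close> are arbitrary; smoothness
    and regularity are claimed over \<open>U'\<close> only.\<close>
  define L where "L w = Lc (chart_map (tangent_chart A \<phi>) w)" for w
  interpret W: sode_coords "B \<times> UNIV" "?f"
    using sode_coeff_smooth[OF \<phi>(1) U'] image by unfold_locales (auto simp: B_def intro: open_Times)
  have L\<phi>: "fun_coord A L \<phi> z = Lc z" if "z \<in> B \<times> UNIV" for z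
    using tangent_chart_map_inv(1)[OF \<phi>(1), of z U'] that image by (simp add: fun_coord_def L_def)
  have L\<phi>_smooth: "smooth_on (chart_image \<phi> U' \<times> UNIV) (fun_coord A L \<phi>)"
    unfolding image by (rule smooth_on_cong[OF W.open_W _ Lc]) (simp add: L\<phi>)
  have full: "U' \<inter> chart_dom \<phi> = U'" using sub by blast
  have L: "smooth_function (tangent_atlas A) (tangent_bundle A U') L"
    unfolding smooth_function_iff
  proof
    fix \<psi> assume \<psi>: "\<psi> \<in> A"
    interpret T: coordinate_transition "chart_image \<psi> U'" "chart_image \<phi> (U' \<inter> chart_dom \<psi>)" "coord_change \<psi> \<phi>"
      using transition[OF \<psi> \<phi>(1) U'] full by simp
    have "smooth_on (chart_image \<phi> (U' \<inter> chart_dom \<psi>) \<times> UNIV) (fun_coord A L \<phi>)"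
      by (rule smooth_on_subset[OF L\<phi>_smooth]) (auto simp: chart_image_def)
    from T.comp_prolong_smooth[OF this]
    show "smooth_on (chart_image \<psi> U' \<times> UNIV) (fun_coord A L \<psi>)"
      by (rule smooth_on_cong[OF T.opens(1), rotated]) (use fun_coord_change[OF \<psi> \<phi>(1), of _ U' L] full in simp)
  qed
  have D': "smooth_function (tangent_atlas A) (tangent_bundle A U') D"
    by (rule smooth_function_mono[OF D sub(1)])
  have HL: "V i (V j (fun_coord A L \<phi>)) z = ?g i j z" if z: "z \<in> B \<times> UNIV" for i j z
  proof -
    have "V i (V j (fun_coord A L \<phi>)) z = V i (V j Lc) z"
      by (intro W.V_cong L\<phi> z; assumption)
    then show ?thesis using H[of z i j] z by auto
  qed
  have reg: "regular A U' L"
    unfolding regular_def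
  proof (intro ballI)
    fix \<psi> z assume \<psi>: "\<psi> \<in> A" and "z \<in> chart_image (tangent_chart A \<psi>) (tangent_bundle A U')"
    then have z: "z \<in> chart_image \<psi> U' \<times> UNIV" by (simp add: tangent_chart_image)
    then have zU: "z \<in> chart_image \<psi> U \<times> UNIV" using chart_image_mono[OF sub(1), of \<psi>] by auto
    let ?w = "chart_inv (tangent_chart A \<psi>) z" and ?z' = "prolong (coord_change \<psi> \<phi>) z"
    interpret T: coordinate_transition "chart_image \<psi> U'" "chart_image \<phi> (U' \<inter> chart_dom \<psi>)" "coord_change \<psi> \<phi>"
      using transition[OF \<psi> \<phi>(1) U'] full by simp
    have z': "?z' \<in> chart_image \<phi> (U' \<inter> chart_dom \<psi>) \<times> UNIV" by (rule T.prolong_mem[OF z])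
    then have z'B: "?z' \<in> B \<times> UNIV"
      using image chart_image_mono[of "U' \<inter> chart_dom \<psi>" U' \<phi>] by auto
    have "?w = chart_inv (tangent_chart A \<phi>) ?z'"
      using tangent_chart_inv_change[OF \<psi> \<phi>(1), of z U'] z full by simp
    then have wz: "chart_map (tangent_chart A \<phi>) ?w = ?z'"
      using tangent_chart_map_inv(1)[OF \<phi>(1) z'] by simp
    have "?w \<in> tangent_bundle A (chart_dom \<psi> \<inter> U')" by (rule tangent_chart_map_inv(2)[OF \<psi> z])
    then have w: "?w \<in> tangent_bundle A U" "fst ?w \<in> chart_dom \<phi>"
      using sub by (auto simp: tangent_bundle_def)
    have x: "fst z \<in> chart_image \<psi> U'" using z by auto
    have "fst ?w = chart_inv \<psi> (fst z)"
      using tangent_chart_inv[OF \<psi> x, of "snd z"] by simp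
    then have cv: "coord_vec A \<psi> (fst z) k \<in> tangent_space A (fst ?w)" for k
      using tangent_vector_mem[OF \<psi> chart_imageD(1)[OF \<psi> x]] by (simp add: coord_vec_eq[OF \<psi> x])
    \<comment> \<open>Both sides have the same transformation law and agree in the chart \<phi>.
      Thus non-singularity of \<open>g\<close> in the chart \<psi> can be used directly, without
      inverting a Jacobian.\<close>
    have "V i (V j (fun_coord A L \<psi>)) z = tensor_coord A g \<psi> i j z" for i j
    proof -
      have "tensor_coord A g \<psi> i j z = (\<Sum>a\<in>UNIV. \<Sum>b\<in>UNIV. coord_vec A \<psi> (fst z) i \<phi> $ a
          * coord_vec A \<psi> (fst z) j \<phi> $ b * ?g a b ?z')"
        unfolding tensor_coord_def[of A g \<psi>] using tensor_expand[OF g(1) w(1) \<phi>(1) w(2) cv cv] wz by simp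
      then show ?thesis
        using hessian_change[OF U' L\<phi>_smooth \<phi>(1) \<psi>, of z i j] full z HL[OF z'B] by simp
    qed
    moreover have "invertible ((\<chi> i j. tensor_coord A g \<psi> i j z) :: real^'n^'n)"
      using g(3) \<psi> zU[folded tangent_chart_image[OF \<psi>]] unfolding nonsingular_tensor_def by blast
    ultimately show "invertible ((\<chi> i j. V i (V j (fun_coord A L \<psi>)) z) :: real^'n^'n)" by simp
  qed
  have "EL ?f (fun_coord A L \<phi>) ?D i z = 0" if z: "z \<in> chart_image \<phi> U' \<times> UNIV" for i z
  proof -
    have zB: "z \<in> B \<times> UNIV" using z image by simp
    have V: "V i (fun_coord A L \<phi>) y = V i Lc y" if "y \<in> B \<times> UNIV" for y
      by (intro W.V_cong L\<phi> that; assumption)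
    have "sode_derivation ?f (V i (fun_coord A L \<phi>)) z = sode_derivation ?f (V i Lc) z"
      by (intro W.sode_cong V zB; assumption)
    moreover have "dq i (fun_coord A L \<phi>) z = dq i Lc z"
      by (intro W.dq_cong L\<phi> zB; assumption)
    ultimately show ?thesis
      using E[of z i] zB by (auto simp: EL_def)
  qed
  then have "equivalent_systems A \<Gamma> U' L D"
    by (rule equivalent_systems_chart[OF U' \<phi>(1) sub(2) L D' _ reg])
  then show ?thesis using U' pU' sub(1) L reg by blast
qed

end

text \<open>The two conditions are equivalent at each point separately: one implication keeps both
  \<open>U\<close> and \<open>D\<close>, the other shrinks \<open>U\<close> and restricts
  \<open>D\<close>.\<close>

theorem theorem1:
  fixes A :: "('q::{t2_space, second_countable_topology}, real^'n) chart set"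
    and \<Gamma> :: "('q, 'n::finite) tq_field"
  assumes "smooth_atlas A"
    and "second_order_field A \<Gamma>"
  shows "(\<forall>p. \<exists>U. open U \<and> p \<in> U \<and>
            (\<exists>L D. smooth_function (tangent_atlas A) (tangent_bundle A U) L \<and>
                   smooth_function (tangent_atlas A) (tangent_bundle A U) D \<and>
                   regular A U L \<and>
                   equivalent_systems A \<Gamma> U L D))
     \<longleftrightarrow>
         (\<forall>p. \<exists>U. open U \<and> p \<in> U \<and>
            (\<exists>D g. smooth_function (tangent_atlas A) (tangent_bundle A U) D \<and>
                   tensor02_along A U g \<and>
                   symmetric_tensor A U g \<and>
                   nonsingular_tensor A U g \<and>
                   DV_symmetric A U g \<and>
                   nabla_condition A \<Gamma> U g D \<and>
                   jacobi_condition A \<Gamma> U g D))"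
    (is "(\<forall>p. ?dissipative p) \<longleftrightarrow> (\<forall>p. ?tensor p)")
proof -
  interpret second_order A \<Gamma> by unfold_locales (rule assms)+
  have 1: "?tensor p" if "?dissipative p" for p
  proof -
    from that obtain U L D where *: "open U" "p \<in> U"
      "smooth_function (tangent_atlas A) (tangent_bundle A U) L"
      "smooth_function (tangent_atlas A) (tangent_bundle A U) D"
      "regular A U L" "equivalent_systems A \<Gamma> U L D" by blast
    show ?thesis
      using dissipative_imp_tensor[OF *(1,3-6)] *(1,2,4) by blast
  qed
  have 2: "?dissipative p" if "?tensor p" for p
  proof -
    from that obtain U D g where *: "open U" "p \<in> U"
      "smooth_function (tangent_atlas A) (tangent_bundle A U) D"
      "tensor02_along A U g" "symmetric_tensor A U g" "nonsingular_tensor A U g"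
      "DV_symmetric A U g" "nabla_condition A \<Gamma> U g D" "jacobi_condition A \<Gamma> U g D" by blast
    from tensor_imp_dissipative[OF *] obtain U' L where "open U'" "p \<in> U'" "U' \<subseteq> U"
      "smooth_function (tangent_atlas A) (tangent_bundle A U') L" "regular A U' L"
      "equivalent_systems A \<Gamma> U' L D" by blast
    moreover from this(3) have "smooth_function (tangent_atlas A) (tangent_bundle A U') D"
      by (rule smooth_function_mono[OF *(3)])
    ultimately show ?thesis by blast
  qed
  show ?thesis
  proof (intro iffI allI)
    show "?tensor p" if "\<forall>p. ?dissipative p" for p by (rule 1[OF spec[OF that]])
    show "?dissipative p" if "\<forall>p. ?tensor p" for p by (rule 2[OF spec[OF that]])
  qed
qed


end
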